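(* The shuffle relations $\mathrm{sh}_I=0$ among the Plücker coordinates give a set of generators for the degree-one part of the ideal defining the affine Grassmannian $\widehat{\mathrm{Gr}}_0(n)$ inside the infinite Grassmannian $\mathrm{Gr}_0(\infty)$.
   Context: $K$ is an algebraically closed field of arbitrary characteristic, $A=K[[t]]$, $F=K((t))$, $n\ge1$. An $A$-lattice in $F^n$ is a free $A$-submodule of rank $n$; $L_1=A^n$ with standard basis $e_1,\dots,e_n$. Under $e_{cn+i}\leftrightarrow t^ce_i$ ($1\le i\le n$, $c\in\mathbb{Z}$), $F^n$ is identified with $K^\infty=\{\sum_{j\ge N}a_je_j: N\in\mathbb{Z},\,a_j\in K\}$. Let $E_k=\{\sum_{j\ge k}a_je_j\}$, so $E_1=L_1$. The infinite Grassmannian $\mathrm{Gr}_0(\infty)$ is the set of subspaces $V\subset K^\infty$ with $E_m\subset V\subset E_{-m}$ for some $m$ and virtual dimension $\dim(V/V\cap E_1)-\dim(E_1/V\cap E_1)=0$; the affine Grassmannian $\widehat{\mathrm{Gr}}_0(n)\subset\mathrm{Gr}_0(\infty)$ is the set of those $V$ that are $t$-stable, i.e. the $A$-lattices of virtual dimension $0$. For $s\ge1$ put $r=sn$ and $V_s=t^{-s(n-1)}L_1/t^sL_1$. Then $\wedge^\infty V_\infty=\varinjlim\wedge^{sn}V_s$ along the maps $\wedge^{sn}V_s\to\wedge^{(s+1)n}V_{s+1}$, $v_1\wedge\dots\wedge v_{sn}\mapsto v_1\wedge\dots\wedge v_{sn}\wedge t^se_1\wedge\dots\wedge t^se_n$.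 Sending $V$ with $t^{-s(n-1)}L_1\supset V\supset t^sL_1$ to $V/t^sL_1\in\mathrm{Gr}(sn,V_s)\subset\mathbb{P}(\wedge^{sn}V_s)$ makes $\widehat{\mathrm{Gr}}_0(n)\subset\mathrm{Gr}_0(\infty)$ closed Ind-subvarieties of $\mathbb{P}(\wedge^\infty V_\infty)=\bigcup_s\mathbb{P}(\wedge^{sn}V_s)$, with homogeneous coordinate ring defined as an inverse limit over $s$. Let $X(w_s)\subset\widehat{\mathrm{Gr}}_0(n)$ be the (reduced) affine Schubert variety of all $A$-lattices $L$ with $t^{-s(n-1)}L_1\supset L\supset t^sL_1$ and $\dim(L/t^sL_1)=sn$; $\widehat{\mathrm{Gr}}_0(n)$ is the direct limit of the $X(w_s)$. Plücker coordinates: for each $s$, renormalize indices by multiplying by $t^{s(n-1)}$, so that $V_s$ has basis indexed by $1,\dots,rn$, the index $cn+i$ ($0\le c\le r-1$, $1\le i\le n$) standing for the class of $t^{c-s(n-1)}e_i$. An $r$-tuple $I=(i_1<\dots<i_r)$ in $\{1,\dots,rn\}$ gives the usual Plücker coordinate $p_I$ on $\mathrm{Gr}(r,V_s)$ (the $r\times r$ minor with rows $I$); it is the restriction of the infinite Plücker coordinate indexed by the sequence $(i_1,\dots,i_r,rn+1,rn+2,\dots)$ (in renormalized indices). One has $p_I|_{X(w_s)}\ne0$ if and only if $i_j\ge(j-1)n+1$ for $1\le j\le r$. Shuffles: let $I=(i_1<\dots<i_r)$ be such that $p_I|_{X(w_s)}\ne0$ (so that $i_r\le rn$), and suppose $i_1\ge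 n+1$. Put $\widetilde I=(i_1-n,\dots,i_r-n)$ and choose $\ell$ with $1\le\ell\le r$. The shuffle is the sum of all Plücker coordinates obtained by replacing $\ell$ elements $J\subset I$ by the corresponding $\ell$ elements $\widetilde J\subset\widetilde I$: $$\mathrm{sh}_I=\sum_{J\subset I,\ |J|=\ell}p_{I\setminus J\cup\widetilde J},$$ where each term is the minor whose rows are those of $I$ with row $i$ replaced, in its position, by row $i-n$ for every $i\in J$. The shuffles vanish identically on $X(w_s)$. *)

theory Defs
  imports
    "HOL-Computational_Algebra.Formal_Laurent_Series"
    "HOL-Library.Function_Algebras"
    "Jordan_Normal_Form.Determinant"
begin

text \<open>
  \<open>K\<close> is the coefficient type, \<open>A = K[[t]]\<close> the type of formal power series and \<open>F = K((t))\<close> the type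
  of formal Laurent series, \<open>t\<close> being \<^const>\<open>fls_X\<close>. An element of \<open>F\<^sup>n\<close> is a function on the natural
  numbers that vanishes outside \<open>{1..n}\<close>.
\<close>

type_synonym 'a lvec = "nat \<Rightarrow> 'a fls"

definition scaleF :: "'a::field \<Rightarrow> 'a lvec \<Rightarrow> 'a lvec" where
  "scaleF c v = (\<lambda>i. fls_const c * v i)"

interpretation lvec: vector_space "scaleF :: 'a::field \<Rightarrow> 'a lvec \<Rightarrow> 'a lvec"
  by unfold_locales
    (auto simp: scaleF_def fun_eq_iff algebra_simps simp flip: fls_const_mult_const fls_plus_const)

definition Fspace :: "nat \<Rightarrow> 'a::field lvec set" where
  "Fspace n = {v. \<forall>i. i \<notin> {1..n} \<longrightarrow> v i = 0}"

definition tpow :: "int \<Rightarrow> 'a::field lvec \<Rightarrow> 'a lvec" where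
  "tpow c v = (\<lambda>i. fls_X_intpow c * v i)"

definition L1 :: "nat \<Rightarrow> 'a::field lvec set" where
  "L1 n = {v \<in> Fspace n. \<forall>i. v i \<in> range fps_to_fls}"

definition unit_lvec :: "nat \<Rightarrow> 'a::field lvec" where
  "unit_lvec i = (\<lambda>k. if k = i then 1 else 0)"

text \<open>
  The coordinate of \<open>v\<close> at \<open>e\<^sub>j\<close>: writing \<open>j = c n + i\<close> with \<open>1 \<le> i \<le> n\<close>, it is the coefficient
  of \<open>t\<^sup>c\<close> in the \<open>i\<close>-th component. This identifies \<open>F\<^sup>n\<close> with \<open>K\<^sup>\<infinity>\<close>.
\<close>

definition coord :: "nat \<Rightarrow> 'a::field lvec \<Rightarrow> int \<Rightarrow> 'a" where
  "coord n v j = fls_nth (v (nat ((j - 1) mod int n) + 1)) ((j - 1) div int n)"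

definition E :: "nat \<Rightarrow> int \<Rightarrow> 'a::field lvec set" where
  "E n k = {v \<in> Fspace n. \<forall>j<k. coord n v j = 0}"

text \<open>The classes of the entries of \<open>bs\<close> form a \<open>K\<close>-basis of the quotient \<open>V/W\<close>.\<close>

definition quot_basis :: "'a::field lvec set \<Rightarrow> 'a lvec set \<Rightarrow> 'a lvec list \<Rightarrow> bool" where
  "quot_basis V W bs \<longleftrightarrow> set bs \<subseteq> V \<and>
     (\<forall>v\<in>V. \<exists>!c. length c = length bs \<and> v - (\<Sum>k<length bs. scaleF (c ! k) (bs ! k)) \<in> W)"

definition quot_dim :: "'a::field lvec set \<Rightarrow> 'a lvec set \<Rightarrow> nat \<Rightarrow> bool" where
  "quot_dim V W d \<longleftrightarrow> (\<exists>bs. quot_basis V W bs \<and> length bs = d)"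

definition virtual_dim :: "nat \<Rightarrow> 'a::field lvec set \<Rightarrow> int \<Rightarrow> bool" where
  "virtual_dim n V k \<longleftrightarrow>
     (\<exists>p q. quot_dim V (V \<inter> E n 1) p \<and> quot_dim (E n 1) (V \<inter> E n 1) q \<and> int p - int q = k)"

definition Gr_inf :: "nat \<Rightarrow> 'a::field lvec set set" where
  "Gr_inf n = {V. lvec.subspace V \<and> (\<exists>m. E n m \<subseteq> V \<and> V \<subseteq> E n (- m)) \<and> virtual_dim n V 0}"

definition Gr_aff :: "nat \<Rightarrow> 'a::field lvec set set" where
  "Gr_aff n = {V \<in> Gr_inf n. \<forall>v\<in>V. tpow 1 v \<in> V}"

definition in_level :: "nat \<Rightarrow> nat \<Rightarrow> 'a::field lvec set \<Rightarrow> bool" where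
  "in_level n s V \<longleftrightarrow>
     V \<subseteq> tpow (- (int s * (int n - 1))) ` L1 n \<and> tpow (int s) ` L1 n \<subseteq> V"

definition X_schubert :: "nat \<Rightarrow> nat \<Rightarrow> 'a::field lvec set set" where
  "X_schubert n s = {L \<in> Gr_aff n. in_level n s L \<and> quot_dim L (tpow (int s) ` L1 n) (s * n)}"

text \<open>
  The points of the affine cone over the part of \<open>Y\<close> at level \<open>s\<close>: a list \<open>vs\<close> stands for the
  decomposable vector \<open>v\<^sub>1 \<and> \<dots> \<and> v\<^sub>s\<^sub>n\<close> of \<open>\<and>\<^sup>s\<^sup>n V\<^sub>s\<close> that represents \<open>V / t\<^sup>s L\<^sub>1\<close>.
\<close>

definition frames :: "nat \<Rightarrow> nat \<Rightarrow> 'a::field lvec set set \<Rightarrow> 'a lvec list set" where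
  "frames n s Y = {vs. \<exists>V\<in>Y. in_level n s V \<and> quot_basis V (tpow (int s) ` L1 n) vs}"

text \<open>
  The indices \<open>j\<close> of the basis vectors \<open>e\<^sub>j\<close> that survive in \<open>V\<^sub>s\<close>. Indices are not renormalized here;
  adding \<open>s n (n - 1)\<close> turns this interval into \<open>{1..s n\<^sup>2}\<close>.
\<close>

definition level_idx :: "nat \<Rightarrow> nat \<Rightarrow> int set" where
  "level_idx n s = {1 - int s * int n * (int n - 1) .. int s * int n}"

text \<open>
  The minor with the given list of rows, as a function on the cone over the Grassmannian at level
  \<open>s\<close>; functions on this cone are extended by zero. The list need not be sorted, and a
  repeated row gives zero.
\<close>

definition plucker :: "nat \<Rightarrow> nat \<Rightarrow> int list \<Rightarrow> 'a::field lvec list \<Rightarrow> 'a" where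
  "plucker n s js vs =
     (if vs \<in> frames n s (Gr_inf n)
      then det (mat (length js) (length vs) (\<lambda>(j, k). coord n (vs ! k) (js ! j)))
      else 0)"

definition scale_form :: "'a::field \<Rightarrow> ('a lvec list \<Rightarrow> 'a) \<Rightarrow> 'a lvec list \<Rightarrow> 'a" where
  "scale_form c f = (\<lambda>vs. c * f vs)"

interpretation form: vector_space
    "scale_form :: 'a::field \<Rightarrow> ('a lvec list \<Rightarrow> 'a) \<Rightarrow> 'a lvec list \<Rightarrow> 'a"
  by unfold_locales (auto simp: scale_form_def fun_eq_iff algebra_simps)

definition level_sets :: "nat \<Rightarrow> nat \<Rightarrow> int set set" where
  "level_sets n s = {I. I \<subseteq> level_idx n s \<and> card I = s * n}"

definition level_forms :: "nat \<Rightarrow> nat \<Rightarrow> ('a::field lvec list \<Rightarrow> 'a) set" where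
  "level_forms n s = form.span ((\<lambda>I. plucker n s (sorted_list_of_set I)) ` level_sets n s)"

text \<open>
  The degree-one part of the homogeneous coordinate ring of \<open>Gr\<^sub>0(\<infinity>)\<close>: the inverse limit over
  \<open>s \<ge> 1\<close> of the spaces of linear forms, along the transposes of
  \<open>v\<^sub>1 \<and> \<dots> \<and> v\<^sub>s\<^sub>n \<mapsto> v\<^sub>1 \<and> \<dots> \<and> v\<^sub>s\<^sub>n \<and> t\<^sup>s e\<^sub>1 \<and> \<dots> \<and> t\<^sup>s e\<^sub>n\<close>. The unused
  component \<open>f 0\<close> is set to zero.
\<close>

definition coord_ring1 :: "nat \<Rightarrow> (nat \<Rightarrow> 'a::field lvec list \<Rightarrow> 'a) set" where
  "coord_ring1 n = {f. f 0 = 0 \<and> (\<forall>s\<ge>1. f s \<in> level_forms n s) \<and>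
     (\<forall>s\<ge>1. \<forall>vs \<in> frames n s (Gr_inf n).
        f s vs = f (Suc s) (vs @ map (\<lambda>i. tpow (int s) (unit_lvec i)) [1..<Suc n]))}"

definition ideal1 :: "nat \<Rightarrow> (nat \<Rightarrow> 'a::field lvec list \<Rightarrow> 'a) set" where
  "ideal1 n = {f \<in> coord_ring1 n. \<forall>s\<ge>1. \<forall>vs \<in> frames n s (Gr_aff n). f s vs = 0}"

text \<open>
  The closure, in the inverse limit topology, of the \<open>K\<close>-span of \<open>G\<close>. Each level is
  finite-dimensional and discrete, and component \<open>s\<close> of a form determines the components below it,
  so it suffices to approximate at one level \<open>s\<close> at a time.
\<close>

definition closed_span ::
    "nat \<Rightarrow> (nat \<Rightarrow> 'a::field lvec list \<Rightarrow> 'a) set \<Rightarrow> (nat \<Rightarrow> 'a lvec list \<Rightarrow> 'a) set" where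
  "closed_span n G = {f \<in> coord_ring1 n. \<forall>s\<ge>1. f s \<in> form.span ((\<lambda>g. g s) ` G)}"

definition shuffle :: "nat \<Rightarrow> nat \<Rightarrow> int set \<Rightarrow> nat \<Rightarrow> 'a::field lvec list \<Rightarrow> 'a" where
  "shuffle n s I l =
     (\<Sum>J | J \<subseteq> I \<and> card J = l.
        plucker n s (map (\<lambda>i. if i \<in> J then i - int n else i) (sorted_list_of_set I)))"

text \<open>
  The second conjunct says that the Pluecker coordinate of \<open>I\<close> does not vanish identically on
  \<open>X(w\<^sub>s)\<close>, the third that all shifted indices stay in range (\<open>i\<^sub>1 \<ge> n + 1\<close> after
  renormalization).
\<close>

definition shuffle_index :: "'a::field itself \<Rightarrow> nat \<Rightarrow> nat \<Rightarrow> int set \<Rightarrow> bool" where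
  "shuffle_index K n s I \<longleftrightarrow> I \<in> level_sets n s \<and>
     (\<exists>vs \<in> frames n s (X_schubert n s). plucker n s (sorted_list_of_set I) vs \<noteq> (0::'a)) \<and>
     (\<forall>i\<in>I. i - int n \<in> level_idx n s)"

text \<open>
  The shuffle of \<open>I\<close> as an element of the inverse limit. The tuple \<open>I\<close> at level \<open>s\<close> and the tuple
  \<open>I \<union> {s n + 1, \<dots>, s' n}\<close> at level \<open>s' \<ge> s\<close> have the same infinite Pluecker coordinate. Terms
  in which \<open>J\<close> meets the added tail restrict to zero at level \<open>s\<close>, but they cannot be omitted at the
  higher levels: without them the sum need not vanish on \<open>X(w\<^sub>s\<^sub>')\<close>.
\<close>

definition shuffle_relations :: "nat \<Rightarrow> (nat \<Rightarrow> 'a::field lvec list \<Rightarrow> 'a) set" where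
  "shuffle_relations n = {f \<in> coord_ring1 n. \<exists>s I l. 1 \<le> s \<and> shuffle_index TYPE('a) n s I \<and>
     1 \<le> l \<and> l \<le> s * n \<and>
     (\<forall>s'\<ge>s. f s' = shuffle n s' (I \<union> {int (s * n) + 1 .. int (s' * n)}) l)}"

end

theory Submission
  imports Defs
begin

text \<open>
  Linear forms correspond to coefficient functions on charge-zero Maya diagrams. A shuffle is a
  coefficient in \<open>z\<close> of the pullback of a Pluecker coordinate under \<open>1 + z t\<close>, which fixes every
  \<open>t\<close>-stable lattice and acts on it with determinant one, so the shuffles vanish.

  Conversely, order diagrams by the sum of the squares of their elements. If a diagram has a gap of more
  than \<open>n\<close> between consecutive elements, some shuffle has it as leading term. The other diagrams
  correspond to \<open>n\<close>-restricted partitions, and their Pluecker coordinates are independent on the affine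
  Grassmannian by the ladder argument of James, Lascoux, Leclerc and Thibon: the annihilator of the
  affine Grassmannian is stable under the transposed divided powers of the Chevalley operators, because
  the affine root subgroups preserve the affine Grassmannian and \<open>K\<close> is infinite; undoing the ladders of
  a restricted diagram with these operators reduces its coefficient to that of the vacuum.
\<close>

text \<open>Levels are the main obstacle: a form is an inverse system, a shuffle is prescribed only
  from some level on, and lowering indices leaves a level from below. One coefficient function on
  Maya diagrams restricts to every level at once, which is why forms are handled through it. The
  terms of a shuffle all have the same sum of elements, and so do the diagrams that a divided power
  combines, hence the sum cannot single out a leading term. The sum of squares can: lowering
  \<open>i\<close> by \<open>n\<close> adds \<open>n^2 - 2 n i\<close>, lowering it by one subtracts
  \<open>2 i - 1\<close>, so for a fixed number of moves only the sum of the moved indices matters,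
  and extremal choices are unique. This is supplied, from some level on, by applying the operators
  to the delta function of the diagram. Divided powers arise as coefficients of polynomials in
  \<open>z\<close>; no factorial is inverted, so the characteristic is arbitrary. For
  \<open>n = 1\<close> consecutive indices are congruent and the operators degenerate, but then the
  vacuum is the only diagram of every level.\<close>

section \<open>Minors and determinants of sums\<close>

lemma permutes_less_bound: "p permutes {0..<m::nat} \<Longrightarrow> i < m \<Longrightarrow> p i < m"
  using permutes_in_image[of p "{0..<m}" i] by simp

lemma infinite_alg_closed_field: "infinite (UNIV :: 'a::alg_closed_field set)"
proof
  assume fin: "finite (UNIV :: 'a set)"
  define q :: "'a poly" where "q = (\<Prod>a\<in>UNIV. [:- a, 1:])"
  have deg: "degree q = card (UNIV :: 'a set)"
    unfolding q_def by (subst degree_prod_eq_sum_degree) auto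
  have "card (UNIV :: 'a set) > 0" using fin by (simp add: card_gt_0_iff)
  then have "degree (q + 1) > 0" using deg by (simp add: degree_add_eq_left)
  then obtain x where "poly (q + 1) x = 0" using alg_closed_imp_poly_has_root by blast
  moreover have "poly q x = 0" unfolding q_def poly_prod by (rule prod_zero[OF fin]) auto
  ultimately show False by simp
qed

lemma sum_powers_eq_0_imp_coeff_0:
  fixes c :: "nat \<Rightarrow> 'a::alg_closed_field"
  assumes "\<And>z. (\<Sum>k\<le>m. z ^ k * c k) = 0" and "k \<le> m"
  shows "c k = 0"
proof -
  define p where "p = (\<Sum>k\<le>m. monom (c k) k)"
  have "poly p z = 0" for z
    using assms(1)[of z] by (simp add: p_def poly_sum poly_monom mult.commute)
  then have "p = 0" using poly_roots_finite[of p] infinite_alg_closed_field by fastforce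
  moreover have "coeff p k = c k" using assms(2) by (simp add: p_def coeff_sum if_distrib cong: if_cong)
  ultimately show ?thesis by simp
qed

text \<open>Replaces a unipotence argument: it will show that the determinant of
  \<open>1 + z t\<close> on a quotient of a lattice does not depend on \<open>z\<close>.\<close>

lemma nonvanishing_poly_fun_const:
  fixes c :: "nat \<Rightarrow> 'a::alg_closed_field"
  assumes "\<And>z. (\<Sum>k\<le>m. z ^ k * c k) \<noteq> 0"
  shows "(\<Sum>k\<le>m. z ^ k * c k) = c 0"
proof -
  define p where "p = (\<Sum>k\<le>m. monom (c k) k)"
  have p: "poly p z = (\<Sum>k\<le>m. z ^ k * c k)" for z
    by (simp add: p_def poly_sum poly_monom mult.commute)
  have "degree p = 0" using assms alg_closed_imp_poly_has_root[of p] unfolding p[symmetric] by auto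
  then obtain a where a: "p = [:a:]" using degree_eq_zeroE by blast
  have "(\<Sum>k\<le>m. 0 ^ k * c k) = (\<Sum>k\<in>{0}. 0 ^ k * c k)" by (rule sum.mono_neutral_right) auto
  then have "poly p 0 = c 0" unfolding p by simp
  then show ?thesis unfolding p[symmetric] a by simp
qed

lemma det_not_square: "nr \<noteq> nc \<Longrightarrow> det (mat nr nc f) = 0"
  by (simp add: det_def)

lemma det_mat:
  "det (mat m m f) = (\<Sum>p | p permutes {0..<m}. of_int (sign p) * (\<Prod>i = 0..<m. f (i, p i)))"
proof -
  have "det (mat m m f) =
      (\<Sum>p | p permutes {0..<m}. of_int (sign p) * (\<Prod>i = 0..<m. mat m m f $$ (i, p i)))"
    by (rule det_def') simp
  also have "\<dots> = (\<Sum>p | p permutes {0..<m}. of_int (sign p) * (\<Prod>i = 0..<m. f (i, p i)))"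
  proof (rule sum.cong[OF refl])
    fix p assume "p \<in> {p. p permutes {0..<m}}"
    then have "p i < m" if "i < m" for i using permutes_less_bound that by blast
    then have "(\<Prod>i = 0..<m. mat m m f $$ (i, p i)) = (\<Prod>i = 0..<m. f (i, p i))"
      by (intro prod.cong) auto
    then show "of_int (sign p) * (\<Prod>i = 0..<m. mat m m f $$ (i, p i)) =
        of_int (sign p) * (\<Prod>i = 0..<m. f (i, p i))" by simp
  qed
  finally show ?thesis .
qed

text \<open>Multilinearity in the rows. The coefficient of \<open>z ^ l\<close> collects the
  replacements of \<open>l\<close> rows; shuffles and divided powers are both instances.\<close>

lemma det_add_scaled_rows:
  fixes A B :: "nat \<Rightarrow> nat \<Rightarrow> 'a::comm_ring_1"
  shows "det (mat m m (\<lambda>(i, j). A i j + z * B i j)) =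
    (\<Sum>J\<in>Pow {0..<m}. z ^ card J * det (mat m m (\<lambda>(i, j). if i \<in> J then B i j else A i j)))"
proof -
  let ?P = "\<lambda>J p. \<Prod>i\<in>{0..<m}. if i \<in> J then B i (p i) else A i (p i)"
  let ?D = "\<lambda>J. det (mat m m (\<lambda>(i, j). if i \<in> J then B i j else A i j))"
  have expand: "(\<Prod>i\<in>{0..<m}. A i (p i) + z * B i (p i)) =
      (\<Sum>J\<in>Pow {0..<m}. z ^ card J * ?P J p)"
    for p
  proof -
    have "(\<Prod>i\<in>{0..<m}. z * B i (p i) + A i (p i)) =
      (\<Sum>J\<in>Pow {0..<m}. (\<Prod>i\<in>J. z * B i (p i)) * (\<Prod>i\<in>{0..<m} - J. A i (p i)))"
      by (rule prod_add) simp
    also have "\<dots> =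
      (\<Sum>J\<in>Pow {0..<m}. z ^ card J * ?P J p)"
    proof (rule sum.cong[OF refl])
      fix J assume "J \<in> Pow {0..<m}"
      then have J: "J \<subseteq> {0..<m}" by simp
      then have "{0..<m} \<inter> {i. i \<in> J} = J" "{0..<m} \<inter> - {i. i \<in> J} = {0..<m} - J" by auto
      then show "(\<Prod>i\<in>J. z * B i (p i)) * (\<Prod>i\<in>{0..<m} - J. A i (p i)) =
          z ^ card J * ?P J p"
        by (subst prod.If_cases) (auto simp: prod.distrib mult.assoc)
    qed
    finally show ?thesis by (simp add: add.commute)
  qed
  have "det (mat m m (\<lambda>(i, j). A i j + z * B i j)) =
    (\<Sum>p\<in>{p. p permutes {0..<m}}. of_int (sign p) * (\<Prod>i\<in>{0..<m}. A i (p i) + z * B i (p i)))"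
    by (simp add: det_mat)
  also have "\<dots> = (\<Sum>p\<in>{p. p permutes {0..<m}}. \<Sum>J\<in>Pow {0..<m}.
      z ^ card J * (of_int (sign p) * ?P J p))"
    unfolding expand sum_distrib_left by (simp add: ac_simps)
  also have "\<dots> = (\<Sum>J\<in>Pow {0..<m}. z ^ card J * (\<Sum>p\<in>{p. p permutes {0..<m}}.
      of_int (sign p) * ?P J p))"
    by (subst sum.swap) (simp add: sum_distrib_left)
  also have "\<dots> = (\<Sum>J\<in>Pow {0..<m}. z ^ card J *
      ?D J)"
    by (simp add: det_mat)
  finally show ?thesis .
qed

text \<open>Since \<open>js\<close> is distinct, sets of row positions can be traded for sets of row
  labels, the form in which shuffles are written.\<close>

lemma det_add_scaled_rows_list:
  fixes F G :: "'b \<Rightarrow> nat \<Rightarrow> 'a::comm_ring_1"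
  assumes "distinct js"
  shows "det (mat (length js) m (\<lambda>(j, k). F (js ! j) k + z * G (js ! j) k)) =
    (\<Sum>J\<in>Pow (set js). z ^ card J *
       det (mat (length js) m (\<lambda>(j, k). if js ! j \<in> J then G (js ! j) k else F (js ! j) k)))"
proof (cases "length js = m")
  case True
  have inj: "inj_on ((!) js) {0..<m}" using assms True by (auto intro: inj_on_nth)
  have img: "(!) js ` {0..<m} = set js" using True by (auto simp: set_conv_nth)
  have bij: "bij_betw (image ((!) js)) (Pow {0..<m}) (Pow (set js))"
    using bij_betw_Pow[of "(!) js" "{0..<m}" "set js"] inj img by (auto simp: bij_betw_def)
  have "(\<Sum>J\<in>Pow {0..<m}. z ^ card J *
       det (mat m m (\<lambda>(j, k). if j \<in> J then G (js ! j) k else F (js ! j) k))) =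
    (\<Sum>J\<in>Pow {0..<m}. z ^ card ((!) js ` J) *
       det (mat m m (\<lambda>(j, k). if js ! j \<in> (!) js ` J then G (js ! j) k else F (js ! j) k)))"
  proof (rule sum.cong[OF refl])
    fix J assume "J \<in> Pow {0..<m}"
    then have J: "J \<subseteq> {0..<m}" by simp
    have "card ((!) js ` J) = card J" using inj J by (meson card_image inj_on_subset)
    moreover have "js ! j \<in> (!) js ` J \<longleftrightarrow> j \<in> J" if "j < m" for j
      using inj J that by (meson atLeastLessThan_iff inj_on_image_mem_iff zero_le)
    then have "mat m m (\<lambda>(j, k). if j \<in> J then G (js ! j) k else F (js ! j) k) =
      mat m m (\<lambda>(j, k). if js ! j \<in> (!) js ` J then G (js ! j) k else F (js ! j) k)"
      by (intro eq_matI) auto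
    ultimately show "z ^ card J * det (mat m m (\<lambda>(j, k). if j \<in> J then G (js ! j) k else F (js ! j) k)) =
      z ^ card ((!) js ` J) *
       det (mat m m (\<lambda>(j, k). if js ! j \<in> (!) js ` J then G (js ! j) k else F (js ! j) k))" by simp
  qed
  also have "\<dots> = (\<Sum>J\<in>Pow (set js). z ^ card J *
       det (mat m m (\<lambda>(j, k). if js ! j \<in> J then G (js ! j) k else F (js ! j) k)))"
    by (rule sum.reindex_bij_betw[OF bij])
  finally show ?thesis unfolding True by (simp only: det_add_scaled_rows)
qed (simp add: det_not_square)

lemma det_zero_row:
  assumes "i < m" and "\<And>k. k < m' \<Longrightarrow> f (i, k) = (0::'a::comm_ring_1)"
  shows "det (mat m m' f) = 0"
proof (cases "m = m'")
  case True
  have "(\<Prod>j = 0..<m. f (j, p j)) = 0" if "p permutes {0..<m}" for p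
  proof (rule prod_zero)
    have "f (i, p i) = 0" using assms True permutes_less_bound[OF that assms(1)] by simp
    then show "\<exists>j\<in>{0..<m}. f (j, p j) = 0" using assms(1) by (intro bexI[of _ i]) auto
  qed simp
  then show ?thesis unfolding True[symmetric] det_mat by (intro sum.neutral) auto
qed (simp add: det_not_square)

lemma det_zero_column:
  assumes "k < m'" and "\<And>i. i < m \<Longrightarrow> f (i, k) = (0::'a::comm_ring_1)"
  shows "det (mat m m' f) = 0"
proof (cases "m = m'")
  case True
  have "det (transpose_mat (mat m m f)) = 0"
    unfolding transpose_mat_def using assms True
    by (intro det_zero_row[of k]) auto
  then show ?thesis using det_transpose[of "mat m m f" m] True by simp
qed (simp add: det_not_square)

section \<open>Coordinates of vectors in \<open>F\<^sup>n\<close>\<close>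

lemma coord_add: "coord n (v + w) j = coord n v j + coord n w j"
  by (simp add: coord_def)

lemma coord_diff: "coord n (v - w) j = coord n v j - coord n w j"
  by (simp add: coord_def)

lemma coord_0 [simp]: "coord n 0 j = 0"
  by (simp add: coord_def)

lemma coord_scaleF: "coord n (scaleF c v) j = c * coord n v j"
  by (simp add: coord_def scaleF_def)

lemma coord_sum: "coord n (sum f A) j = (\<Sum>x\<in>A. coord n (f x) j)"
  by (rule sum_comp_morphism[of "\<lambda>v. coord n v j" f A, unfolded o_def, symmetric]) (rule coord_0, rule coord_add)

lemmas coord_simps = coord_add coord_diff coord_scaleF coord_sum

lemma fls_nth_X_intpow_times: "fls_nth (fls_X_intpow c * (f :: 'a::field fls)) k = fls_nth f (k - c)"
  by (subst fls_X_intpow_times_conv_shift(1)) simp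

lemma coord_tpow:
  assumes "n \<ge> 1"
  shows "coord n (tpow c v) j = coord n v (j - c * int n)"
proof -
  have "j - c * int n - 1 = (j - 1) + (- c) * int n" by simp
  then have "(j - c * int n - 1) div int n = (j - 1) div int n - c"
      "(j - c * int n - 1) mod int n = (j - 1) mod int n"
    using div_mult_self1[of "int n" "j - 1" "- c"] mod_mult_self1[of "j - 1" "- c" "int n"] assms
    by (simp_all only:)
  then show ?thesis
    by (simp add: coord_def tpow_def fls_nth_X_intpow_times)
qed

lemma coord_component:
  assumes "i \<in> {1..n}"
  shows "coord n v (c * int n + int i) = fls_nth (v i) c"
proof -
  have "int i - 1 + c * int n = c * int n + int i - 1" "0 \<le> int i - 1" "int i - 1 < int n"
    using assms by auto
  then have "(c * int n + int i - 1) mod int n = int i - 1" "(c * int n + int i - 1) div int n = c"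
    by (metis mod_mult_self1 mod_pos_pos_trivial,
        metis add.commute add.left_neutral div_mult_self1 div_pos_pos_trivial not_le)
  moreover have "nat (int i - 1) + 1 = i" using assms by auto
  ultimately show ?thesis by (simp add: coord_def)
qed

lemma lvec_eqI:
  assumes "v \<in> Fspace n" "w \<in> Fspace n" and "\<And>j. coord n v j = coord n w j"
  shows "v = w"
proof
  fix i
  show "v i = w i"
  proof (cases "i \<in> {1..n}")
    case True
    show ?thesis
      using coord_component[OF True, of v] coord_component[OF True, of w] assms(3)
      by (intro fls_eqI) metis
  qed (use assms in \<open>auto simp: Fspace_def\<close>)
qed

lemma subspace_Fspace: "lvec.subspace (Fspace n)"
  by (auto simp: lvec.subspace_def Fspace_def scaleF_def)

lemma subspace_E: "lvec.subspace (E n k)"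
  using subspace_Fspace[of n] by (auto simp: lvec.subspace_def E_def coord_simps)

lemma E_mono: "k \<le> l \<Longrightarrow> E n l \<subseteq> E n k"
  by (auto simp: E_def)

lemma E_subset_Fspace: "E n k \<subseteq> Fspace n"
  by (auto simp: E_def)

lemma tpow_Fspace: "v \<in> Fspace n \<Longrightarrow> tpow c v \<in> Fspace n"
  by (auto simp: Fspace_def tpow_def)

lemma range_fps_to_fls_iff: "f \<in> range fps_to_fls \<longleftrightarrow> (\<forall>k<0. fls_nth f k = 0)"
proof
  assume "\<forall>k<0. fls_nth f k = 0"
  then have "0 \<le> fls_subdegree f" by (metis fls_subdegree_ge0I)
  then show "f \<in> range fps_to_fls" by (metis fls_regpart_to_fls_trivial rangeI)
qed auto

text \<open>Turns the lattice bounds of a level into index bounds: \<open>c = s\<close> gives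
  \<open>E n (s n + 1)\<close>, and \<open>c = - s (n - 1)\<close> gives
  \<open>E n (low n s)\<close>.\<close>

lemma tpow_L1:
  assumes "n \<ge> 1"
  shows "tpow c ` L1 n = E n (c * int n + 1)"
proof
  show "tpow c ` L1 n \<subseteq> E n (c * int n + 1)"
  proof
    fix w assume "w \<in> tpow c ` L1 n"
    then obtain v where v: "v \<in> L1 n" "w = tpow c v" by blast
    have "coord n v j = 0" if "j < 1" for j
    proof -
      have "(j - 1) div int n < 0" using that assms by (simp add: div_neg_pos_less0)
      then show ?thesis using v(1) by (auto simp: coord_def L1_def range_fps_to_fls_iff)
    qed
    then show "w \<in> E n (c * int n + 1)"
      using v tpow_Fspace by (auto simp: E_def coord_tpow[OF assms] L1_def)
  qed
  show "E n (c * int n + 1) \<subseteq> tpow c ` L1 n"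
  proof
    fix w assume w: "w \<in> E n (c * int n + 1)"
    have 1: "w = tpow c (tpow (- c) w)"
      by (auto simp: tpow_def fun_eq_iff fls_nth_X_intpow_times intro!: fls_eqI)
    have "tpow (- c) w \<in> L1 n"
      unfolding L1_def mem_Collect_eq range_fps_to_fls_iff
    proof (intro conjI allI impI)
      show F: "tpow (- c) w \<in> Fspace n" using w by (auto simp: E_def tpow_Fspace)
      fix i k :: int and i' assume "k < 0"
      show "fls_nth (tpow (- c) w i') k = 0"
      proof (cases "i' \<in> {1..n}")
        case True
        have "k * int n + int i' \<le> 0"
        proof -
          have "k * int n \<le> (-1) * int n" using \<open>k < 0\<close> by (intro mult_right_mono) auto
          then show ?thesis using True by auto
        qed
        then have "coord n (tpow (- c) w) (k * int n + int i') = 0"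
          using w unfolding coord_tpow[OF assms] E_def by auto
        then show ?thesis using coord_component[OF True] by metis
      next
        case False
        then show ?thesis using F by (auto simp: Fspace_def)
      qed
    qed
    then show "w \<in> tpow c ` L1 n" using 1 by blast
  qed
qed

section \<open>The basis vectors \<open>e_j\<close> and the index shift\<close>

definition basis_vec :: "nat \<Rightarrow> int \<Rightarrow> 'a::field lvec" where
  "basis_vec n j = tpow ((j - 1) div int n) (unit_lvec (nat ((j - 1) mod int n) + 1))"

lemma basis_vec_Fspace:
  assumes "n \<ge> 1" shows "basis_vec n j \<in> Fspace n"
proof -
  have "nat ((j - 1) mod int n) < n" using assms by (simp add: nat_less_iff)
  then show ?thesis unfolding basis_vec_def
    by (intro tpow_Fspace) (auto simp: Fspace_def unit_lvec_def)
qed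

lemma coord_basis_vec:
  assumes "n \<ge> 1" shows "coord n (basis_vec n j) i = (if i = j then 1 else 0)"
proof -
  define c r where "c = (j - 1) div int n" and "r = (j - 1) mod int n"
  have j: "j = c * int n + r + 1" by (simp add: c_def r_def)
  have r: "0 \<le> r" "r < int n" using assms by (auto simp: r_def)
  define k where "k = i - c * int n"
  have "coord n (unit_lvec (nat r + 1) :: 'a lvec) k = (if k = r + 1 then 1 else 0)"
  proof (cases "(k - 1) mod int n = r")
    case True
    then have k: "k - 1 = ((k - 1) div int n) * int n + r" by (metis div_mult_mod_eq)
    have "(k - 1) div int n = 0 \<longleftrightarrow> k = r + 1" using k r assms by (auto simp: algebra_simps)
    then show ?thesis using True by (auto simp: coord_def unit_lvec_def)
  next
    case False
    then have "k \<noteq> r + 1" using r by auto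
    moreover have "nat ((k - 1) mod int n) \<noteq> nat r"
      using False r assms by (metis eq_nat_nat_iff pos_mod_sign of_nat_0_less_iff less_eq_Suc_le One_nat_def)
    ultimately show ?thesis by (simp add: coord_def unit_lvec_def)
  qed
  moreover have "coord n (basis_vec n j :: 'a lvec) i = coord n (unit_lvec (nat r + 1)) k"
    unfolding basis_vec_def coord_tpow[OF assms] c_def r_def k_def ..
  ultimately show ?thesis using j by (auto simp: k_def)
qed

lemma basis_vec_in_E: "n \<ge> 1 \<Longrightarrow> k \<le> j \<Longrightarrow> basis_vec n j \<in> E n k"
  by (auto simp: E_def basis_vec_Fspace coord_basis_vec)

lemma tail_basis_vec:
  assumes "n \<ge> 1"
  shows "map (\<lambda>i. tpow (int s) (unit_lvec i)) [1..<Suc n] = map (basis_vec n) [int (s*n) + 1..int (s*n) + int n]"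
proof (rule nth_equalityI)
  fix i assume "i < length (map (\<lambda>i. tpow (int s) (unit_lvec i :: 'a lvec)) [1..<Suc n])"
  then have i: "i < n" by (simp del: upt_Suc)
  have "(int (s*n) + int i) div int n = int s" "(int (s*n) + int i) mod int n = int i"
    using i by simp_all
  then show "map (\<lambda>i. tpow (int s) (unit_lvec i)) [1..<Suc n] ! i =
      (map (basis_vec n) [int (s*n) + 1..int (s*n) + int n] ! i :: 'a lvec)"
    using i by (simp add: basis_vec_def nth_append del: upt_Suc)
qed simp

text \<open>The map sending \<open>e_j\<close> to \<open>e_(j-1)\<close>. It is linear over
  \<open>F\<close>; the factor \<open>fls_X_intpow (- 1)\<close> occurs because the vector after
  \<open>t^c e_n\<close> is \<open>t^(c+1) e_1\<close>.\<close>

definition shift1 :: "nat \<Rightarrow> 'a::field lvec \<Rightarrow> 'a lvec" where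
  "shift1 n v = (\<lambda>i. if 1 \<le> i \<and> i < n then v (i + 1) else if i = n then fls_X_intpow (- 1) * v 1 else 0)"

lemma coord_shift1:
  assumes "n \<ge> 1" shows "coord n (shift1 n v) j = coord n v (j + 1)"
proof -
  define c r where "c = (j - 1) div int n" and "r = (j - 1) mod int n"
  have j: "j = c * int n + (r + 1)" by (simp add: c_def r_def)
  have r: "0 \<le> r" "r < int n" using assms by (auto simp: r_def)
  define i where "i = nat (r + 1)"
  have i: "i \<in> {1..n}" "j = c * int n + int i" using r j by (auto simp: i_def)
  have L: "coord n (shift1 n v) j = fls_nth (shift1 n v i) c" unfolding i(2) by (rule coord_component[OF i(1)])
  show ?thesis
  proof (cases "i < n")
    case True
    then have "coord n v (j + 1) = fls_nth (v (i + 1)) c"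
      using coord_component[of "i + 1" n v c] i by (simp add: algebra_simps)
    then show ?thesis unfolding L using True i by (simp add: shift1_def)
  next
    case False
    then have "i = n" using i by simp
    then have "j + 1 = (c + 1) * int n + int 1" using i by (simp add: algebra_simps)
    then have "coord n v (j + 1) = fls_nth (v 1) (c + 1)"
      using coord_component[of 1 n v "c + 1"] assms by simp
    moreover have "shift1 n v i = fls_X_intpow (- 1) * v 1" using \<open>i = n\<close> by (simp only: shift1_def) simp
    ultimately show ?thesis unfolding L by (simp only: fls_nth_X_intpow_times) simp
  qed
qed

abbreviation in_class :: "nat \<Rightarrow> nat \<Rightarrow> int \<Rightarrow> bool" where
  "in_class n p j \<equiv> (j - 1) mod int n = int p - 1"

text \<open>
  The element \<open>e\<^sub>j\<^sub>+\<^sub>1 \<mapsto> e\<^sub>j\<^sub>+\<^sub>1 + z e\<^sub>j\<close>, for all \<open>j\<close> congruent to \<open>p\<close> modulo \<open>n\<close>, of an affine root subgroup.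
\<close>

definition root_op :: "nat \<Rightarrow> nat \<Rightarrow> 'a \<Rightarrow> 'a::field lvec \<Rightarrow> 'a lvec" where
  "root_op n p z v = (\<lambda>i. v i + (if i = p then fls_const z * shift1 n v i else 0))"

lemma coord_root_op:
  assumes "1 \<le> p" "p \<le> n"
  shows "coord n (root_op n p z v) j =
    coord n v j + (if in_class n p j then z * coord n v (j + 1) else 0)"
proof -
  have n: "n \<ge> 1" using assms by simp
  have "nat ((j - 1) mod int n) + 1 = p \<longleftrightarrow> in_class n p j"
    using assms n by (auto simp: nat_eq_iff)
  then show ?thesis
    using coord_shift1[OF n, of v j] by (auto simp: coord_def root_op_def)
qed

lemma root_op_Fspace: "1 \<le> p \<Longrightarrow> p \<le> n \<Longrightarrow> v \<in> Fspace n \<Longrightarrow> root_op n p z v \<in> Fspace n"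
  by (auto simp: Fspace_def root_op_def)

text \<open>Linearity over \<open>F\<close> is what makes the image of a \<open>t\<close>-stable
  lattice \<open>t\<close>-stable again.\<close>

lemma root_op_tpow: "root_op n p z (tpow c v) = tpow c (root_op n p z v)"
  by (auto simp: root_op_def tpow_def shift1_def fun_eq_iff algebra_simps)

lemma root_op_0 [simp]: "root_op n p z 0 = 0"
  by (auto simp: root_op_def shift1_def fun_eq_iff)

lemma root_op_add: "root_op n p z (v + w) = root_op n p z v + root_op n p z w"
  by (auto simp: root_op_def shift1_def fun_eq_iff algebra_simps)

lemma root_op_scaleF: "root_op n p z (scaleF c v) = scaleF c (root_op n p z v)"
  by (auto simp: root_op_def shift1_def scaleF_def fun_eq_iff algebra_simps)

lemma root_op_sum: "root_op n p z (sum f A) = (\<Sum>x\<in>A. root_op n p z (f x))"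
  by (rule sum_comp_morphism[of "root_op n p z" f A, unfolded o_def, symmetric]) (rule root_op_0, rule root_op_add)

lemma tpow_0 [simp]: "tpow c 0 = 0"
  by (auto simp: tpow_def fun_eq_iff)

lemma tpow_add: "tpow c (v + w) = tpow c v + tpow c w"
  by (auto simp: tpow_def fun_eq_iff algebra_simps)

lemma tpow_diff: "tpow c (v - w) = tpow c v - tpow c w"
  by (auto simp: tpow_def fun_eq_iff algebra_simps)

lemma tpow_scaleF: "tpow c (scaleF a v) = scaleF a (tpow c v)"
  by (auto simp: tpow_def scaleF_def fun_eq_iff algebra_simps)

lemma tpow_sum: "tpow c (sum f A) = (\<Sum>x\<in>A. tpow c (f x))"
  by (rule sum_comp_morphism[of "tpow c" f A, unfolded o_def, symmetric]) (rule tpow_0, rule tpow_add)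

section \<open>Lattices spanned by finite families\<close>

definition lincomb :: "(nat \<Rightarrow> 'a::field) \<Rightarrow> 'a lvec list \<Rightarrow> 'a lvec" where
  "lincomb c vs = (\<Sum>k<length vs. scaleF (c k) (vs ! k))"

definition indep_list :: "'a::field lvec list \<Rightarrow> bool" where
  "indep_list vs \<longleftrightarrow> (\<forall>c. lincomb c vs = 0 \<longrightarrow> (\<forall>k<length vs. c k = 0))"

lemma lincomb_cong: "(\<And>k. k < length vs \<Longrightarrow> c k = d k) \<Longrightarrow> lincomb c vs = lincomb d vs"
  by (auto simp: lincomb_def intro!: sum.cong)

lemma lincomb_diff: "lincomb (\<lambda>k. c k - d k) vs = lincomb c vs - lincomb d vs"
  by (simp add: lincomb_def lvec.scale_left_diff_distrib sum_subtractf)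

lemma lincomb_append:
  "lincomb c (vs @ ws) = lincomb c vs + lincomb (\<lambda>k. c (length vs + k)) ws"
proof -
  have "(\<Sum>k<length vs + m. f k) = (\<Sum>k<length vs. f k) + (\<Sum>k<m. f (length vs + k))"
    for m and f :: "nat \<Rightarrow> 'a lvec"
    by (induction m) (auto simp: add.assoc)
  then show ?thesis by (simp add: lincomb_def nth_append)
qed

lemma coord_lincomb: "coord n (lincomb c vs) j = (\<Sum>k<length vs. c k * coord n (vs ! k) j)"
  by (simp add: lincomb_def coord_simps)

lemma lincomb_in_span: "lincomb c vs \<in> lvec.span (set vs)"
  unfolding lincomb_def by (intro lvec.span_sum lvec.span_scale lvec.span_base) auto

lemma span_set_imp_lincomb:
  assumes "v \<in> lvec.span (set vs)" obtains c where "v = lincomb c vs"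
proof -
  have "\<exists>c. v = lincomb c vs" using assms
  proof (induction rule: lvec.span_induct_alt)
    case base
    then show ?case by (intro exI[of _ "\<lambda>_. 0"]) (simp add: lincomb_def)
  next
    case (step a x y)
    then obtain c k where c: "y = lincomb c vs" and k: "k < length vs" "x = vs ! k"
      by (auto simp: in_set_conv_nth)
    have "lincomb (c(k := c k + a)) vs = (\<Sum>j<length vs. scaleF (c j) (vs ! j) + (if j = k then scaleF a x else 0))"
      unfolding lincomb_def by (intro sum.cong) (auto simp: k lvec.scale_left_distrib)
    also have "\<dots> = scaleF a x + y"
      using k by (simp add: sum.distrib c lincomb_def add.commute)
    finally show ?case by metis
  qed
  then show ?thesis using that by blast
qed

lemma indep_list_iff: "indep_list vs \<longleftrightarrow> distinct vs \<and> lvec.independent (set vs)"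
proof
  assume ind: "indep_list vs"
  have dist: "distinct vs"
  proof (rule ccontr)
    assume "\<not> distinct vs"
    then obtain i j where ij: "i < length vs" "j < length vs" "i \<noteq> j" "vs ! i = vs ! j"
      by (auto simp: distinct_conv_nth)
    have "lincomb (\<lambda>k. (if k = i then 1 else 0) - (if k = j then 1 else 0)) vs = 0"
    proof -
      have 1: "lincomb (\<lambda>k. if k = i then 1 else 0) vs = vs ! i" if "i < length vs" for i
      proof -
        have "lincomb (\<lambda>k. if k = i then 1 else 0) vs = (\<Sum>k<length vs. if k = i then vs ! i else 0)"
          unfolding lincomb_def by (intro sum.cong) auto
        then show ?thesis using that by simp
      qed
      show ?thesis unfolding lincomb_diff using 1[OF ij(1)] 1[OF ij(2)] ij(4) by simp
    qed
    then show False using ind ij unfolding indep_list_def by fastforce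
  qed
  have "lvec.independent (set vs)"
  proof (rule lvec.independent_if_scalars_zero)
    fix f x assume *: "(\<Sum>x\<in>set vs. scaleF (f x) x) = 0" "x \<in> set vs"
    have "lincomb (\<lambda>k. f (vs ! k)) vs = (\<Sum>x\<in>set vs. scaleF (f x) x)"
      unfolding lincomb_def
      by (rule sum.reindex_bij_betw[OF bij_betw_nth[OF dist refl refl]])
    then show "f x = 0" using ind * by (fastforce simp: indep_list_def in_set_conv_nth)
  qed simp
  then show "distinct vs \<and> lvec.independent (set vs)" using dist by simp
next
  assume "distinct vs \<and> lvec.independent (set vs)"
  then have dist: "distinct vs" and ind: "lvec.independent (set vs)" by auto
  show "indep_list vs" unfolding indep_list_def
  proof (intro allI impI)
    fix c k assume *: "lincomb c vs = 0" "k < length vs"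
    have bij: "bij_betw ((!) vs) {..<length vs} (set vs)" by (rule bij_betw_nth[OF dist refl refl])
    define u where "u x = c (the_inv_into {..<length vs} ((!) vs) x)" for x
    have u: "u (vs ! k) = c k" if "k < length vs" for k
      unfolding u_def using bij that by (simp add: bij_betw_def the_inv_into_f_f)
    have "(\<Sum>x\<in>set vs. scaleF (u x) x) = (\<Sum>k<length vs. scaleF (u (vs ! k)) (vs ! k))"
      by (rule sum.reindex_bij_betw[OF bij, symmetric])
    also have "\<dots> = 0" using * u by (simp add: lincomb_def)
    finally have "u (vs ! k) = 0" 
      using lvec.independentD[OF ind finite_set subset_refl] *(2) nth_mem by blast
    then show "c k = 0" using u *(2) by simp
  qed
qed

text \<open>Replaces the unique coefficient lists of \<open>quot_basis\<close> by spanning and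
  independence, for which the library's linear algebra is available.\<close>

lemma quot_basisI:
  assumes "lvec.subspace W" "set bs \<subseteq> V"
    and "\<And>v. v \<in> V \<Longrightarrow> \<exists>u\<in>lvec.span (set bs). v - u \<in> W"
    and "indep_list bs" "lvec.span (set bs) \<inter> W \<subseteq> {0}"
  shows "quot_basis V W bs"
  unfolding quot_basis_def
proof (intro conjI ballI)
  have lc: "(\<Sum>k<length bs. scaleF (c ! k) (bs ! k)) = lincomb ((!) c) bs" for c
    by (simp add: lincomb_def)
  fix v assume "v \<in> V"
  then obtain c where c: "v - lincomb c bs \<in> W" using assms(3) by (metis span_set_imp_lincomb)
  show "\<exists>!c. length c = length bs \<and> v - (\<Sum>k<length bs. scaleF (c ! k) (bs ! k)) \<in> W"
    unfolding lc
  proof (rule ex1I[of _ "map c [0..<length bs]"])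
    have "lincomb ((!) (map c [0..<length bs])) bs = lincomb c bs" by (intro lincomb_cong) simp
    then show "length (map c [0..<length bs]) = length bs \<and> v - lincomb ((!) (map c [0..<length bs])) bs \<in> W"
      using c by simp
  next
    fix d assume d: "length d = length bs \<and> v - lincomb ((!) d) bs \<in> W"
    have "lincomb (\<lambda>k. c k - d ! k) bs \<in> W"
      using lvec.subspace_diff[OF assms(1) conjunct2[OF d] c] unfolding lincomb_diff by simp
    then have "lincomb (\<lambda>k. c k - d ! k) bs = 0" using assms(5) lincomb_in_span by blast
    then have "\<forall>k<length bs. c k - d ! k = 0" using assms(4) unfolding indep_list_def by blast
    then show "d = map c [0..<length bs]" using d by (intro nth_equalityI) auto
  qed
qed (use assms in auto)

lemma quot_basis_repr:
  assumes "quot_basis V W bs" "v \<in> V" obtains c where "v - lincomb c bs \<in> W"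
  using assms unfolding quot_basis_def lincomb_def by metis

lemma quot_basis_unique:
  assumes "quot_basis V W bs" "v \<in> V" "v - lincomb c bs \<in> W" "v - lincomb d bs \<in> W" "k < length bs"
  shows "c k = d k"
proof -
  have "\<exists>!c. length c = length bs \<and> v - (\<Sum>k<length bs. scaleF (c ! k) (bs ! k)) \<in> W"
    using assms(1,2) by (auto simp: quot_basis_def)
  moreover have "length (map c [0..<length bs]) = length bs \<and>
      v - (\<Sum>k<length bs. scaleF (map c [0..<length bs] ! k) (bs ! k)) \<in> W"
    using assms(3) by (simp add: lincomb_def)
  moreover have "length (map d [0..<length bs]) = length bs \<and>
      v - (\<Sum>k<length bs. scaleF (map d [0..<length bs] ! k) (bs ! k)) \<in> W"
    using assms(4) by (simp add: lincomb_def)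
  ultimately have "map c [0..<length bs] = map d [0..<length bs]" by (elim ex1E) blast
  then show ?thesis using assms(5) by auto
qed

section \<open>Truncated representatives at a finite level and the lattices they span\<close>

abbreviation low :: "nat \<Rightarrow> nat \<Rightarrow> int" where
  "low n s \<equiv> 1 - int s * int n * (int n - 1)"

lemma level_bound_le_1: "n \<ge> 1 \<Longrightarrow> low n s \<le> 1"
  by simp

text \<open>With \<open>lo = low n s\<close> and \<open>hi = s n\<close> this is a complement of
  \<open>t^s L_1\<close> in the largest lattice of level \<open>s\<close>, hence a copy of
  \<open>V_s\<close> inside \<open>F^n\<close>.\<close>

definition supp :: "nat \<Rightarrow> int \<Rightarrow> int \<Rightarrow> 'a::field lvec set" where
  "supp n lo hi = {v \<in> Fspace n. \<forall>j. j < lo \<or> hi < j \<longrightarrow> coord n v j = 0}"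

lemma subspace_supp: "lvec.subspace (supp n lo hi)"
  using subspace_Fspace[of n] by (auto simp: lvec.subspace_def supp_def coord_simps)

lemma basis_vec_supp: "n \<ge> 1 \<Longrightarrow> lo \<le> j \<Longrightarrow> j \<le> hi \<Longrightarrow> basis_vec n j \<in> supp n lo hi"
  by (auto simp: supp_def basis_vec_Fspace coord_basis_vec)

lemma coord_sum_basis_vec:
  assumes "n \<ge> 1"
  shows "coord n (\<Sum>j\<in>{lo..hi}. scaleF (c j) (basis_vec n j)) i = (if i \<in> {lo..hi} then c i else 0)"
proof -
  have "coord n (\<Sum>j\<in>{lo..hi}. scaleF (c j) (basis_vec n j)) i = (\<Sum>j\<in>{lo..hi}. if j = i then c i else 0)"
    unfolding coord_simps by (intro sum.cong) (auto simp: coord_basis_vec[OF assms])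
  then show ?thesis by simp
qed

lemma supp_expand:
  assumes "n \<ge> 1" "v \<in> supp n lo hi"
  shows "v = (\<Sum>j\<in>{lo..hi}. scaleF (coord n v j) (basis_vec n j))"
proof (rule lvec_eqI)
  show "v \<in> Fspace n" using assms by (simp add: supp_def)
  show "(\<Sum>j\<in>{lo..hi}. scaleF (coord n v j) (basis_vec n j)) \<in> Fspace n"
    using assms by (intro lvec.subspace_sum lvec.subspace_scale subspace_Fspace basis_vec_Fspace)
  fix i
  show "coord n v i = coord n (\<Sum>j\<in>{lo..hi}. scaleF (coord n v j) (basis_vec n j)) i"
    unfolding coord_sum_basis_vec[OF assms(1)]
    using assms(2) by (auto simp: supp_def)
qed

lemma span_basis_vec:
  assumes "n \<ge> 1" shows "lvec.span (basis_vec n ` {lo..hi}) = supp n lo hi"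
proof
  show "lvec.span (basis_vec n ` {lo..hi}) \<subseteq> supp n lo hi"
    using assms basis_vec_supp by (intro lvec.span_minimal subspace_supp) auto
  show "supp n lo hi \<subseteq> lvec.span (basis_vec n ` {lo..hi})"
  proof
    fix v assume "v \<in> supp n lo hi"
    from supp_expand[OF assms this] show "v \<in> lvec.span (basis_vec n ` {lo..hi})"
      by (metis (no_types, lifting) imageI lvec.span_base lvec.span_scale lvec.span_sum)
  qed
qed

lemma indep_list_basis_vec:
  assumes "n \<ge> 1" "distinct js" shows "indep_list (map (basis_vec n) js :: 'a::field lvec list)"
  unfolding indep_list_def
proof (intro allI impI)
  fix c k assume *: "lincomb c (map (basis_vec n) js :: 'a lvec list) = 0" "k < length (map (basis_vec n) js :: 'a lvec list)"
  have "coord n (lincomb c (map (basis_vec n) js :: 'a lvec list)) (js ! k) = (\<Sum>i<length js. if i = k then c k else 0)"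
    unfolding coord_lincomb using assms *(2)
    by (intro sum.cong) (auto simp: coord_basis_vec nth_eq_iff_index_eq)
  then show "c k = 0" using * by simp
qed

text \<open>The preimage in \<open>F^n\<close> of the subspace of the quotient modulo
  \<open>t^s L_1\<close> spanned by the classes of \<open>vs\<close>.\<close>

definition lattice_of :: "nat \<Rightarrow> nat \<Rightarrow> 'a::field lvec list \<Rightarrow> 'a lvec set" where
  "lattice_of n s vs = {v. \<exists>u\<in>lvec.span (set vs). v - u \<in> E n (int (s * n) + 1)}"

lemma subspace_lattice_of: "lvec.subspace (lattice_of n s vs)"
  unfolding lvec.subspace_def lattice_of_def
proof (safe)
  show "\<exists>u\<in>lvec.span (set vs). 0 - u \<in> E n (int (s * n) + 1)"
    using lvec.span_zero lvec.subspace_0[OF subspace_E] by (intro bexI[of _ 0]) auto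
next
  fix x y u w assume *: "u \<in> lvec.span (set vs)" "w \<in> lvec.span (set vs)"
    "x - u \<in> E n (int (s * n) + 1)" "y - w \<in> E n (int (s * n) + 1)"
  have "(x - u) + (y - w) \<in> E n (int (s * n) + 1)" using * lvec.subspace_add[OF subspace_E] by blast
  moreover have "(x - u) + (y - w) = x + y - (u + w)" by simp
  ultimately show "\<exists>u\<in>lvec.span (set vs). x + y - u \<in> E n (int (s * n) + 1)"
    using * lvec.span_add by metis
next
  fix c x u assume *: "u \<in> lvec.span (set vs)" "x - u \<in> E n (int (s * n) + 1)"
  have "scaleF c (x - u) \<in> E n (int (s * n) + 1)" using * lvec.subspace_scale[OF subspace_E] by blast
  then show "\<exists>u\<in>lvec.span (set vs). scaleF c x - u \<in> E n (int (s * n) + 1)"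
    using * lvec.span_scale lvec.scale_right_diff_distrib by metis
qed

lemma span_subset_lattice_of: "lvec.span (set vs) \<subseteq> lattice_of n s (vs :: 'a::field lvec list)"
proof
  fix x :: "'a lvec" assume "x \<in> lvec.span (set vs)"
  then show "x \<in> lattice_of n s vs"
    unfolding lattice_of_def using lvec.subspace_0[OF subspace_E] by (auto intro!: bexI[of _ x])
qed

lemma E_subset_lattice_of: "E n (int (s * n) + 1) \<subseteq> lattice_of n s (vs :: 'a::field lvec list)"
proof
  fix v :: "'a lvec" assume "v \<in> E n (int (s * n) + 1)"
  then show "v \<in> lattice_of n s vs"
    unfolding lattice_of_def using lvec.span_zero by (auto intro!: bexI[of _ 0])
qed

lemma span_Int_span_of_independent:
  assumes "lvec.independent B" "A \<subseteq> B"
  shows "lvec.span A \<inter> lvec.span (B - A) \<subseteq> {0}"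
proof
  fix x assume x: "x \<in> lvec.span A \<inter> lvec.span (B - A)"
  have iA: "lvec.independent A" "lvec.independent (B - A)" 
    using assms lvec.independent_mono[OF assms(1), of A] lvec.independent_mono[OF assms(1), of "B - A"] by auto
  have r: "lvec.representation A x = lvec.representation B x"
    using lvec.representation_extend[OF assms(1) _ assms(2)] x by auto
  have r2: "lvec.representation (B - A) x = lvec.representation B x"
    using lvec.representation_extend[OF assms(1), of x "B - A"] x by auto
  have "lvec.representation B x b = 0" for b
    using lvec.representation_ne_zero[of A x b] lvec.representation_ne_zero[of "B - A" x b] r r2 by auto
  then show "x \<in> {0}"
    using lvec.sum_nonzero_representation_eq[OF iA(1), of x] x r by auto
qed

context
  fixes n s :: nat and vs :: "'a::field lvec list"
  assumes n: "n \<ge> 1" and len: "length vs = s * n"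
    and sup: "set vs \<subseteq> supp n (low n s) (int (s * n))"
    and ind: "indep_list vs"
begin

private abbreviation (input) "hi \<equiv> int (s * n)"

private lemma span_vs: "lvec.span (set vs) \<subseteq> supp n (low n s) hi"
  using sup by (intro lvec.span_minimal subspace_supp)

private lemma supp_Int_E: "supp n (low n s) hi \<inter> E n (hi + 1) \<subseteq> {0 :: 'a lvec}"
proof
  fix v :: "'a lvec" assume v: "v \<in> supp n (low n s) hi \<inter> E n (hi + 1)"
  have "coord n v j = 0" for j using v by (cases "j \<le> hi") (auto simp: supp_def E_def)
  then have "v = 0" using v lvec.subspace_0[OF subspace_Fspace]
    by (intro lvec_eqI[of v n 0]) (auto simp: supp_def)
  then show "v \<in> {0}" by simp
qed

lemma quot_basis_lattice_of: "quot_basis (lattice_of n s vs) (E n (int (s * n) + 1)) vs"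
proof (rule quot_basisI)
  show "set vs \<subseteq> lattice_of n s vs"
    using span_subset_lattice_of lvec.span_superset by blast
  show "lvec.span (set vs) \<inter> E n (int (s * n) + 1) \<subseteq> {0}"
    using span_vs supp_Int_E by blast
qed (auto simp: subspace_E ind lattice_of_def)

lemma lattice_of_bounds: "lattice_of n s vs \<subseteq> E n (low n s)"
proof
  fix v assume "v \<in> lattice_of n s vs"
  then obtain u where u: "u \<in> lvec.span (set vs)" "v - u \<in> E n (hi + 1)" by (auto simp: lattice_of_def)
  have "low n s \<le> hi + 1" using level_bound_le_1[OF n, of s] of_nat_0_le_iff[of "s * n"] by linarith
  then have "v - u \<in> E n (low n s)" using u E_mono by blast
  moreover have "u \<in> E n (low n s)" using u span_vs by (auto simp: supp_def E_def)
  ultimately have "v - u + u \<in> E n (low n s)" using lvec.subspace_add[OF subspace_E] by blast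
  then show "v \<in> E n (low n s)" by simp
qed

private lemma lattice_of_Int_supp: "lattice_of n s vs \<inter> supp n (low n s) hi \<subseteq> lvec.span (set vs)"
proof
  fix x assume x: "x \<in> lattice_of n s vs \<inter> supp n (low n s) hi"
  then obtain u where u: "u \<in> lvec.span (set vs)" "x - u \<in> E n (hi + 1)" by (auto simp: lattice_of_def)
  then have "x - u \<in> supp n (low n s) hi" using x span_vs lvec.subspace_diff[OF subspace_supp] by blast
  then have "x - u = 0" using supp_Int_E u by blast
  then show "x \<in> lvec.span (set vs)" using u by simp
qed

text \<open>Modulo \<open>t^s L_1\<close> the lattice and \<open>E n 1\<close> both have dimension
  \<open>s n\<close>, so their intersection has the same codimension in both. A basis
  \<open>BA\<close> of the intersection is extended to bases \<open>BU\<close> and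
  \<open>BE\<close>; the added vectors give the two quotient bases.\<close>

lemma virtual_dim_lattice_of: "virtual_dim n (lattice_of n s vs) 0"
proof -
  define V where "V = lattice_of n s vs"
  define U where "U = lvec.span (set vs)"
  define E1 where "E1 = (supp n 1 hi :: 'a lvec set)"
  define A where "A = U \<inter> E1"
  have low_le: "low n s \<le> 1" using n by auto
  have E1_sub: "E1 \<subseteq> supp n (low n s) hi" using low_le by (auto simp: E1_def supp_def)
  have sV: "lvec.subspace V" unfolding V_def by (rule subspace_lattice_of)
  have sA: "lvec.subspace A" unfolding A_def U_def E1_def
    by (intro lvec.subspace_inter lvec.subspace_span subspace_supp)
  obtain BA where BA: "BA \<subseteq> A" "lvec.independent BA" "A \<subseteq> lvec.span BA"
    using lvec.maximal_independent_subset by blast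
  obtain BU where BU: "BA \<subseteq> BU" "BU \<subseteq> U" "lvec.independent BU" "U \<subseteq> lvec.span BU"
    using lvec.maximal_independent_subset_extend[of BA U] BA unfolding A_def by blast
  obtain BE where BE: "BA \<subseteq> BE" "BE \<subseteq> E1" "lvec.independent BE" "E1 \<subseteq> lvec.span BE"
    using lvec.maximal_independent_subset_extend[of BA E1] BA unfolding A_def by blast
  have card_eq: "finite B \<and> card B = card S"
    if "lvec.independent S" "finite S" "lvec.independent B" "B \<subseteq> lvec.span S" "S \<subseteq> lvec.span B"
    for B S :: "'a lvec set"
    using lvec.independent_span_bound[of S B] lvec.independent_span_bound[of B S] that by auto
  have cU: "finite BU" "card BU = s * n"
    using card_eq[of "set vs" BU] ind BU len distinct_card[of vs] lvec.span_superset[of "set vs"]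
    unfolding indep_list_iff U_def by auto
  define es where "es = (map (basis_vec n) [1..hi] :: 'a lvec list)"
  have es: "indep_list es" unfolding es_def by (rule indep_list_basis_vec[OF n]) simp
  have es_span: "lvec.span (set es) = E1" unfolding es_def E1_def using span_basis_vec[OF n, of 1 hi] by simp
  have len_es: "length es = s * n" by (simp add: es_def del: of_nat_mult)
  have cE: "finite BE" "card BE = s * n"
    using card_eq[of "set es" BE] es BE distinct_card[of es] len_es lvec.span_superset[of "set es"]
    unfolding indep_list_iff es_span by auto
  have VA: "V \<inter> supp n (low n s) hi \<subseteq> U" unfolding V_def U_def by (rule lattice_of_Int_supp)
  have EA: "supp n (low n s) hi \<inter> E n 1 \<subseteq> E1" by (auto simp: E1_def supp_def E_def)
  have E1E: "E1 \<subseteq> E n 1" by (auto simp: E1_def supp_def E_def)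
  have UV: "U \<subseteq> V" unfolding U_def V_def by (rule span_subset_lattice_of)
  have EV: "E n (hi + 1) \<subseteq> V" unfolding V_def by (rule E_subset_lattice_of)
  have EE: "E n (hi + 1) \<subseteq> E n 1" by (rule E_mono) simp
  have AV: "A \<subseteq> V \<inter> E n 1" using UV E1E by (auto simp: A_def)
  have sI: "lvec.subspace (V \<inter> E n 1)" by (intro lvec.subspace_inter sV subspace_E)
  obtain lU where lU: "set lU = BU - BA" "distinct lU" using cU finite_distinct_list[of "BU - BA"] by auto
  obtain lE where lE: "set lE = BE - BA" "distinct lE" using cE finite_distinct_list[of "BE - BA"] by auto
  have split: "\<exists>a\<in>lvec.span BA. \<exists>b\<in>lvec.span (B - BA). u = a + b"
    if "u \<in> lvec.span B" "BA \<subseteq> B" for u B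
  proof -
    have "BA \<union> (B - BA) = B" using that by auto
    then have "u \<in> lvec.span (BA \<union> (B - BA))" using that by simp
    then show ?thesis unfolding lvec.span_Un by auto
  qed
  have spA: "lvec.span BA \<subseteq> A" using BA sA by (intro lvec.span_minimal)
  have *: "v - b \<in> V \<inter> E n 1" if "v - u \<in> E n (hi + 1)" "u = a + b" "a \<in> lvec.span BA" for v u a b
  proof -
    have "v - b = (v - u) + a" using that by simp
    moreover have "v - u \<in> V \<inter> E n 1" using that EV EE by blast
    moreover have "a \<in> V \<inter> E n 1" using that spA AV by blast
    ultimately show ?thesis using lvec.subspace_add[OF sI] by metis
  qed
  have 1: "quot_basis V (V \<inter> E n 1) lU"
  proof (rule quot_basisI[OF sI])
    show "set lU \<subseteq> V" using lU BU UV by auto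
    show "indep_list lU" unfolding indep_list_iff using lU BU lvec.independent_mono[of BU "BU - BA"] by auto
    show "lvec.span (set lU) \<inter> (V \<inter> E n 1) \<subseteq> {0}"
    proof
      fix x assume x: "x \<in> lvec.span (set lU) \<inter> (V \<inter> E n 1)"
      have "lvec.span (set lU) \<subseteq> U" unfolding U_def
        using lU BU by (intro lvec.span_minimal) (auto simp: U_def)
      then have xU: "x \<in> U" using x by blast
      then have "x \<in> A" using x EA span_vs by (auto simp: A_def U_def)
      then show "x \<in> {0}" using span_Int_span_of_independent[OF BU(3,1)] BA x lU by auto
    qed
    fix v assume "v \<in> V"
    then obtain u where u: "u \<in> U" "v - u \<in> E n (hi + 1)" by (auto simp: V_def lattice_of_def U_def)
    then obtain a b where "a \<in> lvec.span BA" "b \<in> lvec.span (BU - BA)" "u = a + b"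
      using split[of u BU] BU by blast
    then show "\<exists>u\<in>lvec.span (set lU). v - u \<in> V \<inter> E n 1" using *[OF u(2)] lU by auto
  qed
  have 2: "quot_basis (E n 1) (V \<inter> E n 1) lE"
  proof (rule quot_basisI[OF sI])
    show "set lE \<subseteq> E n 1" using lE BE E1E by auto
    show "indep_list lE" unfolding indep_list_iff using lE BE lvec.independent_mono[of BE "BE - BA"] by auto
    show "lvec.span (set lE) \<inter> (V \<inter> E n 1) \<subseteq> {0}"
    proof
      fix x assume x: "x \<in> lvec.span (set lE) \<inter> (V \<inter> E n 1)"
      have "lvec.span (set lE) \<subseteq> E1"
        using lE BE by (intro lvec.span_minimal) (auto simp: E1_def subspace_supp)
      then have xU: "x \<in> E1" using x by blast
      then have "x \<in> A" using x VA E1_sub by (auto simp: A_def)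
      then show "x \<in> {0}" using span_Int_span_of_independent[OF BE(3,1)] BA x lE by auto
    qed
    fix v :: "'a lvec" assume v: "v \<in> E n 1"
    define u where "u = (\<Sum>j\<in>{1..hi}. scaleF (coord n v j) (basis_vec n j))"
    have uE: "u \<in> E1" unfolding u_def E1_def
      using n by (intro lvec.subspace_sum lvec.subspace_scale subspace_supp basis_vec_supp) auto
    have cu: "coord n u i = (if i \<in> {1..hi} then coord n v i else 0)" for i
      unfolding u_def by (rule coord_sum_basis_vec[OF n])
    have "v - u \<in> Fspace n"
      using v uE lvec.subspace_diff[OF subspace_Fspace] by (auto simp: E_def E1_def supp_def)
    then have u: "v - u \<in> E n (hi + 1)" using v by (auto simp: E_def coord_diff cu)
    then obtain a b where "a \<in> lvec.span BA" "b \<in> lvec.span (BE - BA)" "u = a + b"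
      using split[of u BE] BE uE by blast
    then show "\<exists>u\<in>lvec.span (set lE). v - u \<in> V \<inter> E n 1" using *[OF u] lE by auto
  qed
  have fBA: "finite BA" using BU cU finite_subset by blast
  have "length lU = s * n - card BA" "length lE = s * n - card BA"
    using distinct_card[of lU] distinct_card[of lE] lU lE cU cE BU BE fBA by (auto simp: card_Diff_subset)
  then have "int (length lU) - int (length lE) = 0" by simp
  then show ?thesis using 1 2 unfolding virtual_dim_def quot_dim_def V_def by blast
qed

lemma in_level_lattice_of: "in_level n s (lattice_of n s vs)"
  unfolding in_level_def tpow_L1[OF n]
  using lattice_of_bounds E_subset_lattice_of[of n s vs] by (simp add: algebra_simps)

lemma lattice_of_Gr_inf: "lattice_of n s vs \<in> Gr_inf n"
proof -
  define m where "m = max (hi + 1) (- (low n s))"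
  have m: "hi + 1 \<le> m" "- m \<le> (low n s)" by (simp_all add: m_def)
  have "E n m \<subseteq> lattice_of n s vs"
    using E_subset_lattice_of[of n s vs] E_mono[OF m(1)] by blast
  moreover have "lattice_of n s vs \<subseteq> E n (- m)"
    using lattice_of_bounds E_mono[OF m(2)] by blast
  ultimately show ?thesis
    unfolding Gr_inf_def using virtual_dim_lattice_of subspace_lattice_of by auto
qed

lemma frames_lattice_of: "lattice_of n s vs \<in> Y \<Longrightarrow> vs \<in> frames n s Y"
  unfolding frames_def tpow_L1[OF n]
  using in_level_lattice_of quot_basis_lattice_of by (auto simp: algebra_simps)

end

section \<open>Linear forms and their coefficients\<close>

abbreviation tail :: "nat \<Rightarrow> nat \<Rightarrow> 'a::field lvec list" where
  "tail n s \<equiv> map (basis_vec n) [int (s * n) + 1..int (s * n) + int n]"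

abbreviation row_list :: "int set \<Rightarrow> int list" where
  "row_list I \<equiv> sorted_list_of_set I"

text \<open>Free of the frame condition in \<open>plucker\<close>, so that determinants can be
  manipulated for arbitrary lists.\<close>

definition minor :: "nat \<Rightarrow> int list \<Rightarrow> 'a::field lvec list \<Rightarrow> 'a" where
  "minor n js vs = det (mat (length js) (length vs) (\<lambda>(j, k). coord n (vs ! k) (js ! j)))"

lemma plucker_minor:
  "plucker n s js vs = (if vs \<in> frames n s (Gr_inf n) then minor n js vs else 0)"
  by (simp add: plucker_def minor_def)

lemma minor_length: "length js \<noteq> length vs \<Longrightarrow> minor n js vs = 0"
  by (simp add: minor_def det_not_square)

lemma minor_zero_row:
  assumes "j \<in> set js" "\<And>v. v \<in> set vs \<Longrightarrow> coord n v j = 0"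
  shows "minor n js vs = 0"
proof -
  obtain i where "i < length js" "js ! i = j" using assms(1) by (auto simp: in_set_conv_nth)
  then show ?thesis unfolding minor_def using assms(2) by (intro det_zero_row[of i]) auto
qed

lemma minor_not_distinct:
  assumes "\<not> distinct js" shows "minor n js vs = 0"
proof (cases "length js = length vs")
  case True
  obtain i j where ij: "i < length js" "j < length js" "i \<noteq> j" "js ! i = js ! j"
    using assms by (auto simp: distinct_conv_nth)
  define M where "M = mat (length js) (length vs) (\<lambda>(j, k). coord n (vs ! k) (js ! j))"
  have "M \<in> carrier_mat (length js) (length js)" using True by (simp add: M_def)
  moreover have "row M i = row M j" using ij by (intro eq_vecI) (auto simp: M_def)
  ultimately show ?thesis unfolding minor_def M_def[symmetric] using ij
    by (intro det_identical_rows[of M "length js" i j])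
qed (rule minor_length)

lemma frames_mono: "Y \<subseteq> Y' \<Longrightarrow> frames n s Y \<subseteq> frames n s Y'"
  by (auto simp: frames_def)

lemma Gr_aff_subset: "Gr_aff n \<subseteq> Gr_inf n"
  by (auto simp: Gr_aff_def)

lemma frames_Gr_affD: "vs \<in> frames n s (Gr_aff n) \<Longrightarrow> vs \<in> frames n s (Gr_inf n)"
  using frames_mono[OF Gr_aff_subset] by blast

lemma frames_in_E:
  assumes "n \<ge> 1" "vs \<in> frames n s Y" "v \<in> set vs"
  shows "v \<in> E n (low n s)"
proof -
  obtain V where "in_level n s V" "quot_basis V (tpow (int s) ` L1 n) vs"
    using assms(2) by (auto simp: frames_def)
  then have "v \<in> tpow (- (int s * (int n - 1))) ` L1 n"
    using assms(3) by (auto simp: in_level_def quot_basis_def)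
  then show ?thesis by (simp add: tpow_L1[OF assms(1)] algebra_simps)
qed

lemma set_tail: "set (tail n s) = basis_vec n ` {int (s * n) + 1..int (s * n) + int n}"
  by simp

lemma lincomb_tail_in_E:
  assumes "n \<ge> 1" shows "lincomb c (tail n s) \<in> E n (int (s * n) + 1)"
  unfolding lincomb_def
  using assms by (intro lvec.subspace_sum lvec.subspace_scale subspace_E)
    (auto simp: nth_upto intro!: basis_vec_in_E)

lemma coord_lincomb_tail:
  assumes "n \<ge> 1" "i < n"
  shows "coord n (lincomb c (tail n s)) (int (s * n) + 1 + int i) = c i"
proof -
  have "coord n (lincomb c (tail n s)) (int (s * n) + 1 + int i) = (\<Sum>k<n. if k = i then c i else 0)"
    unfolding coord_lincomb using assms
    by (intro sum.cong) (auto simp: coord_basis_vec nth_upto)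
  then show ?thesis using assms by simp
qed

lemma E_diff_lincomb_tail:
  assumes n: "n \<ge> 1" and w: "w \<in> E n (int (s * n) + 1)"
  shows "w - lincomb (\<lambda>i. coord n w (int (s * n) + 1 + int i)) (tail n s) \<in> E n (int (s * n) + int n + 1)"
proof -
  define N where "N = int (s * n)"
  define d where "d = (\<lambda>i. coord n w (N + 1 + int i))"
  have "w - lincomb d (tail n s) \<in> E n (N + 1)"
    unfolding N_def by (rule lvec.subspace_diff[OF subspace_E w lincomb_tail_in_E[OF n]])
  moreover have "coord n (w - lincomb d (tail n s)) j = 0" if "N + 1 \<le> j" "j < N + int n + 1" for j
  proof -
    define i where "i = nat (j - N - 1)"
    have "j = N + 1 + int i" "i < n" using that by (auto simp: i_def)
    then show ?thesis using coord_lincomb_tail[OF n, of i d s] by (simp add: coord_diff d_def N_def)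
  qed
  ultimately have "w - lincomb d (tail n s) \<in> E n (N + int n + 1)"
    unfolding E_def by (smt (verit) mem_Collect_eq)
  then show ?thesis by (simp only: d_def N_def)
qed

text \<open>The lattice stays the same; the tail is a basis of \<open>t^s L_1\<close> modulo
  \<open>t^(s+1) L_1\<close>. This realizes the transition map between levels on frames.\<close>

lemma frames_append_tail:
  assumes n: "n \<ge> 1" and Y: "Y \<subseteq> Gr_inf n" and vs: "vs \<in> frames n s Y"
  shows "vs @ tail n s \<in> frames n (Suc s) Y"
proof -
  define N where "N = int (s * n)"
  obtain V where V: "V \<in> Y" "in_level n s V" and qb: "quot_basis V (E n (N + 1)) vs"
    using vs unfolding frames_def tpow_L1[OF n] by (auto simp: N_def)
  have low: "V \<subseteq> E n (low n s)" and high: "E n (N + 1) \<subseteq> V"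
    using V(2) unfolding in_level_def tpow_L1[OF n] by (auto simp: N_def algebra_simps)
  have N': "int (Suc s) * int n + 1 = N + int n + 1" by (simp add: N_def algebra_simps)
  have "in_level n (Suc s) V"
    unfolding in_level_def tpow_L1[OF n] N'
  proof
    have "0 \<le> int n * (int n - 1)" using n by simp
    then have "- (int (Suc s) * (int n - 1)) * int n + 1 \<le> low n s"
      by (simp add: algebra_simps)
    then show "V \<subseteq> E n (- (int (Suc s) * (int n - 1)) * int n + 1)" using low E_mono by blast
    show "E n (N + int n + 1) \<subseteq> V" using high E_mono[of "N + 1" "N + int n + 1" n] by auto
  qed
  moreover have "quot_basis V (tpow (int (Suc s)) ` L1 n) (vs @ tail n s)"
    unfolding quot_basis_def tpow_L1[OF n] N'
  proof (intro conjI ballI)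
    have "basis_vec n j \<in> V" if "N + 1 \<le> j" for j using basis_vec_in_E[OF n that] high by blast
    then show "set (vs @ tail n s) \<subseteq> V" using qb by (auto simp: quot_basis_def N_def)
    have lc: "(\<Sum>k<length (vs @ tail n s). scaleF (c ! k) ((vs @ tail n s) ! k)) =
        lincomb ((!) c) vs + lincomb (\<lambda>k. c ! (length vs + k)) (tail n s)" for c
      using lincomb_append[of "(!) c" vs "tail n s"] by (simp only: lincomb_def)
    fix v assume v: "v \<in> V"
    obtain c where c: "v - lincomb c vs \<in> E n (N + 1)" by (rule quot_basis_repr[OF qb v])
    define w where "w = v - lincomb c vs"
    define d where "d = (\<lambda>i. coord n w (N + 1 + int i))"
    have w: "w \<in> E n (N + 1)" using c by (simp add: w_def)
    define x where "x = map c [0..<length vs] @ map d [0..<n]"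
    have x1: "lincomb ((!) x) vs = lincomb c vs" by (intro lincomb_cong) (simp add: x_def nth_append)
    have x2: "lincomb (\<lambda>k. x ! (length vs + k)) (tail n s) = lincomb d (tail n s)"
      by (intro lincomb_cong) (simp add: x_def nth_append)
    show "\<exists>!c. length c = length (vs @ tail n s) \<and>
        v - (\<Sum>k<length (vs @ tail n s). scaleF (c ! k) ((vs @ tail n s) ! k)) \<in> E n (N + int n + 1)"
      unfolding lc
    proof (rule ex1I[of _ x])
      have "w - lincomb d (tail n s) \<in> E n (N + int n + 1)"
        unfolding d_def N_def by (rule E_diff_lincomb_tail[OF n w[unfolded N_def]])
      then show "length x = length (vs @ tail n s) \<and>
          v - (lincomb ((!) x) vs + lincomb (\<lambda>k. x ! (length vs + k)) (tail n s)) \<in> E n (N + int n + 1)"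
        unfolding x1 x2 by (simp add: x_def w_def diff_diff_eq)
    next
      fix y assume y: "length y = length (vs @ tail n s) \<and>
          v - (lincomb ((!) y) vs + lincomb (\<lambda>k. y ! (length vs + k)) (tail n s)) \<in> E n (N + int n + 1)"
      define e where "e = (\<lambda>k. y ! (length vs + k))"
      have ye: "v - lincomb ((!) y) vs - lincomb e (tail n s) \<in> E n (N + int n + 1)"
        using y unfolding e_def diff_diff_eq by blast
      \<comment> \<open>Modulo \<open>t^s L_1\<close> the tail disappears, so the coefficients on
        \<open>vs\<close> are forced before those on the tail.\<close>
      then have "v - lincomb ((!) y) vs - lincomb e (tail n s) \<in> E n (N + 1)"
        using E_mono[of "N + 1" "N + int n + 1" n] by auto
      then have "v - lincomb ((!) y) vs - lincomb e (tail n s) + lincomb e (tail n s) \<in> E n (N + 1)"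
        using lvec.subspace_add[OF subspace_E] lincomb_tail_in_E[OF n, of e s] unfolding N_def by blast
      then have "v - lincomb ((!) y) vs \<in> E n (N + 1)" by simp
      then have yc: "y ! k = c k" if "k < length vs" for k
        using quot_basis_unique[OF qb v _ c that] by blast
      then have "lincomb ((!) y) vs = lincomb c vs" by (intro lincomb_cong)
      then have ye': "w - lincomb e (tail n s) \<in> E n (N + int n + 1)" using ye by (simp add: w_def)
      have "e i = d i" if "i < n" for i
      proof -
        have "coord n (w - lincomb e (tail n s)) (N + 1 + int i) = 0"
          using ye' that by (auto simp: E_def)
        then show ?thesis using coord_lincomb_tail[OF n that, of e s] by (simp add: coord_diff d_def N_def)
      qed
      then show "y = x" using y yc
        by (intro nth_equalityI) (auto simp: x_def nth_append e_def, metis add_diff_inverse_nat nat_add_left_cancel_less)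
    qed
  qed
  ultimately show ?thesis using V(1) by (auto simp: frames_def)
qed

text \<open>The column of the tail vector \<open>e_j\<close> has its only nonzero entry in row
  \<open>j\<close>.\<close>

lemma minor_tail_zero:
  assumes n: "n \<ge> 1" and j: "j \<in> {int (s * n) + 1..int (s * n) + int n}" "j \<notin> set js"
  shows "minor n js (vs @ tail n s) = 0"
proof -
  define k where "k = nat (j - int (s * n) - 1)"
  have k: "k < n" "j = int (s * n) + 1 + int k" using j by (auto simp: k_def)
  show ?thesis unfolding minor_def
  proof (rule det_zero_column[of "length vs + k"])
    fix i assume "i < length js"
    then have "js ! i \<noteq> j" using j by auto
    then show "(case (i, length vs + k) of (j, k) \<Rightarrow> coord n ((vs @ tail n s) ! k) (js ! j)) = 0"
      using k n by (simp add: nth_append nth_upto coord_basis_vec)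
  qed (use k in simp)
qed

text \<open>The matrix is block triangular with an identity block, because no index of
  \<open>js\<close> reaches the tail.\<close>

lemma minor_append_tail:
  assumes n: "n \<ge> 1" and js: "\<And>j. j \<in> set js \<Longrightarrow> j \<le> int (s * n)"
  shows "minor n (js @ [int (s * n) + 1..int (s * n) + int n]) (vs @ tail n s) = minor n js vs"
proof (cases "length js = length vs")
  case True
  define m where "m = length vs"
  define ts where "ts = [int (s * n) + 1..int (s * n) + int n]"
  have ts: "length ts = n" "\<And>i. i < n \<Longrightarrow> ts ! i = int (s * n) + 1 + int i"
    by (auto simp: ts_def nth_upto)
  define A where "A = mat m m (\<lambda>(j, k). coord n (vs ! k) (js ! j))"
  define B where "B = mat n m (\<lambda>(j, k). coord n (vs ! k) (ts ! j))"
  have "mat (m + n) (m + n) (\<lambda>(j, k). coord n ((vs @ map (basis_vec n) ts) ! k) ((js @ ts) ! j))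
      = four_block_mat A (0\<^sub>m m n) B (1\<^sub>m n)"
  proof (rule eq_matI)
    fix i k assume "i < dim_row (four_block_mat A (0\<^sub>m m n) B (1\<^sub>m n))"
      "k < dim_col (four_block_mat A (0\<^sub>m m n) B (1\<^sub>m n))"
    then have ik: "i < m + n" "k < m + n" by (auto simp: A_def B_def)
    have "js ! i \<noteq> int (s * n) + 1 + x" if "i < m" "x \<ge> 0" for x
      using js[of "js ! i"] that True by (auto simp: m_def)
    then show "mat (m + n) (m + n) (\<lambda>(j, k). coord n ((vs @ map (basis_vec n) ts) ! k) ((js @ ts) ! j)) $$ (i, k) =
        four_block_mat A (0\<^sub>m m n) B (1\<^sub>m n) $$ (i, k)"
      using ik n True ts by (auto simp: A_def B_def nth_append coord_basis_vec m_def)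
  qed (auto simp: A_def B_def)
  moreover have "det (four_block_mat A (0\<^sub>m m n) B (1\<^sub>m n)) = det A * det (1\<^sub>m n :: 'a mat)"
    by (rule det_four_block_mat_upper_right_zero[where n = m and m = n]) (auto simp: A_def B_def)
  ultimately have "det (mat (m + n) (m + n) (\<lambda>(j, k). coord n ((vs @ map (basis_vec n) ts) ! k) ((js @ ts) ! j)))
      = det A" by simp
  then show ?thesis unfolding minor_def ts_def[symmetric] A_def using True ts by (simp add: m_def)
qed (simp add: minor_length)

lemma sorted_list_of_set_append:
  assumes "finite I" "\<And>i. i \<in> I \<Longrightarrow> i \<le> (a::int)"
  shows "row_list (I \<union> {a + 1..b}) = row_list I @ [a + 1..b]"
proof -
  have "sorted (row_list I @ [a + 1..b])" "distinct (row_list I @ [a + 1..b])"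
    using assms(1) by (auto simp: sorted_append dest!: assms(2))
  moreover have "set (row_list I @ [a + 1..b]) = I \<union> {a + 1..b}" using assms by auto
  ultimately show ?thesis by (metis sorted_list_of_set.idem_if_sorted_distinct)
qed

lemma finite_level_sets [simp]: "finite (level_sets n s)"
  by (rule finite_subset[of _ "Pow (level_idx n s)"]) (auto simp: level_sets_def level_idx_def)

lemma level_sets_finite: "I \<in> level_sets n s \<Longrightarrow> finite I"
  by (auto simp: level_sets_def level_idx_def intro: finite_subset)

lemma level_sets_le: "I \<in> level_sets n s \<Longrightarrow> i \<in> I \<Longrightarrow> i \<le> int (s * n)"
  by (auto simp: level_sets_def level_idx_def)

lemma level_sets_append:
  assumes n: "n \<ge> 1" and I: "I \<in> level_sets n s"
  shows "I \<union> {int (s * n) + 1..int (s * n) + int n} \<in> level_sets n (Suc s)"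
proof -
  have "I \<inter> {int (s * n) + 1..int (s * n) + int n} = {}" using level_sets_le[OF I] by force
  then have "card (I \<union> {int (s * n) + 1..int (s * n) + int n}) = Suc s * n"
    using I level_sets_finite[OF I] by (subst card_Un_disjoint) (auto simp: level_sets_def)
  moreover have "low n (Suc s) \<le> low n s"
    using n by (simp add: algebra_simps)
  moreover have "low n (Suc s) \<le> int (s * n) + 1"
    using level_bound_le_1[OF n, of "Suc s"] of_nat_0_le_iff[of "s * n"] by linarith
  ultimately show ?thesis
    using I unfolding level_sets_def level_idx_def by (auto simp: algebra_simps subset_iff)
qed

section \<open>Coefficient functions on Maya diagrams\<close>

abbreviation maya :: "nat \<Rightarrow> int set \<Rightarrow> int set" where
  "maya N A \<equiv> A \<union> {int N<..}"

text \<open>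
  The set \<open>maya (s n) I\<close> is the infinite Pluecker index of \<open>I\<close>; thus \<open>a\<close> stands for the formal sum of
  all infinite Pluecker coordinates with coefficients \<open>a\<close>.
\<close>

definition ev :: "nat \<Rightarrow> nat \<Rightarrow> (int set \<Rightarrow> 'a::field) \<Rightarrow> 'a lvec list \<Rightarrow> 'a" where
  "ev n s a vs = (\<Sum>I\<in>level_sets n s. a (maya (s * n) I) * plucker n s (row_list I) vs)"

text \<open>At level \<open>s + 1\<close> only the sets \<open>I \<union> T\<close> with
  \<open>I\<close> of level \<open>s\<close> contribute: a set missing an element of
  \<open>T\<close> gives a zero column, and an index below \<open>low n s\<close> gives a zero
  row.\<close>

lemma ev_append_tail:
  assumes n: "n \<ge> 1" and vs: "vs \<in> frames n s (Gr_inf n)"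
  shows "ev n (Suc s) a (vs @ tail n s) = ev n s a vs"
proof -
  define T where "T = {int (s * n) + 1..int (s * n) + int n}"
  have vs': "vs @ tail n s \<in> frames n (Suc s) (Gr_inf n)" by (rule frames_append_tail[OF n order_refl vs])
  have TU: "I \<union> T \<union> {int (Suc s * n)<..} = maya (s * n) I" for I
    by (auto simp: T_def algebra_simps)
  have low_le: "low n s \<le> int (s * n) + 1" using level_bound_le_1[OF n, of s] of_nat_0_le_iff[of "s * n"] by linarith
  have inj: "inj_on (\<lambda>I. I \<union> T) (level_sets n s)"
  proof (rule inj_onI)
    fix I J assume "I \<in> level_sets n s" "J \<in> level_sets n s" "I \<union> T = J \<union> T"
    moreover have "I \<inter> T = {}" "J \<inter> T = {}"
      using calculation level_sets_le by (fastforce simp: T_def)+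
    ultimately show "I = J" by blast
  qed
  have zero: "plucker n (Suc s) (row_list K) (vs @ tail n s) = 0"
    if K: "K \<in> level_sets n (Suc s) - (\<lambda>I. I \<union> T) ` level_sets n s" for K
  proof (cases "T \<subseteq> K")
    case True
    have "finite K" using K level_sets_finite by blast
    have "card (K - T) = s * n"
      using True K by (subst card_Diff_subset) (auto simp: T_def level_sets_def)
    moreover have "K = (K - T) \<union> T" using True by auto
    \<comment> \<open>\<open>K - T\<close> has the right number of elements, so it can fail to be a
      level set only through an index out of range; that index must be too low.\<close>
    ultimately have "\<not> K - T \<subseteq> level_idx n s" using K unfolding level_sets_def by blast
    then obtain j where j: "j \<in> K" "j \<notin> T" "j \<notin> level_idx n s" by auto
    have "j \<le> int (s * n) + int n" using K j level_sets_le[of K n "Suc s" j] by (auto simp: algebra_simps)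
    then have jlo: "j < low n s" using j by (auto simp: T_def level_idx_def)
    have "minor n (row_list K) (vs @ tail n s) = 0"
    proof (rule minor_zero_row[of j])
      show "j \<in> set (row_list K)" using j \<open>finite K\<close> by simp
      fix v :: "'a lvec" assume "v \<in> set (vs @ tail n s)"
      then consider "v \<in> set vs" | i where "v = basis_vec n i" "i \<ge> int (s * n) + 1" by auto
      then show "coord n v j = 0"
        using frames_in_E[OF n vs, of v] jlo low_le by cases (auto simp: E_def coord_basis_vec[OF n])
    qed
    then show ?thesis by (simp add: plucker_minor)
  next
    case False
    then obtain j where "j \<in> T" "j \<notin> K" by auto
    then show ?thesis
      using minor_tail_zero[OF n, of j s "row_list K" vs] level_sets_finite[of K n "Suc s"] K
      by (simp add: plucker_minor T_def)
  qed
  have "ev n (Suc s) a (vs @ tail n s) = (\<Sum>K\<in>(\<lambda>I. I \<union> T) ` level_sets n s.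
      a (K \<union> {int (Suc s * n)<..}) * plucker n (Suc s) (row_list K) (vs @ tail n s))"
    unfolding ev_def using level_sets_append[OF n] zero
    by (intro sum.mono_neutral_right) (auto simp: T_def)
  also have "\<dots> = (\<Sum>I\<in>level_sets n s. a (maya (s * n) I) *
      plucker n (Suc s) (row_list (I \<union> T)) (vs @ tail n s))"
    unfolding sum.reindex[OF inj] o_def TU ..
  also have "\<dots> = ev n s a vs"
    unfolding ev_def
  proof (intro sum.cong refl arg_cong2[where f = "(*)"])
    fix I assume I: "I \<in> level_sets n s"
    have "row_list (I \<union> T) = row_list I @ [int (s * n) + 1..int (s * n) + int n]"
      unfolding T_def using level_sets_finite[OF I] level_sets_le[OF I] by (rule sorted_list_of_set_append)
    moreover have "minor n (row_list I @ [int (s * n) + 1..int (s * n) + int n]) (vs @ tail n s)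
        = minor n (row_list I) vs"
      using level_sets_finite[OF I] level_sets_le[OF I] by (intro minor_append_tail[OF n]) simp
    ultimately show "plucker n (Suc s) (row_list (I \<union> T)) (vs @ tail n s) = plucker n s (row_list I) vs"
      using vs vs' by (simp only: plucker_minor if_True)
  qed
  finally show ?thesis .
qed

lemma coord_ring1_tail:
  assumes "n \<ge> 1" "f \<in> coord_ring1 n" "1 \<le> s" "vs \<in> frames n s (Gr_inf n)"
  shows "f s vs = f (Suc s) (vs @ tail n s)"
  using assms unfolding coord_ring1_def tail_basis_vec[OF assms(1)] by blast

lemma sum_fun_apply: "(\<Sum>x\<in>A. f x) y = (\<Sum>x\<in>A. f x y)" for f :: "_ \<Rightarrow> _ \<Rightarrow> 'a::comm_monoid_add"
  by (rule sum_comp_morphism[of "\<lambda>g. g y" f A, unfolded o_def, symmetric]) auto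

lemma ev_level_forms: "ev n s a \<in> level_forms n s"
proof -
  have "ev n s a = (\<Sum>I\<in>level_sets n s. scale_form (a (maya (s * n) I)) (plucker n s (row_list I)))"
    by (rule ext) (simp add: ev_def sum_fun_apply scale_form_def)
  then show ?thesis unfolding level_forms_def
    by (simp only:) (intro form.span_sum form.span_scale form.span_base imageI)
qed

lemma ev_coord_ring1:
  assumes "n \<ge> 1"
  shows "(\<lambda>s. if s = 0 then 0 else ev n s a) \<in> coord_ring1 n"
  unfolding coord_ring1_def tail_basis_vec[OF assms]
  by (auto simp: ev_level_forms ev_append_tail[OF assms] simp del: of_nat_mult)

text \<open>A frame of the coordinate subspace of \<open>I\<close>. On such frames the Pluecker
  coordinates take the values 0 and 1 of a dual basis, so evaluating there reads off
  coefficients.\<close>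

definition coord_frame :: "nat \<Rightarrow> int set \<Rightarrow> 'a::field lvec list" where
  "coord_frame n I = map (basis_vec n) (row_list I)"

lemma coord_frame_props:
  assumes n: "n \<ge> 1" and I: "I \<in> level_sets n s"
  shows "length (coord_frame n I :: 'a::field lvec list) = s * n"
    and "set (coord_frame n I :: 'a lvec list) \<subseteq> supp n (low n s) (int (s * n))"
    and "indep_list (coord_frame n I :: 'a lvec list)"
proof -
  show "length (coord_frame n I :: 'a lvec list) = s * n"
    using I by (auto simp: coord_frame_def level_sets_def)
  show "indep_list (coord_frame n I :: 'a lvec list)"
    unfolding coord_frame_def by (rule indep_list_basis_vec[OF n]) simp
  have "I \<subseteq> {low n s..int (s * n)}"
    using I by (auto simp: level_sets_def level_idx_def)
  then show "set (coord_frame n I :: 'a lvec list) \<subseteq> supp n (low n s) (int (s * n))"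
    using level_sets_finite[OF I] basis_vec_supp[OF n] unfolding coord_frame_def by fastforce
qed

lemma coord_frame_frames:
  assumes n: "n \<ge> 1" and I: "I \<in> level_sets n s"
  shows "coord_frame n I \<in> frames n s (Gr_inf n)"
  using coord_frame_props[OF n I] by (intro frames_lattice_of lattice_of_Gr_inf n)

lemma coord_frame_append:
  assumes n: "n \<ge> 1" and I: "I \<in> level_sets n s"
  shows "coord_frame n (I \<union> {int (s * n) + 1..int (s * n) + int n}) = coord_frame n I @ tail n s"
  unfolding coord_frame_def
  by (subst sorted_list_of_set_append) (use level_sets_finite[OF I] level_sets_le[OF I] in auto)

lemma minor_coord_frame_self:
  assumes "n \<ge> 1" "finite I" shows "minor n (row_list I) (coord_frame n I) = 1"
proof -
  define l where "l = row_list I"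
  have "distinct l" by (simp add: l_def)
  then have eq: "mat (length l) (length l) (\<lambda>(j, k). coord n (map (basis_vec n) l ! k) (l ! j)) = 1\<^sub>m (length l)"
    using assms by (intro eq_matI) (auto simp: coord_basis_vec nth_eq_iff_index_eq)
  show ?thesis unfolding minor_def coord_frame_def l_def[symmetric] length_map eq by (rule det_one)
qed

lemma minor_coord_frame_eq_0:
  assumes n: "n \<ge> 1" and I: "finite I" "set js \<noteq> I" shows "minor n js (coord_frame n I) = 0"
proof (cases "length js = card I")
  case True
  have "\<not> I \<subseteq> set js"
  proof
    assume "I \<subseteq> set js"
    then have "I = set js" using True card_length[of js] by (metis List.finite_set card_seteq)
    then show False using I by simp
  qed
  then obtain i where i: "i \<in> I" "i \<notin> set js" by auto
  then obtain k where k: "k < length (row_list I)" "row_list I ! k = i"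
    using I by (metis in_set_conv_nth set_sorted_list_of_set)
  have "js ! a \<noteq> i" if "a < length js" for a using i nth_mem[OF that] by auto
  then show ?thesis unfolding minor_def
    using i k by (intro det_zero_column[of k]) (auto simp: coord_frame_def coord_basis_vec[OF n])
qed (simp add: minor_length coord_frame_def)

text \<open>Duality between coordinate frames and Pluecker coordinates: a form is recovered from its
  values on the coordinate frames.\<close>

lemma level_forms_expand:
  assumes n: "n \<ge> 1" and h: "h \<in> level_forms n s"
  shows "h vs = (\<Sum>I\<in>level_sets n s. h (coord_frame n I) * plucker n s (row_list I) vs)"
  using h unfolding level_forms_def
proof (induction arbitrary: vs rule: form.span_induct_alt)
  case base
  then show ?case by simp
next
  case (step c x y)
  then obtain K where K: "K \<in> level_sets n s" "x = plucker n s (row_list K)" by auto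
  have "x (coord_frame n I) = (if I = K then 1 else 0)" if I: "I \<in> level_sets n s" for I
    using minor_coord_frame_self[OF n, of I] minor_coord_frame_eq_0[OF n, of I "row_list K"]
      level_sets_finite[OF I] level_sets_finite[OF K(1)] coord_frame_frames[OF n I]
    unfolding K(2) plucker_minor by auto
  then have "(\<Sum>I\<in>level_sets n s. (scale_form c x + y) (coord_frame n I) * plucker n s (row_list I) vs)
     = (\<Sum>I\<in>level_sets n s. (if I = K then c * x vs else 0) +
          y (coord_frame n I) * plucker n s (row_list I) vs)"
    by (intro sum.cong) (auto simp: scale_form_def K(2) algebra_simps)
  also have "\<dots> = (scale_form c x + y) vs"
    using K step.IH[of vs] by (simp add: sum.distrib scale_form_def)
  finally show ?case by simp
qed

text \<open>\<open>K\<close> is the infinite Pluecker index of a tuple of level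
  \<open>s\<close>.\<close>

definition fits :: "nat \<Rightarrow> nat \<Rightarrow> int set \<Rightarrow> bool" where
  "fits n s K \<longleftrightarrow> K \<inter> {..int (s * n)} \<in> level_sets n s \<and> {int (s * n)<..} \<subseteq> K"

lemma fits_level_set:
  assumes "I \<in> level_sets n s"
  shows "fits n s (maya (s * n) I)" "(maya (s * n) I) \<inter> {..int (s * n)} = I"
proof -
  show "(maya (s * n) I) \<inter> {..int (s * n)} = I" using level_sets_le[OF assms] by auto
  then show "fits n s (maya (s * n) I)" using assms unfolding fits_def by auto
qed

lemma fits_Suc:
  assumes n: "n \<ge> 1" and K: "fits n s K"
  shows "fits n (Suc s) K"
    "K \<inter> {..int (Suc s * n)} = K \<inter> {..int (s * n)} \<union> {int (s * n) + 1..int (s * n) + int n}"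
proof -
  have "int (Suc s * n) = int (s * n) + int n" by simp
  then show *: "K \<inter> {..int (Suc s * n)} = K \<inter> {..int (s * n)} \<union> {int (s * n) + 1..int (s * n) + int n}"
    using K by (auto simp: fits_def subset_iff simp del: of_nat_mult of_nat_add)
  show "fits n (Suc s) K"
    using level_sets_append[OF n, of "K \<inter> {..int (s * n)}" s] K unfolding fits_def * by auto
qed

lemma fits_mono:
  assumes "n \<ge> 1" "fits n s K" "s \<le> t" shows "fits n t K"
  using assms(3,2) by (induction rule: dec_induct) (auto intro: fits_Suc[OF assms(1)])

text \<open>
  The starting level \<open>s0\<close> is needed because a shuffle prescribes its components only from some level on.
  The value is junk if \<open>K\<close> fits no level.
\<close>

definition coefs :: "nat \<Rightarrow> nat \<Rightarrow> (nat \<Rightarrow> 'a::field lvec list \<Rightarrow> 'a) \<Rightarrow> int set \<Rightarrow> 'a" where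
  "coefs n s0 h K = (let s = (LEAST s. s0 \<le> s \<and> fits n s K) in h s (coord_frame n (K \<inter> {..int (s * n)})))"

text \<open>Passing to the next level appends the tail to the coordinate frame, and
  \<open>compat\<close> says that this leaves the value unchanged; hence the least level can be
  replaced by any other admissible one.\<close>

lemma coefs_eq:
  assumes n: "n \<ge> 1"
    and compat: "\<And>s vs. s0 \<le> s \<Longrightarrow> vs \<in> frames n s (Gr_inf n) \<Longrightarrow> h s vs = h (Suc s) (vs @ tail n s)"
    and s: "s0 \<le> s" and K: "fits n s K"
  shows "coefs n s0 h K = h s (coord_frame n (K \<inter> {..int (s * n)}))"
proof -
  define t where "t = (LEAST s. s0 \<le> s \<and> fits n s K)"
  have t: "s0 \<le> t" "fits n t K" "t \<le> s"
    using LeastI[of "\<lambda>s. s0 \<le> s \<and> fits n s K" s] Least_le[of "\<lambda>s. s0 \<le> s \<and> fits n s K" s] s K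
    by (auto simp: t_def)
  have "h t (coord_frame n (K \<inter> {..int (t * n)})) = h s (coord_frame n (K \<inter> {..int (s * n)}))"
    using t(3)
  proof (induction rule: dec_induct)
    case (step m)
    have m: "fits n m K" using fits_mono[OF n t(2) step(1)] .
    then have *: "K \<inter> {..int (m * n)} \<in> level_sets n m" by (simp add: fits_def)
    show ?case
      unfolding step fits_Suc(2)[OF n m] coord_frame_append[OF n *]
      using step(1) t(1) coord_frame_frames[OF n *] by (intro compat) auto
  qed simp
  then show ?thesis by (simp add: coefs_def Let_def t_def)
qed

text \<open>Every compatible system of forms comes from one coefficient function. For a system known
  only from \<open>s0\<close> on, \<open>ev\<close> then provides the components below.\<close>

lemma ev_coefs:
  assumes n: "n \<ge> 1"
    and compat: "\<And>s vs. s0 \<le> s \<Longrightarrow> vs \<in> frames n s (Gr_inf n) \<Longrightarrow> h s vs = h (Suc s) (vs @ tail n s)"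
    and s: "s0 \<le> s" and h: "h s \<in> level_forms n s"
  shows "ev n s (coefs n s0 h) = h s"
proof
  fix vs
  show "ev n s (coefs n s0 h) vs = h s vs"
    unfolding ev_def level_forms_expand[OF n h, of vs]
  proof (intro sum.cong refl arg_cong2[where f = "(*)"])
    fix I assume I: "I \<in> level_sets n s"
    show "coefs n s0 h (maya (s * n) I) = h s (coord_frame n I)"
      using coefs_eq[of n s0 h s "maya (s * n) I", OF n compat s fits_level_set(1)[OF I]] fits_level_set(2)[OF I] by simp
  qed
qed

section \<open>Vanishing of the shuffles on lattices\<close>

lemma sum_Pow_card:
  fixes g :: "'b set \<Rightarrow> 'a::comm_semiring_1"
  assumes "finite S"
  shows "(\<Sum>J\<in>Pow S. z ^ card J * g J) = (\<Sum>l\<le>card S. z ^ l * (\<Sum>J | J \<subseteq> S \<and> card J = l. g J))"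
proof -
  have "(\<Sum>J\<in>Pow S. z ^ card J * g J) = (\<Sum>l\<le>card S. \<Sum>J | J \<in> Pow S \<and> card J = l. z ^ card J * g J)"
    using assms by (intro sum.group[symmetric]) (auto simp: card_mono)
  then show ?thesis by (simp add: sum_distrib_left cong: conj_cong)
qed

lemma shuffle_minor:
  "shuffle n s I l vs = (if vs \<in> frames n s (Gr_inf n) then
     \<Sum>J | J \<subseteq> I \<and> card J = l. minor n (map (\<lambda>i. if i \<in> J then i - int n else i) (row_list I)) vs
   else 0)"
  by (simp add: shuffle_def sum_fun_apply plucker_minor)

text \<open>
  On a lattice, \<open>1 + z t\<close> is given by a matrix whose determinant is a polynomial in \<open>z\<close> without
  zeros, hence constant; the shuffles are the coefficients of the corresponding minor.
\<close>

lemma shuffle_eq_0: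
  fixes vs :: "'a::alg_closed_field lvec list"
  assumes n: "n \<ge> 1" and vs: "vs \<in> frames n s (Gr_aff n)"
    and I: "finite I" "\<And>i. i \<in> I \<Longrightarrow> i \<le> int (s * n)" and l: "l \<ge> 1"
  shows "shuffle n s I l vs = 0"
proof (cases "length (row_list I) = length vs \<and> l \<le> card I")
  case True
  define js where "js = row_list I"
  define m where "m = length vs"
  define N where "N = int (s * n)"
  define lo where "lo = low n s"
  have len: "length js = m" "card I = m" "set js = I" "distinct js"
    using True I by (simp_all add: js_def m_def)
  obtain V where V: "V \<in> Gr_aff n" and qb: "quot_basis V (E n (N + 1)) vs"
    using vs unfolding frames_def tpow_L1[OF n] by (auto simp: N_def)
  have sV: "lvec.subspace V" and tV: "\<And>v. v \<in> V \<Longrightarrow> tpow 1 v \<in> V"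
    using V by (auto simp: Gr_aff_def Gr_inf_def)
  have "\<exists>c. tpow 1 (vs ! k) - lincomb c vs \<in> E n (N + 1)" if "k < m" for k
  proof -
    have "vs ! k \<in> V" using qb that by (auto simp: quot_basis_def m_def)
    then show ?thesis using quot_basis_repr[OF qb tV] by metis
  qed
  then obtain C where C: "\<And>k. k < m \<Longrightarrow> tpow 1 (vs ! k) - lincomb (C k) vs \<in> E n (N + 1)" by metis
  \<comment> \<open>The matrix \<open>C\<close> describes \<open>t\<close> on the lattice modulo
    \<open>t^s L_1\<close>. Coordinates up to \<open>N\<close> do not see the error term, and
    multiplication by \<open>t\<close> shifts coordinates by \<open>n\<close>.\<close>
  have cC: "coord n (vs ! k) (i - int n) = (\<Sum>r<m. coord n (vs ! r) i * C k r)" if "k < m" "i \<le> N" for i k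
  proof -
    have "coord n (tpow 1 (vs ! k) - lincomb (C k) vs) i = 0" using C[OF that(1)] that(2) by (auto simp: E_def)
    then show ?thesis by (simp add: coord_diff coord_tpow[OF n] coord_lincomb m_def mult.commute)
  qed
  define D where "D z = mat m m (\<lambda>(r, k). (if r = k then 1 else 0) + z * C k r)" for z
  have row_sum: "coord n (vs ! k) i + z * coord n (vs ! k) (i - int n) =
      (\<Sum>r<m. coord n (vs ! r) i * D z $$ (r, k))" if "k < m" "i \<le> N" for z k i
  proof -
    have "(\<Sum>r<m. coord n (vs ! r) i * D z $$ (r, k)) =
        (\<Sum>r<m. (if r = k then coord n (vs ! k) i else 0) + z * (coord n (vs ! r) i * C k r))"
      using that by (intro sum.cong) (auto simp: D_def algebra_simps)
    also have "\<dots> = coord n (vs ! k) i + z * coord n (vs ! k) (i - int n)"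
      using that by (simp add: sum.distrib cC sum_distrib_left)
    finally show ?thesis ..
  qed
  \<comment> \<open>A kernel vector would give a combination \<open>w\<close> of the frame with
    \<open>w + t z w\<close> in \<open>t^s L_1\<close>. Since \<open>w\<close> vanishes far below,
    this forces \<open>w\<close> into \<open>t^s L_1\<close>, contradicting the independence of the
    frame modulo \<open>t^s L_1\<close>.\<close>
  have D_nonzero: "det (D z) \<noteq> 0" for z
  proof
    assume "det (D z) = 0"
    moreover have "D z \<in> carrier_mat m m" by (simp add: D_def)
    ultimately obtain u where u: "u \<in> carrier_vec m" "u \<noteq> 0\<^sub>v m" "D z *\<^sub>v u = 0\<^sub>v m"
      using det_0_iff_vec_prod_zero_field by blast
    have Du: "(\<Sum>k<m. D z $$ (r, k) * u $ k) = 0" if "r < m" for r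
    proof -
      have "(D z *\<^sub>v u) $ r = 0" using u that by simp
      moreover have "(D z *\<^sub>v u) $ r = (\<Sum>k<m. D z $$ (r, k) * u $ k)"
        using u(1) that by (simp add: scalar_prod_def D_def atLeast0LessThan)
      ultimately show ?thesis by simp
    qed
    define w where "w = lincomb (($) u) vs"
    have cw: "coord n w i = (\<Sum>k<m. u $ k * coord n (vs ! k) i)" for i
      by (simp add: w_def coord_lincomb m_def)
    have rec: "coord n w i + z * coord n w (i - int n) = 0" if "i \<le> N" for i
    proof -
      have "coord n w i + z * coord n w (i - int n) =
          (\<Sum>k<m. u $ k * (coord n (vs ! k) i + z * coord n (vs ! k) (i - int n)))"
        unfolding cw by (simp add: sum.distrib sum_distrib_left algebra_simps)
      also have "\<dots> = (\<Sum>k<m. \<Sum>r<m. coord n (vs ! r) i * (D z $$ (r, k) * u $ k))"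
        using that by (intro sum.cong) (auto simp: row_sum sum_distrib_left algebra_simps)
      also have "\<dots> = (\<Sum>r<m. coord n (vs ! r) i * (\<Sum>k<m. D z $$ (r, k) * u $ k))"
        by (subst sum.swap) (simp add: sum_distrib_left)
      finally show ?thesis by (simp add: Du)
    qed
    have low: "coord n w i = 0" if "i < lo" for i
    proof -
      have "coord n (vs ! k) i = 0" if "k < m" for k
        using frames_in_E[OF n vs, of "vs ! k"] that \<open>i < lo\<close> by (auto simp: E_def lo_def m_def)
      then show ?thesis by (simp add: cw)
    qed
    \<comment> \<open>The recursion expresses the coordinate at \<open>i\<close> by the one at
      \<open>i - n\<close>, so the induction climbs from the lower bound \<open>lo\<close>.\<close>
    have w0: "coord n w i = 0" if "i \<le> N" for i
      using that
    proof (induction "nat (i - lo + 1)" arbitrary: i rule: less_induct)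
      case less
      show ?case
      proof (cases "i < lo")
        case False
        then have "coord n w (i - int n) = 0" using less n by auto
        then show ?thesis using rec[OF less(2)] by simp
      qed (rule low)
    qed
    have "w \<in> Fspace n" unfolding w_def lincomb_def
      using frames_in_E[OF n vs] E_subset_Fspace
      by (intro lvec.subspace_sum lvec.subspace_scale subspace_Fspace) (auto simp: set_conv_nth)
    then have "w \<in> E n (N + 1)" using w0 by (auto simp: E_def)
    then have wE: "0 - lincomb (($) u) vs \<in> E n (N + 1)"
      using lvec.subspace_neg[OF subspace_E] by (simp add: w_def)
    have "0 - lincomb (\<lambda>_. 0) vs \<in> E n (N + 1)"
      using lvec.subspace_0[OF subspace_E] by (simp add: lincomb_def)
    then have "u $ k = 0" if "k < m" for k
      using quot_basis_unique[OF qb lvec.subspace_0[OF sV] wE, of "\<lambda>_. 0" k] that by (simp add: m_def)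
    then show False using u by auto
  qed
  define e where "e l = (\<Sum>J | J \<subseteq> {0..<m} \<and> card J = l.
      det (mat m m (\<lambda>(i, j). if i \<in> J then C j i else if i = j then 1 else 0)))" for l
  have D_poly: "det (D z) = (\<Sum>l\<le>m. z ^ l * e l)" for z
    unfolding D_def det_add_scaled_rows e_def using sum_Pow_card[of "{0..<m}" z] by simp
  have "det (D z) = e 0" for z
    unfolding D_poly by (rule nonvanishing_poly_fun_const) (rule D_nonzero[unfolded D_poly])
  then have "det (D z) = det (D 0)" for z by simp
  moreover have "D 0 = 1\<^sub>m m" by (intro eq_matI) (auto simp: D_def)
  ultimately have det_D: "det (D z) = 1" for z by simp
  define M where "M = mat m m (\<lambda>(j, k). coord n (vs ! k) (js ! j))"
  define sh where "sh l = (\<Sum>J | J \<subseteq> I \<and> card J = l. minor n (map (\<lambda>i. if i \<in> J then i - int n else i) js) vs)" for l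
  have shuffles: "(\<Sum>l\<le>m. z ^ l * sh l) = det M" for z
  proof -
    have rows: "mat (length js) m (\<lambda>(j, k). coord n (vs ! k) (js ! j) + z * coord n (vs ! k) (js ! j - int n)) = M * D z"
    proof (rule eq_matI)
      fix j k assume "j < dim_row (M * D z)" "k < dim_col (M * D z)"
      then have jk: "j < m" "k < m" by (auto simp: M_def D_def)
      then have "js ! j \<le> N" using len I(2)[of "js ! j"] nth_mem[of j js] by (simp add: N_def)
      then show "mat (length js) m (\<lambda>(j, k). coord n (vs ! k) (js ! j) + z * coord n (vs ! k) (js ! j - int n)) $$ (j, k)
          = (M * D z) $$ (j, k)"
        using jk len row_sum[OF jk(2), of "js ! j" z]
        by (simp add: M_def D_def scalar_prod_def atLeast0LessThan)
    qed (auto simp: M_def D_def len)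
    have "det M = det M * det (D z)" by (simp add: det_D)
    also have "\<dots> = det (M * D z)" by (rule det_mult[symmetric, of _ m]) (auto simp: M_def D_def)
    also have "\<dots> = (\<Sum>J\<in>Pow I. z ^ card J * det (mat (length js) m
       (\<lambda>(j, k). if js ! j \<in> J then coord n (vs ! k) (js ! j - int n) else coord n (vs ! k) (js ! j))))"
      unfolding rows[symmetric] using det_add_scaled_rows_list[OF len(4), of m "\<lambda>i k. coord n (vs ! k) i" z "\<lambda>i k. coord n (vs ! k) (i - int n)"]
      by (simp add: len(3))
    also have "\<dots> = (\<Sum>J\<in>Pow I. z ^ card J * minor n (map (\<lambda>i. if i \<in> J then i - int n else i) js) vs)"
      unfolding minor_def
      by (intro sum.cong refl arg_cong2[where f = "(*)"] arg_cong[where f = det] eq_matI) (auto simp: m_def)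
    also have "\<dots> = (\<Sum>l\<le>m. z ^ l * sh l)" unfolding sh_def sum_Pow_card[OF I(1)] len(2) ..
    finally show ?thesis ..
  qed
  \<comment> \<open>Moving \<open>det M\<close> into the constant term gives a polynomial that
    vanishes for every \<open>z\<close>; the coefficients with \<open>l >= 1\<close> are not
    affected.\<close>
  have "(\<Sum>k\<le>m. z ^ k * (if k = 0 then sh 0 - det M else sh k)) = 0" for z
  proof -
    have "(\<Sum>k\<le>m. z ^ k * (if k = 0 then sh 0 - det M else sh k)) =
        (\<Sum>k\<le>m. z ^ k * sh k - (if k = 0 then det M else 0))"
      by (intro sum.cong) auto
    then show ?thesis by (simp add: sum_subtractf shuffles)
  qed
  from sum_powers_eq_0_imp_coeff_0[where m = m and k = l and c = "\<lambda>k. if k = 0 then sh 0 - det M else sh k", OF this]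
  have "sh l = 0" using True l len by (simp split: if_splits)
  then show ?thesis by (simp add: shuffle_minor sh_def js_def)
next
  case False
  then consider "length (row_list I) \<noteq> length vs" | "l > card I" by linarith
  then show ?thesis
  proof cases
    case 1
    then show ?thesis by (simp add: shuffle_minor minor_length)
  next
    case 2
    have "card J \<noteq> l" if "J \<subseteq> I" for J using card_mono[OF I(1) that] 2 by simp
    then have "{J. J \<subseteq> I \<and> card J = l} = {}" by blast
    then show ?thesis by (simp only: shuffle_minor) simp
  qed
qed

text \<open>A component is the next one evaluated on the frame with its tail appended, so vanishing
  descends to lower levels.\<close>

lemma frames_lift_induct:
  assumes n: "n \<ge> 1" and f: "f \<in> coord_ring1 n" and s: "1 \<le> s" "s \<le> s0"
    and van: "\<And>us. us \<in> frames n s0 (Gr_aff n) \<Longrightarrow> f s0 us = 0"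
    and vs: "vs \<in> frames n s (Gr_aff n)"
  shows "f s vs = 0"
  using s(2,1) vs
proof (induction arbitrary: vs rule: inc_induct)
  case base
  then show ?case by (intro van)
next
  case (step m)
  have "f m vs = f (Suc m) (vs @ tail n m)"
    using coord_ring1_tail[OF n f step(4) frames_Gr_affD[OF step(5)]] .
  also have "\<dots> = 0"
    using step frames_append_tail[OF n Gr_aff_subset step(5)] by (intro step.IH) auto
  finally show ?case .
qed

lemma shuffle_relation_eq_0:
  fixes vs :: "'a::alg_closed_field lvec list"
  assumes n: "n \<ge> 1" and f: "f \<in> shuffle_relations n" and s: "1 \<le> s" and vs: "vs \<in> frames n s (Gr_aff n)"
  shows "f s vs = 0"
proof -
  obtain s0 I l where f1: "f \<in> coord_ring1 n" and s0: "1 \<le> s0" "shuffle_index TYPE('a) n s0 I" "1 \<le> l"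
    and fs: "\<And>s'. s' \<ge> s0 \<Longrightarrow> f s' = shuffle n s' (I \<union> {int (s0 * n) + 1 .. int (s' * n)}) l"
    using f unfolding shuffle_relations_def by blast
  have I: "I \<in> level_sets n s0" using s0 by (simp add: shuffle_index_def)
  have high: "f s' us = 0" if "s' \<ge> s0" "us \<in> frames n s' (Gr_aff n)" for s' us
    unfolding fs[OF that(1)]
  proof (rule shuffle_eq_0[OF n that(2) _ _ s0(3)])
    fix i assume "i \<in> I \<union> {int (s0 * n) + 1 .. int (s' * n)}"
    moreover have "int (s0 * n) \<le> int (s' * n)" using that(1) by (simp del: of_nat_mult)
    ultimately show "i \<le> int (s' * n)" using level_sets_le[OF I] by fastforce
  qed (use level_sets_finite[OF I] in simp)
  show ?thesis
  proof (cases "s0 \<le> s")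
    case True
    then show ?thesis using high vs by blast
  next
    case False
    then show ?thesis using frames_lift_induct[OF n f1 s _ high[OF order_refl] vs] by simp
  qed
qed

lemma closed_span_subset_ideal1:
  assumes n: "n \<ge> 1"
  shows "closed_span n (shuffle_relations n) \<subseteq> (ideal1 n :: (nat \<Rightarrow> 'a::alg_closed_field lvec list \<Rightarrow> 'a) set)"
proof
  fix f :: "nat \<Rightarrow> 'a lvec list \<Rightarrow> 'a" assume f: "f \<in> closed_span n (shuffle_relations n)"
  have "f s vs = 0" if s: "1 \<le> s" and vs: "vs \<in> frames n s (Gr_aff n)" for s vs
  proof -
    have "f s \<in> form.span ((\<lambda>g. g s) ` shuffle_relations n)" using f s by (auto simp: closed_span_def)
    then show ?thesis
    proof (induction rule: form.span_induct_alt)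
      case (step c x y)
      then show ?case using shuffle_relation_eq_0[OF n _ s vs] by (auto simp: scale_form_def)
    qed simp
  qed
  then show "f \<in> ideal1 n" using f by (auto simp: ideal1_def closed_span_def)
qed

section \<open>Shuffles as linear forms compatible with the levels\<close>

lemma plucker_level_forms:
  assumes n: "n \<ge> 1" and len: "length js = s * n" and le: "\<And>j. j \<in> set js \<Longrightarrow> j \<le> int (s * n)"
  shows "(plucker n s js :: 'a::field lvec list \<Rightarrow> 'a) \<in> level_forms n s"
proof (cases "distinct js \<and> (\<forall>j\<in>set js. low n s \<le> j)")
  case True
  define l where "l = row_list (set js)"
  have js: "set js \<in> level_sets n s"
    using True len le distinct_card[of js] by (auto simp: level_sets_def level_idx_def)
  have "mset js = mset l" unfolding l_def using True by (simp add: sorted_list_of_set_sort_remdups distinct_remdups_id)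
  then obtain p where p: "p permutes {..<length l}" "permute_list p l = js"
    using mset_eq_permutation by metis
  have len_l: "length l = length js" using \<open>mset js = mset l\<close> by (metis size_mset)
  have "(plucker n s js :: 'a lvec list \<Rightarrow> 'a) = scale_form (of_int (sign p)) (plucker n s l)"
  proof
    fix vs :: "'a lvec list"
    have "minor n js vs = of_int (sign p) * minor n l vs"
    proof (cases "length js = length vs")
      case True
      define A where "A = mat (length js) (length js) (\<lambda>(j, k). coord n (vs ! k) (l ! j))"
      have p': "p permutes {0..<length js}" using p len_l by (simp add: atLeast0LessThan)
      have "minor n js vs = det (mat (length js) (length js) (\<lambda>(i, j). A $$ (p i, j)))"
        unfolding minor_def True[symmetric]
      proof (intro arg_cong[where f = det] eq_matI)
        fix i k assume "i < dim_row (mat (length js) (length js) (\<lambda>(i, j). A $$ (p i, j)))"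
          "k < dim_col (mat (length js) (length js) (\<lambda>(i, j). A $$ (p i, j)))"
        moreover have "js ! i = l ! (p i)" if "i < length js"
          using p len_l that permute_list_nth[of p l i] by simp
        ultimately show "mat (length js) (length js) (\<lambda>(j, k). coord n (vs ! k) (js ! j)) $$ (i, k) =
            mat (length js) (length js) (\<lambda>(i, j). A $$ (p i, j)) $$ (i, k)"
          using permutes_less_bound[OF p'] by (simp add: A_def)
      qed auto
      also have "\<dots> = of_int (sign p) * det A"
        by (rule det_permute_rows[OF _ p']) (simp add: A_def)
      finally show ?thesis using True len_l by (simp add: A_def minor_def)
    qed (simp add: minor_length len_l)
    then show "plucker n s js vs = scale_form (of_int (sign p)) (plucker n s l) vs"
      by (simp add: plucker_minor scale_form_def)
  qed
  then show ?thesis unfolding level_forms_def l_def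
    by (simp only:) (intro form.span_scale form.span_base imageI js)
next
  case False
  have "plucker n s js = (0 :: 'a lvec list \<Rightarrow> 'a)"
  proof
    fix vs
    show "plucker n s js vs = (0 :: 'a lvec list \<Rightarrow> 'a) vs"
    proof (cases "distinct js")
      case True
      then obtain j where j: "j \<in> set js" "j < low n s" using False by force
      show ?thesis
        using minor_zero_row[OF j(1), of vs n] frames_in_E[OF n, of vs s "Gr_inf n"] j
        by (auto simp: plucker_minor E_def)
    qed (simp add: plucker_minor minor_not_distinct)
  qed
  then show ?thesis by (simp add: level_forms_def form.span_zero)
qed

lemma shuffle_level_forms:
  assumes n: "n \<ge> 1" and I: "finite I" "card I = s * n" "\<And>i. i \<in> I \<Longrightarrow> i \<le> int (s * n)"
  shows "shuffle n s I l \<in> level_forms n s"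
proof -
  have "shuffle n s I l = (\<Sum>J | J \<subseteq> I \<and> card J = l.
      plucker n s (map (\<lambda>i. if i \<in> J then i - int n else i) (row_list I)))"
    by (simp add: shuffle_def)
  also have "\<dots> \<in> level_forms n s"
    unfolding level_forms_def
  proof (intro form.span_sum)
    fix J
    show "plucker n s (map (\<lambda>i. if i \<in> J then i - int n else i) (row_list I)) \<in>
        form.span ((\<lambda>I. plucker n s (row_list I)) ` level_sets n s)"
      unfolding level_forms_def[symmetric] using I by (intro plucker_level_forms[OF n]) (auto, fastforce)
  qed
  finally show ?thesis .
qed

text \<open>If \<open>J\<close> contains an index \<open>j\<close> of the tail, row \<open>j\<close>
  is lost, and no other row can land on it, because lowered tail indices are at most
  \<open>s n\<close>. Such terms therefore have a zero column.\<close>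

lemma shuffle_append_tail:
  assumes n: "n \<ge> 1" and vs: "vs \<in> frames n s (Gr_inf n)"
    and I: "finite I" "\<And>i. i \<in> I \<Longrightarrow> i \<le> int (s * n)"
  shows "shuffle n (Suc s) (I \<union> {int (s * n) + 1..int (s * n) + int n}) l (vs @ tail n s) = shuffle n s I l vs"
proof -
  define T where "T = {int (s * n) + 1..int (s * n) + int n}"
  define \<phi> where "\<phi> J i = (if i \<in> J then i - int n else i)" for J i
  have vs': "vs @ tail n s \<in> frames n (Suc s) (Gr_inf n)" by (rule frames_append_tail[OF n order_refl vs])
  have srt: "row_list (I \<union> T) = row_list I @ [int (s * n) + 1..int (s * n) + int n]"
    unfolding T_def using I by (rule sorted_list_of_set_append)
  have "(\<Sum>J | J \<subseteq> I \<union> T \<and> card J = l. minor n (map (\<phi> J) (row_list (I \<union> T))) (vs @ tail n s))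
      = (\<Sum>J | J \<subseteq> I \<and> card J = l. minor n (map (\<phi> J) (row_list (I \<union> T))) (vs @ tail n s))"
  proof (rule sum.mono_neutral_right)
    show "finite {J. J \<subseteq> I \<union> T \<and> card J = l}" using I by (simp add: T_def)
    show "\<forall>J\<in>{J. J \<subseteq> I \<union> T \<and> card J = l} - {J. J \<subseteq> I \<and> card J = l}.
        minor n (map (\<phi> J) (row_list (I \<union> T))) (vs @ tail n s) = 0"
    proof
      fix J assume "J \<in> {J. J \<subseteq> I \<union> T \<and> card J = l} - {J. J \<subseteq> I \<and> card J = l}"
      then obtain j where j: "j \<in> J" "j \<in> T" by blast
      have "j \<notin> set (map (\<phi> J) (row_list (I \<union> T)))"
        using j I by (force simp: \<phi>_def T_def)
      then show "minor n (map (\<phi> J) (row_list (I \<union> T))) (vs @ tail n s) = 0"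
        by (rule minor_tail_zero[OF n j(2)[unfolded T_def]])
    qed
  qed auto
  also have "\<dots> = (\<Sum>J | J \<subseteq> I \<and> card J = l. minor n (map (\<phi> J) (row_list I)) vs)"
  proof (rule sum.cong[OF refl])
    fix J assume "J \<in> {J. J \<subseteq> I \<and> card J = l}"
    then have J: "J \<subseteq> I" by simp
    have "map (\<phi> J) [int (s * n) + 1..int (s * n) + int n] = [int (s * n) + 1..int (s * n) + int n]"
      using J I(2) by (intro map_idI) (fastforce simp: \<phi>_def)
    then have A: "map (\<phi> J) (row_list (I \<union> T)) =
        map (\<phi> J) (row_list I) @ [int (s * n) + 1..int (s * n) + int n]" unfolding srt by simp
    have B: "i \<le> int (s * n)" if "i \<in> set (map (\<phi> J) (row_list I))" for i
      using that I by (fastforce simp: \<phi>_def)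
    show "minor n (map (\<phi> J) (row_list (I \<union> T))) (vs @ tail n s) =
        minor n (map (\<phi> J) (row_list I)) vs"
      unfolding A by (rule minor_append_tail[OF n B])
  qed
  finally show ?thesis using vs vs' unfolding shuffle_minor T_def \<phi>_def by (simp only: if_True)
qed

section \<open>Root subgroups acting on frames\<close>

text \<open>
  Frames of \<open>t\<close>-stable lattices whose vectors have no coordinates outside \<open>level_idx n s\<close>. For arbitrary
  representatives modulo \<open>t\<^sup>s L\<^sub>1\<close> the shift by one index would bring discarded coordinates back.
\<close>

definition tframe :: "nat \<Rightarrow> nat \<Rightarrow> 'a::field lvec list \<Rightarrow> bool" where
  "tframe n s vs \<longleftrightarrow> length vs = s * n \<and>
     set vs \<subseteq> supp n (low n s) (int (s * n)) \<and> indep_list vs \<and>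
     (\<forall>v\<in>set vs. tpow 1 v \<in> lattice_of n s vs)"

lemma tpow_E: "n \<ge> 1 \<Longrightarrow> v \<in> E n k \<Longrightarrow> tpow 1 v \<in> E n (k + int n)"
  by (auto simp: E_def tpow_Fspace coord_tpow)

lemma tframe_frames:
  assumes n: "n \<ge> 1" and vs: "tframe n s vs"
  shows "vs \<in> frames n s (Gr_aff n)"
proof -
  note props = vs[unfolded tframe_def]
  have "tpow 1 v \<in> lattice_of n s vs" if v: "v \<in> lattice_of n s vs" for v
  proof -
    obtain u where u: "u \<in> lvec.span (set vs)" "v - u \<in> E n (int (s * n) + 1)"
      using v by (auto simp: lattice_of_def)
    obtain c where c: "u = lincomb c vs" using span_set_imp_lincomb[OF u(1)] by blast
    have "tpow 1 u \<in> lattice_of n s vs"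
      unfolding c lincomb_def tpow_sum tpow_scaleF
      using props by (intro lvec.subspace_sum lvec.subspace_scale subspace_lattice_of) auto
    moreover have "tpow 1 (v - u) \<in> lattice_of n s vs"
      using tpow_E[OF n u(2)] E_mono[of "int (s * n) + 1" "int (s * n) + 1 + int n" n] E_subset_lattice_of[of n s vs]
      by auto
    ultimately have "tpow 1 (v - u) + tpow 1 u \<in> lattice_of n s vs"
      using lvec.subspace_add[OF subspace_lattice_of] by blast
    then show ?thesis by (simp add: tpow_diff)
  qed
  moreover have "lattice_of n s vs \<in> Gr_inf n" using props by (intro lattice_of_Gr_inf n) auto
  ultimately have "lattice_of n s vs \<in> Gr_aff n" by (simp add: Gr_aff_def)
  then show ?thesis using props by (intro frames_lattice_of n) auto
qed

lemma lattice_of_append_tail: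
  assumes n: "n \<ge> 1" shows "lattice_of n s vs \<subseteq> lattice_of n (Suc s) (vs @ tail n s)"
proof
  fix v assume "v \<in> lattice_of n s vs"
  then obtain u where u: "u \<in> lvec.span (set vs)" "v - u \<in> E n (int (s * n) + 1)"
    by (auto simp: lattice_of_def)
  define d where "d = (\<lambda>i. coord n (v - u) (int (s * n) + 1 + int i))"
  define w where "w = v - u - lincomb d (tail n s)"
  have "w \<in> E n (int (s * n) + int n + 1)" unfolding w_def d_def by (rule E_diff_lincomb_tail[OF n u(2)])
  then have "w \<in> E n (int (Suc s * n) + 1)" by (simp add: algebra_simps)
  moreover have "w = v - (u + lincomb d (tail n s))" by (simp add: w_def)
  moreover have "u + lincomb d (tail n s) \<in> lvec.span (set (vs @ tail n s))"
    using u(1) lincomb_in_span[of d "tail n s"] lvec.span_mono[of "set vs" "set (vs @ tail n s)"]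
      lvec.span_mono[of "set (tail n s)" "set (vs @ tail n s)"]
    by (intro lvec.span_add) auto
  ultimately show "v \<in> lattice_of n (Suc s) (vs @ tail n s)" unfolding lattice_of_def by auto
qed

lemma level_bound_Suc: "n \<ge> 2 \<Longrightarrow> low n (Suc s) < low n s"
  by simp

lemma tframe_append_tail:
  fixes vs :: "'a::field lvec list"
  assumes n: "n \<ge> 2" and vs: "tframe n s vs"
  shows "tframe n (Suc s) (vs @ tail n s)"
proof -
  have n1: "n \<ge> 1" using n by simp
  note props = vs[unfolded tframe_def]
  define N where "N = int (s * n)"
  have N': "int (Suc s * n) = N + int n" by (simp add: N_def)
  have N0: "N \<ge> 0" by (simp add: N_def)
  have "set (vs @ tail n s) \<subseteq> supp n (low n (Suc s)) (int (Suc s * n))"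
    unfolding N' set_append set_map set_upto N_def[symmetric]
  proof (rule Un_least)
    show "set vs \<subseteq> supp n (low n (Suc s)) (N + int n)"
      using props level_bound_Suc[OF n, of s] unfolding supp_def N_def[symmetric] by force
    show "(basis_vec n ` {N + 1..N + int n} :: 'a lvec set) \<subseteq> supp n (low n (Suc s)) (N + int n)"
    proof (rule image_subsetI)
      fix i assume "i \<in> {N + 1..N + int n}"
      then have "1 \<le> i" "i \<le> N + int n" using N0 by auto
      then show "(basis_vec n i :: 'a lvec) \<in> supp n (low n (Suc s)) (N + int n)"
        using order_trans[OF level_bound_le_1[OF n1, of "Suc s"]] by (intro basis_vec_supp[OF n1])
    qed
  qed
  moreover have "indep_list (vs @ tail n s)"
    unfolding indep_list_def
  proof (intro allI impI)
    fix c k assume c: "lincomb c (vs @ tail n s) = 0" and k: "k < length (vs @ tail n s)"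
    define d where "d k = c (length vs + k)" for k
    have c': "lincomb c vs + lincomb d (tail n s) = 0"
      using c unfolding lincomb_append d_def .
    have d0: "d i = 0" if "i < n" for i
    proof -
      have z: "coord n (vs ! k) (N + 1 + int i) = 0" if "k < length vs" for k
        using props nth_mem[OF that] by (auto simp: supp_def N_def)
      have "coord n (lincomb c vs) (N + 1 + int i) = 0"
        unfolding coord_lincomb by (rule sum.neutral) (simp add: z)
      moreover have "coord n (lincomb c vs + lincomb d (tail n s)) (N + 1 + int i) = 0" unfolding c' by simp
      ultimately show ?thesis unfolding coord_add using coord_lincomb_tail[OF n1 that, of d s] by (simp add: N_def)
    qed
    have "lincomb d (tail n s) = lincomb (\<lambda>_. 0) (tail n s)" by (intro lincomb_cong) (simp add: d0)
    then have "lincomb c vs = 0" using c' by (simp add: lincomb_def)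
    then have "\<forall>k<length vs. c k = 0" using props by (auto simp: indep_list_def)
    moreover have "c k = 0" if "\<not> k < length vs"
      using d0[of "k - length vs"] that k by (simp add: d_def)
    ultimately show "c k = 0" by blast
  qed
  moreover have "tpow 1 v \<in> lattice_of n (Suc s) (vs @ tail n s)" if "v \<in> set (vs @ tail n s)" for v
  proof (cases "v \<in> set vs")
    case True
    then show ?thesis using props lattice_of_append_tail[OF n1] by blast
  next
    case False
    then have "v \<in> basis_vec n ` {N + 1..N + int n}" using that by (auto simp: N_def)
    then have "v \<in> E n (N + 1)" using basis_vec_in_E[OF n1] by auto
    from tpow_E[OF n1 this] have "tpow 1 v \<in> E n (int (Suc s * n) + 1)" unfolding N' by (simp add: algebra_simps)
    then show ?thesis using E_subset_lattice_of by blast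
  qed
  ultimately show ?thesis using props unfolding tframe_def by auto
qed

text \<open>For \<open>n >= 2\<close> no index can be moved twice in the same residue class, so the
  nilpotent part of \<open>root_op\<close> has square zero.\<close>

lemma not_both_residue:
  fixes i :: int
  assumes "n \<ge> 2" "(i - 1) mod int n = r" "(i + 1 - 1) mod int n = r" shows False
proof -
  have "(i - 1) mod int n = (i + 1 - 1) mod int n" unfolding assms(2,3) ..
  then have "int n dvd (i - 1) - (i + 1 - 1)" by (simp only: mod_eq_dvd_iff)
  then show False using assms(1) by (simp add: zdvd_not_zless)
qed

lemma root_op_eq_0:
  assumes n: "n \<ge> 2" "1 \<le> p" "p \<le> n" and v: "v \<in> Fspace n" "root_op n p z v = 0"
  shows "v = 0"
proof (rule lvec_eqI[of _ n])
  show "v \<in> Fspace n" "0 \<in> Fspace n" using v lvec.subspace_0[OF subspace_Fspace] by auto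
  fix j
  have 0: "coord n v j + (if in_class n p j then z * coord n v (j + 1) else 0) = 0" for j
    using coord_root_op[OF n(2,3), of z v j] v(2) by simp
  have "coord n v (j + 1) = 0" if "in_class n p j"
  proof -
    have "\<not> in_class n p (j + 1)" using not_both_residue[OF n(1) that] by blast
    then show ?thesis using 0[of "j + 1"] by simp
  qed
  then show "coord n v j = coord n 0 j" using 0[of j] by (auto split: if_splits)
qed

text \<open>One more level gives room at both ends: nothing is pushed below the lower bound, and
  whatever is pushed out of the new \<open>t^(s+1) L_1\<close> is absorbed by a tail vector.\<close>

lemma tframe_root_op:
  fixes z :: "'a::field"
  assumes n: "n \<ge> 2" and p: "1 \<le> p" "p \<le> n" and vs: "tframe n s vs"
  shows "tframe n (Suc s) (map (root_op n p z) (vs @ tail n s))"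
proof -
  define us where "us = vs @ tail n s"
  define x where "x = root_op n p z"
  define N where "N = int (Suc s * n)"
  define lo where "lo = low n (Suc s)"
  have n1: "n \<ge> 1" using n by simp
  have us: "tframe n (Suc s) us" unfolding us_def by (rule tframe_append_tail[OF n vs])
  note props = us[unfolded tframe_def, folded N_def lo_def]
  have F: "v \<in> Fspace n" if "v \<in> set us" for v using props that by (auto simp: supp_def)
  have lin: "lincomb c (map x us) = x (lincomb c us)" for c
    unfolding lincomb_def x_def root_op_sum root_op_scaleF length_map by (intro sum.cong) auto
  have sup: "set (map x us) \<subseteq> supp n lo N"
  proof
    fix w assume "w \<in> set (map x us)"
    then obtain v where v: "v \<in> set us" "w = x v" by auto
    \<comment> \<open>The shift moves the coordinate at \<open>lo\<close> to \<open>lo - 1\<close>,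
      which is outside the level; it vanishes because \<open>lo\<close> is strictly below the bound
      of level \<open>s\<close>.\<close>
    have "coord n v lo = 0"
    proof (cases "v \<in> set vs")
      case True
      then show ?thesis using vs level_bound_Suc[OF n, of s] unfolding tframe_def lo_def supp_def by force
    next
      case False
      then obtain i where "v = basis_vec n i" "i \<ge> int (s * n) + 1" using v by (auto simp: us_def)
      moreover have "lo < 1" using n by (simp add: lo_def)
      moreover have "0 \<le> int (s * n)" by (rule of_nat_0_le_iff)
      ultimately have "v = basis_vec n i" "i \<noteq> lo" by linarith+
      then show ?thesis by (simp add: coord_basis_vec[OF n1] split: if_splits)
    qed
    moreover have "coord n v j = 0" if "j < lo \<or> j > N" for j using props v that by (auto simp: supp_def)
    ultimately have "coord n (x v) j = 0" if "j < lo \<or> j > N" for j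
      using that unfolding x_def coord_root_op[OF p] by (cases "j + 1 = lo") auto
    then show "w \<in> supp n lo N" using v F root_op_Fspace[OF p] by (auto simp: supp_def x_def)
  qed
  have ind: "indep_list (map x us)"
    unfolding indep_list_def
  proof (intro allI impI)
    fix c k assume c: "lincomb c (map x us) = 0" and k: "k < length (map x us)"
    have "lincomb c us \<in> Fspace n"
      unfolding lincomb_def using F by (intro lvec.subspace_sum lvec.subspace_scale subspace_Fspace) auto
    moreover have "root_op n p z (lincomb c us) = 0" using c[unfolded lin] by (simp add: x_def)
    ultimately have "lincomb c us = 0" by (rule root_op_eq_0[OF n p])
    then show "c k = 0" using props k by (auto simp: indep_list_def)
  qed
  have spx: "x u \<in> lvec.span (set (map x us))" if "u \<in> lvec.span (set us)" for u
    using that lincomb_in_span[of _ "map x us"] by (metis lin span_set_imp_lincomb)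
  \<comment> \<open>The image of \<open>E n (N + 1)\<close> exceeds it at most by a multiple of
    \<open>e_N\<close>. If it does, \<open>N\<close> lies in the class of \<open>p\<close>, so
    \<open>N - 1\<close> does not and \<open>e_N\<close> is fixed by \<open>x\<close>; as a tail
    vector it is in the span.\<close>
  have Ex: "x e \<in> lattice_of n (Suc s) (map x us)" if e: "e \<in> E n (N + 1)" for e
  proof -
    define \<beta> where "\<beta> = coord n (x e) N"
    have eF: "x e \<in> Fspace n" using e root_op_Fspace[OF p] by (auto simp: E_def x_def)
    have \<beta>sp: "scaleF \<beta> (basis_vec n N) \<in> lvec.span (set (map x us))"
    proof (cases "\<beta> = 0")
      case False
      then have pn: "in_class n p N"
        using e unfolding \<beta>_def x_def coord_root_op[OF p] by (auto simp: E_def split: if_splits)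
      have "x (basis_vec n N) = basis_vec n N"
      proof (rule lvec_eqI[of _ n])
        fix j
        have "\<not> in_class n p j" if "j + 1 = N"
          using not_both_residue[OF n, of j] pn unfolding that[symmetric] by blast
        then show "coord n (x (basis_vec n N)) j = coord n (basis_vec n N) j"
          unfolding x_def coord_root_op[OF p] coord_basis_vec[OF n1] by auto
      qed (auto simp: x_def basis_vec_Fspace[OF n1] intro!: root_op_Fspace[OF p])
      moreover have "N \<in> {int (s * n) + 1..int (s * n) + int n}" using n by (simp add: N_def)
      then have "basis_vec n N \<in> set us" unfolding us_def set_append set_tail by blast
      ultimately have "basis_vec n N \<in> set (map x us)" by (metis image_eqI set_map)
      then show ?thesis by (intro lvec.span_scale lvec.span_base)
    qed (simp add: lvec.span_zero)
    have "x e - scaleF \<beta> (basis_vec n N) \<in> Fspace n"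
      by (intro lvec.subspace_diff lvec.subspace_scale subspace_Fspace basis_vec_Fspace n1 eF)
    moreover have "coord n (x e - scaleF \<beta> (basis_vec n N)) j = 0" if "j < N + 1" for j
      using that e unfolding coord_diff coord_scaleF coord_basis_vec[OF n1] \<beta>_def x_def coord_root_op[OF p]
      by (auto simp: E_def)
    ultimately have "x e - scaleF \<beta> (basis_vec n N) \<in> E n (N + 1)" by (simp add: E_def)
    then show ?thesis using \<beta>sp unfolding lattice_of_def N_def by auto
  qed
  have "tpow 1 w \<in> lattice_of n (Suc s) (map x us)" if w: "w \<in> set (map x us)" for w
  proof -
    obtain v where v: "v \<in> set us" "w = x v" using w by auto
    have "tpow 1 v \<in> lattice_of n (Suc s) us" using props v by auto
    then obtain u where u: "u \<in> lvec.span (set us)" "tpow 1 v - u \<in> E n (N + 1)"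
      by (auto simp: lattice_of_def N_def)
    have "x u \<in> lattice_of n (Suc s) (map x us)" using spx[OF u(1)] span_subset_lattice_of by blast
    then have "x u + x (tpow 1 v - u) \<in> lattice_of n (Suc s) (map x us)"
      using Ex[OF u(2)] lvec.subspace_add[OF subspace_lattice_of] by blast
    moreover have "x u + x (tpow 1 v - u) = tpow 1 w"
      unfolding x_def root_op_add[symmetric] v(2) root_op_tpow[symmetric] by simp
    ultimately show ?thesis by simp
  qed
  then show ?thesis using sup ind props unfolding tframe_def us_def x_def N_def lo_def by auto
qed

text \<open>Only \<open>tframe\<close>s are tested, because these are carried to
  \<open>tframe\<close>s by \<open>root_op\<close>. Each of them is a frame of a point of
  \<open>Gr_aff n\<close>, so coefficient functions of elements of the ideal qualify.\<close>

definition Ann :: "nat \<Rightarrow> (int set \<Rightarrow> 'a::field) \<Rightarrow> bool" where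
  "Ann n a \<longleftrightarrow> (\<forall>s\<ge>1. \<forall>vs. tframe n s vs \<longrightarrow> ev n s a vs = 0)"

lemma ev_coord_frame:
  assumes n: "n \<ge> 1" and I: "I \<in> level_sets n s"
  shows "ev n s a (coord_frame n I) = a (maya (s * n) I)"
proof -
  have "a (maya (s * n) K) * plucker n s (row_list K) (coord_frame n I) =
      (if K = I then a (maya (s * n) I) else 0)" if K: "K \<in> level_sets n s" for K
    using minor_coord_frame_self[OF n, of I] minor_coord_frame_eq_0[OF n, of I "row_list K"]
      level_sets_finite[OF I] level_sets_finite[OF K] coord_frame_frames[OF n I]
    by (auto simp: plucker_minor)
  then have "ev n s a (coord_frame n I) = (\<Sum>K\<in>level_sets n s. if K = I then a (maya (s * n) I) else 0)"
    unfolding ev_def by (intro sum.cong) auto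
  then show ?thesis using I by simp
qed

lemma vacuum_level_set: "n \<ge> 1 \<Longrightarrow> {1..int (s * n)} \<in> level_sets n s"
  using level_bound_le_1[of n s] by (auto simp: level_sets_def level_idx_def nat_mult_distrib)

lemma tframe_vacuum:
  assumes n: "n \<ge> 1" shows "tframe n s (coord_frame n {1..int (s * n)})"
proof -
  have "tpow 1 v \<in> lattice_of n s (coord_frame n {1..int (s * n)})"
    if v: "v \<in> set (coord_frame n {1..int (s * n)} :: 'a::field lvec list)" for v
  proof -
    obtain j where j: "v = basis_vec n j" "1 \<le> j" using v by (auto simp: coord_frame_def)
    define u where "u = (\<Sum>i\<in>{1..int (s * n)}. scaleF (coord n (tpow 1 v) i) (basis_vec n i))"
    have "v \<in> E n 1" using j basis_vec_in_E[OF n] by auto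
    then have tv: "tpow 1 v \<in> E n 1" using tpow_E[OF n, of v 1] E_mono[of 1 "1 + int n" n] by auto
    have "basis_vec n i \<in> set (coord_frame n {1..int (s * n)})" if "i \<in> {1..int (s * n)}" for i
      using that unfolding coord_frame_def by simp
    then have "u \<in> lvec.span (set (coord_frame n {1..int (s * n)}))"
      unfolding u_def by (intro lvec.span_sum lvec.span_scale lvec.span_base)
    moreover have "tpow 1 v - u \<in> E n (int (s * n) + 1)"
    proof -
      have cu: "coord n u i = (if i \<in> {1..int (s * n)} then coord n (tpow 1 v) i else 0)" for i
        unfolding u_def by (rule coord_sum_basis_vec[OF n])
      have "u \<in> Fspace n" unfolding u_def
        by (intro lvec.subspace_sum lvec.subspace_scale subspace_Fspace basis_vec_Fspace n)
      then have "tpow 1 v - u \<in> Fspace n" using tv lvec.subspace_diff[OF subspace_Fspace] by (auto simp: E_def)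
      then show ?thesis using tv by (auto simp: E_def coord_diff cu simp del: of_nat_mult)
    qed
    ultimately show ?thesis unfolding lattice_of_def by blast
  qed
  then show ?thesis using coord_frame_props[OF n vacuum_level_set[OF n]] unfolding tframe_def by blast
qed

text \<open>The lattice \<open>L_1\<close> is \<open>t\<close>-stable, and evaluating on its
  coordinate frame returns the coefficient of the vacuum. This is where the inductions on diagrams
  end.\<close>

lemma Ann_vacuum:
  assumes n: "n \<ge> 1" and a: "Ann n a" shows "a {0<..} = 0"
proof -
  have "ev n 1 a (coord_frame n {1..int (1 * n)}) = 0"
    using a tframe_vacuum[OF n, of 1] unfolding Ann_def by blast
  then have "a ({1..int (1 * n)} \<union> {int (1 * n)<..}) = 0"
    unfolding ev_coord_frame[OF n vacuum_level_set[OF n]] .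
  moreover have "{1..int (1 * n)} \<union> {int (1 * n)<..} = {0<..}" by auto
  ultimately show ?thesis by simp
qed

section \<open>Divided powers acting on coefficients\<close>

abbreviation raise :: "int set \<Rightarrow> int set" where
  "raise T \<equiv> (\<lambda>i. i + 1) ` T"

text \<open>
  \<open>lower_op\<close> is the transpose of a divided power of a Chevalley operator on Fock space; \<open>T\<close> is the set
  of positions reached.
\<close>

definition moves :: "nat \<Rightarrow> nat \<Rightarrow> nat \<Rightarrow> int set \<Rightarrow> int set set" where
  "moves n p k K = {T. finite T \<and> card T = k \<and> T \<inter> K = {} \<and> raise T \<subseteq> K \<and>
     (\<forall>i\<in>T. in_class n p i)}"

definition lower :: "int set \<Rightarrow> int set \<Rightarrow> int set" where
  "lower K T = (K - raise T) \<union> T"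

definition lower_op :: "nat \<Rightarrow> nat \<Rightarrow> nat \<Rightarrow> (int set \<Rightarrow> 'a::field) \<Rightarrow> int set \<Rightarrow> 'a" where
  "lower_op n p k a K = (\<Sum>T\<in>moves n p k K. a (lower K T))"

lemma finite_moves:
  assumes "K \<subseteq> {lo..}" "{hi<..} \<subseteq> K" shows "finite (moves n p k K)"
proof (rule finite_subset)
  show "moves n p k K \<subseteq> Pow {lo - 1..hi}"
  proof (intro subsetI PowI)
    fix T i assume T: "T \<in> moves n p k K" "i \<in> T"
    then have "i \<notin> K" "i + 1 \<in> K" by (auto simp: moves_def)
    then have "\<not> hi < i" "lo \<le> i + 1" using assms by auto
    then show "i \<in> {lo - 1..hi}" by simp
  qed
qed simp

lemma sum_Pow_card_le:
  fixes g :: "'b set \<Rightarrow> 'a::comm_semiring_1"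
  assumes "finite S" "card S \<le> M"
  shows "(\<Sum>J\<in>Pow S. z ^ card J * g J) = (\<Sum>l\<le>M. z ^ l * (\<Sum>J | J \<subseteq> S \<and> card J = l. g J))"
proof -
  have "(\<Sum>J | J \<subseteq> S \<and> card J = l. g J) = 0" if "l \<in> {..M} - {..card S}" for l
  proof -
    have "card J \<noteq> l" if "J \<subseteq> S" for J using card_mono[OF assms(1) that] \<open>l \<in> _\<close> by simp
    then have "{J. J \<subseteq> S \<and> card J = l} = {}" by blast
    then show ?thesis by (simp only: sum.empty)
  qed
  then show ?thesis unfolding sum_Pow_card[OF assms(1)]
    using assms(2) by (intro sum.mono_neutral_left) auto
qed

lemma sorted_list_of_set_image:
  fixes \<phi> :: "int \<Rightarrow> int"
  assumes "finite I" "\<And>i j. i \<in> I \<Longrightarrow> j \<in> I \<Longrightarrow> i < j \<Longrightarrow> \<phi> i < \<phi> j"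
  shows "row_list (\<phi> ` I) = map \<phi> (row_list I)"
proof -
  have mono: "\<phi> i \<le> \<phi> j" if "i \<in> I" "j \<in> I" "i \<le> j" for i j
    using assms(2)[of i j] that by (cases "i = j") auto
  have "inj_on \<phi> I" using assms(2) by (metis inj_onI less_irrefl linorder_neqE)
  then have "distinct (map \<phi> (row_list I))" using assms(1) by (simp add: distinct_map)
  moreover have "sorted (map \<phi> (row_list I))"
    unfolding sorted_map
    by (rule sorted_wrt_mono_rel[of _ "(\<le>)"]) (use mono assms(1) in auto)
  moreover have "set (map \<phi> (row_list I)) = \<phi> ` I" using assms(1) by simp
  ultimately show ?thesis by (metis sorted_list_of_set.idem_if_sorted_distinct)
qed

lemma minor_root_op:
  assumes p: "1 \<le> p" "p \<le> n" and I: "finite I" "card I \<le> M"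
  shows "minor n (row_list I) (map (root_op n p z) us) =
    (\<Sum>l\<le>M. z ^ l * (\<Sum>J | J \<subseteq> I \<and> card J = l \<and> (\<forall>i\<in>J. in_class n p i).
       minor n (map (\<lambda>i. if i \<in> J then i + 1 else i) (row_list I)) us))"
proof -
  define js where "js = row_list I"
  have js: "distinct js" "set js = I" using I by (auto simp: js_def)
  define G where "G i k = (if in_class n p i then coord n (us ! k) (i + 1) else 0)" for i k
  define res where "res J \<longleftrightarrow> (\<forall>i\<in>J. in_class n p i)" for J
  define D where "D J = det (mat (length js) (length us)
      (\<lambda>(j, k). if js ! j \<in> J then G (js ! j) k else coord n (us ! k) (js ! j)))" for J
  define m where "m J = minor n (map (\<lambda>i. if i \<in> J then i + 1 else i) js) us" for J
  have D: "D J = (if res J then m J else 0)" if J: "J \<subseteq> I" for J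
  proof (cases "res J")
    case True
    then have "D J = m J"
      unfolding D_def m_def minor_def by (intro arg_cong[where f = det] eq_matI) (auto simp: G_def res_def)
    then show ?thesis using True by simp
  next
    case False
    then obtain i where i: "i \<in> J" "\<not> in_class n p i" by (auto simp: res_def)
    then obtain j where j: "j < length js" "js ! j = i" using J js by (metis in_set_conv_nth subsetD)
    have "D J = 0" unfolding D_def using i j by (intro det_zero_row[of j]) (auto simp: G_def)
    then show ?thesis using False by simp
  qed
  have "minor n js (map (root_op n p z) us) =
      det (mat (length js) (length us) (\<lambda>(j, k). coord n (us ! k) (js ! j) + z * G (js ! j) k))"
    unfolding minor_def
    by (intro arg_cong[where f = det] eq_matI) (auto simp: coord_root_op[OF p] G_def)
  also have "\<dots> = (\<Sum>J\<in>Pow I. z ^ card J * D J)"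
    using det_add_scaled_rows_list[OF js(1), of "length us" "\<lambda>i k. coord n (us ! k) i" z G]
    by (simp add: js(2) D_def)
  also have "\<dots> = (\<Sum>J\<in>Pow I. z ^ card J * (if res J then m J else 0))"
    by (intro sum.cong) (simp_all add: D)
  also have "\<dots> = (\<Sum>l\<le>M. z ^ l * (\<Sum>J | J \<subseteq> I \<and> card J = l. if res J then m J else 0))"
    by (rule sum_Pow_card_le[OF I])
  also have "\<dots> = (\<Sum>l\<le>M. z ^ l * (\<Sum>J | J \<subseteq> I \<and> card J = l \<and> res J. m J))"
  proof (rule sum.cong[OF refl], rule arg_cong2[where f = "(*)", OF refl])
    fix l
    have "finite {J. J \<subseteq> I \<and> card J = l}" using I by simp
    from sum.inter_filter[OF this, of m res, symmetric]
    show "(\<Sum>J | J \<subseteq> I \<and> card J = l. if res J then m J else 0) =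
        (\<Sum>J | J \<subseteq> I \<and> card J = l \<and> res J. m J)"
      by (simp add: conj_assoc)
  qed
  finally show ?thesis by (simp add: js_def m_def res_def)
qed

lemma sum_raise:
  fixes A S :: "int set" and f :: "int \<Rightarrow> int"
  assumes "finite A" "S \<subseteq> A" "raise S \<inter> A = {}"
  shows "(\<Sum>i\<in>(A - S) \<union> raise S. f i) = (\<Sum>i\<in>A. f i) + (\<Sum>i\<in>S. f (i + 1) - f i)"
proof -
  have "(\<Sum>i\<in>(A - S) \<union> raise S. f i) = (\<Sum>i\<in>A - S. f i) + (\<Sum>i\<in>raise S. f i)"
    using assms finite_subset[OF assms(2,1)] by (intro sum.union_disjoint) auto
  also have "(\<Sum>i\<in>raise S. f i) = (\<Sum>i\<in>S. f (i + 1))" by (subst sum.reindex) auto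
  finally show ?thesis using sum.subset_diff[OF assms(2,1), of f] by (simp add: sum_subtractf)
qed

lemma card_raise:
  fixes A S :: "int set"
  assumes "finite A" "S \<subseteq> A" "raise S \<inter> A = {}"
  shows "card ((A - S) \<union> raise S) = card A"
  using sum_raise[OF assms, of "\<lambda>_. 1"] by simp

text \<open>Read from the rows, raising \<open>J\<close> inside \<open>I\<close> must produce a set
  \<open>K \<union> R\<close> with \<open>K\<close> of level \<open>s\<close>; read from
  \<open>K\<close>, the set \<open>J\<close> is a lowering move. The two descriptions match the
  double sum over \<open>I\<close> and \<open>J\<close> with the sum defining
  \<open>lower_op\<close>.\<close>

lemma ev_root_op_coeff:
  assumes n: "n \<ge> 2" and p: "1 \<le> p" "p \<le> n" and vs: "tframe n s vs"
  shows "(\<Sum>I\<in>level_sets n (Suc s). a (I \<union> {int (Suc s * n)<..}) *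
      (\<Sum>J | J \<subseteq> I \<and> card J = l \<and> (\<forall>i\<in>J. in_class n p i).
       minor n (map (\<lambda>i. if i \<in> J then i + 1 else i) (row_list I)) (vs @ tail n s)))
    = ev n s (lower_op n p l a) vs"
proof -
  define N where "N = int (s * n)"
  define lo where "lo = low n s"
  define lo' where "lo' = low n (Suc s)"
  define us where "us = vs @ tail n s"
  define R where "R = {N + 1..N + int n}"
  define \<psi> where "\<psi> J i = (if i \<in> J then i + 1 else i)" for J and i :: int
  define res where "res J \<longleftrightarrow> (\<forall>i\<in>J. in_class n p i)" for J
  have n1: "n \<ge> 1" using n by simp
  have N': "int (Suc s * n) = N + int n" by (simp add: N_def)
  have lolo: "lo' < lo" unfolding lo_def lo'_def by (rule level_bound_Suc[OF n])
  have lo1: "lo \<le> 1" unfolding lo_def by (rule level_bound_le_1[OF n1])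
  have N0: "N \<ge> 0" by (simp add: N_def)
  have fr: "vs \<in> frames n s (Gr_inf n)" using frames_Gr_affD tframe_frames[OF n1 vs] by blast
  have us: "tframe n (Suc s) us" unfolding us_def by (rule tframe_append_tail[OF n vs])
  have usN: "coord n v j = 0" if "v \<in> set us" "j > N + int n" for v j
    using us that unfolding tframe_def supp_def N' by auto
  have uslo: "coord n v j = 0" if v: "v \<in> set us" "j < lo" for v j
  proof (cases "v \<in> set vs")
    case True
    then show ?thesis using vs that unfolding tframe_def supp_def lo_def by auto
  next
    case False
    then obtain i where "v = basis_vec n i" "i \<ge> N + 1" using v by (auto simp: us_def N_def)
    then show ?thesis using that lo1 N0 by (simp add: coord_basis_vec[OF n1])
  qed
  have LS: "I \<in> level_sets n s \<longleftrightarrow> I \<subseteq> {lo..N} \<and> card I = s * n" for I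
    by (simp add: level_sets_def level_idx_def lo_def N_def)
  have LS': "I \<in> level_sets n (Suc s) \<longleftrightarrow> I \<subseteq> {lo'..N + int n} \<and> card I = Suc s * n" for I
  proof -
    have "int (Suc s) * int n = N + int n" by (simp add: N_def algebra_simps)
    then show ?thesis unfolding level_sets_def level_idx_def lo'_def by simp
  qed
  define A where "A = (SIGMA I:level_sets n (Suc s). {J. J \<subseteq> I \<and> card J = l \<and> res J})"
  define B where "B = (SIGMA K:level_sets n s. moves n p l (K \<union> {N<..}))"
  \<comment> \<open>Recovers the row set before raising from the row set \<open>K \<union> R\<close>
    after raising and the moved positions \<open>T\<close>.\<close>
  define h where "h = (\<lambda>(K, T). (lower (K \<union> R) T, T :: int set))"
  define g where "g = (\<lambda>(I, J). a (I \<union> {N + int n<..}) * minor n (map (\<psi> J) (row_list I)) us)"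
  have fin_moves: "finite (moves n p l (K \<union> {N<..}))" if "K \<in> level_sets n s" for K
    using that LS lo1 N0 by (intro finite_moves[of _ lo N]) auto
  have Bfacts: "T \<inter> (K \<union> {N<..}) = {}" "raise T \<subseteq> K \<union> R" "res T" "finite T" "card T = l"
      "T \<subseteq> {lo - 1..N}"
    if "K \<in> level_sets n s" "T \<in> moves n p l (K \<union> {N<..})" for K T
  proof -
    have T: "T \<inter> (K \<union> {N<..}) = {}" "raise T \<subseteq> K \<union> {N<..}" "res T" "finite T" "card T = l"
      using that(2) by (auto simp: moves_def res_def)
    then show "T \<inter> (K \<union> {N<..}) = {}" "res T" "finite T" "card T = l" by auto
    show TT: "T \<subseteq> {lo - 1..N}"
    proof
      fix i assume i: "i \<in> T"
      then have "i \<le> N" using T(1) by force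
      moreover have "i + 1 \<in> K \<union> {N<..}" using i T(2) by auto
      then have "i + 1 \<ge> lo" using that(1) LS lo1 N0 by auto
      ultimately show "i \<in> {lo - 1..N}" by simp
    qed
    show "raise T \<subseteq> K \<union> R"
    proof
      fix j assume j: "j \<in> raise T"
      then have "j \<le> N + 1" using TT by auto
      then show "j \<in> K \<union> R" using j T(2) n1 by (auto simp: R_def)
    qed
  qed
  have h_in: "h x \<in> A" if "x \<in> B" for x
  proof -
    obtain K T where x: "x = (K, T)" and K: "K \<in> level_sets n s" and T: "T \<in> moves n p l (K \<union> {N<..})"
      using \<open>x \<in> B\<close> by (auto simp: B_def)
    note F = Bfacts[OF K T]
    have KR: "K \<union> R \<in> level_sets n (Suc s)" unfolding R_def N_def by (rule level_sets_append[OF n1 K])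
    have TR: "T \<inter> (K \<union> R) = {}" using F(1) by (auto simp: R_def)
    have "K \<union> R = (lower (K \<union> R) T - T) \<union> raise T" "T \<subseteq> lower (K \<union> R) T"
      "raise T \<inter> lower (K \<union> R) T = {}" "finite (lower (K \<union> R) T)"
      using F(2,4) TR level_sets_finite[OF KR] by (auto simp: lower_def)
    then have "card (lower (K \<union> R) T) = Suc s * n"
      using card_raise[of "lower (K \<union> R) T" T] KR LS' by metis
    moreover have "lower (K \<union> R) T \<subseteq> {lo'..N + int n}"
      using KR LS' F(6) lolo unfolding lower_def by fastforce
    ultimately show ?thesis using F LS' unfolding x h_def A_def by (auto simp: lower_def)
  qed
  have unlower: "(lower (K \<union> R) T - T) \<union> raise T = K \<union> R"
    if "K \<in> level_sets n s" "T \<in> moves n p l (K \<union> {N<..})" for K T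
    using Bfacts[OF that] unfolding lower_def R_def by auto
  have KR_disj: "K \<inter> R = {}" if "K \<in> level_sets n s" for K
    using that LS by (fastforce simp: R_def)
  have inj: "inj_on h B"
  proof (rule inj_onI)
    fix x y assume "x \<in> B" "y \<in> B" and hxy: "h x = h y"
    then obtain K T K' T' where xy: "x = (K, T)" "y = (K', T')" and K: "K \<in> level_sets n s" "T \<in> moves n p l (K \<union> {N<..})"
      and K': "K' \<in> level_sets n s" "T' \<in> moves n p l (K' \<union> {N<..})" by (auto simp: B_def)
    have "T = T'" "lower (K \<union> R) T = lower (K' \<union> R) T'" using hxy by (auto simp: xy h_def)
    then have "K \<union> R = K' \<union> R" using unlower[OF K] unlower[OF K'] by metis
    then have "K = K'" using KR_disj[OF K(1)] KR_disj[OF K'(1)] by blast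
    then show "x = y" using xy \<open>T = T'\<close> by simp
  qed
  \<comment> \<open>A nonzero minor has distinct rows, all in the range where the frame has
    coordinates, and contains every tail index; this forces the pair \<open>(I, J)\<close> to come
    from some \<open>(K, J)\<close>.\<close>
  have zero: "g y = 0" if y: "y \<in> A - h ` B" for y
  proof (rule ccontr)
    assume g0: "g y \<noteq> 0"
    obtain I J where yIJ: "y = (I, J)" and I: "I \<in> level_sets n (Suc s)" and J: "J \<subseteq> I" "card J = l" "res J"
      using y by (auto simp: A_def)
    have fI: "finite I" by (rule level_sets_finite[OF I])
    define js where "js = map (\<psi> J) (row_list I)"
    have sjs: "set js = \<psi> J ` I" using fI by (simp add: js_def)
    have m0: "minor n js us \<noteq> 0" using g0 by (simp add: g_def yIJ js_def)
    have dist: "distinct js" using m0 minor_not_distinct by blast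
    then have injI: "inj_on (\<psi> J) I" using fI by (simp add: js_def distinct_map)
    have disj: "raise J \<inter> (I - J) = {}"
    proof (rule ccontr)
      assume "raise J \<inter> (I - J) \<noteq> {}"
      then obtain i where i: "i \<in> J" "i + 1 \<in> I" "i + 1 \<notin> J" by auto
      then have "\<psi> J i = \<psi> J (i + 1)" by (simp add: \<psi>_def)
      then show False using injI i J(1) by (metis add_cancel_right_right inj_onD subsetD zero_neq_one)
    qed
    have img: "\<psi> J ` I = (I - J) \<union> raise J" using J(1) by (auto simp: \<psi>_def)
    have bounds: "j \<in> {lo..N + int n}" if "j \<in> set js" for j
    proof (rule ccontr)
      assume "j \<notin> {lo..N + int n}"
      then have "coord n v j = 0" if "v \<in> set us" for v using usN[OF that] uslo[OF that] by force
      then show False using minor_zero_row[OF \<open>j \<in> set js\<close>] m0 by blast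
    qed
    have Rsub: "R \<subseteq> set js"
    proof
      fix j assume "j \<in> R"
      then show "j \<in> set js" using minor_tail_zero[OF n1, of j s js vs] m0 unfolding R_def N_def us_def by blast
    qed
    define K where "K = \<psi> J ` I - R"
    have KR: "\<psi> J ` I = K \<union> R" using Rsub by (auto simp: K_def sjs)
    have Ksub: "K \<subseteq> {lo..N}"
    proof
      fix j assume "j \<in> K"
      then have "j \<in> {lo..N + int n}" "j \<notin> R" using bounds sjs by (auto simp: K_def)
      then show "j \<in> {lo..N}" by (auto simp: R_def)
    qed
    have "card (\<psi> J ` I) = Suc s * n" using card_image[OF injI] I LS' by simp
    moreover have "card R = n" by (simp add: R_def)
    moreover have "card (\<psi> J ` I) = card K + card R"
      unfolding KR using Ksub by (intro card_Un_disjoint) (auto simp: K_def R_def finite_subset)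
    ultimately have K: "K \<in> level_sets n s" using Ksub LS by simp
    \<comment> \<open>An element of \<open>J\<close> can be occupied after raising only by a raised
      element of \<open>J\<close>, that is by its predecessor, which lies in another class.\<close>
    have Jni: "J \<inter> (K \<union> R) = {}"
    proof (rule ccontr)
      assume "J \<inter> (K \<union> R) \<noteq> {}"
      then obtain j where j: "j \<in> J" "j \<in> \<psi> J ` I" using KR by blast
      then obtain i where "i \<in> J" "j = i + 1" unfolding img by auto
      then show False using not_both_residue[OF n, of i "int p - 1"] j(1) J(3) by (auto simp: res_def)
    qed
    have JN: "J \<inter> {N + int n<..} = {}" using J(1) I LS' by auto
    have "J \<in> moves n p l (K \<union> {N<..})"
    proof -
      have "{N<..} = R \<union> {N + int n<..}" by (auto simp: R_def)
      then have "J \<inter> (K \<union> {N<..}) = {}" using Jni JN by auto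
      moreover have "raise J \<subseteq> K \<union> {N<..}"
        using img KR by (auto simp: R_def)
      moreover have "finite J" using J(1) fI finite_subset by blast
      ultimately show ?thesis using J by (simp add: moves_def res_def)
    qed
    moreover have "lower (K \<union> R) J = I"
      unfolding lower_def KR[symmetric] img using disj J(1) Jni[unfolded KR[symmetric] img] by blast
    ultimately have "y \<in> h ` B" using K by (force simp: B_def h_def yIJ)
    then show False using y by simp
  qed
  have g_h: "g (h (K, T)) = a (lower (K \<union> {N<..}) T) * plucker n s (row_list K) vs"
    if K: "K \<in> level_sets n s" and T: "T \<in> moves n p l (K \<union> {N<..})" for K T
  proof -
    note F = Bfacts[OF K T]
    define I where "I = lower (K \<union> R) T"
    have KR: "K \<union> R \<in> level_sets n (Suc s)" unfolding R_def N_def by (rule level_sets_append[OF n1 K])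
    have fI: "finite I" using level_sets_finite[OF KR] F(4) by (auto simp: I_def lower_def)
    have TR: "T \<inter> (K \<union> R) = {}" using F(1) by (auto simp: R_def)
    have "I \<union> {N + int n<..} = lower (K \<union> {N<..}) T"
      using F(6) n1 unfolding I_def lower_def R_def by auto
    moreover have "minor n (map (\<psi> T) (row_list I)) us = minor n (row_list K) vs"
    proof -
      have img: "\<psi> T ` I = K \<union> R"
      proof -
        have "T \<subseteq> I" by (auto simp: I_def lower_def)
        then have "\<psi> T ` I = (I - T) \<union> raise T" by (auto simp: \<psi>_def)
        then show ?thesis unfolding I_def unlower[OF K T] .
      qed
      \<comment> \<open>Raising keeps the order, since the position above an element of
        \<open>T\<close> is empty unless it belongs to \<open>T\<close>; so sorting introduces no
        sign.\<close>
      have "\<psi> T i < \<psi> T j" if ij: "i \<in> I" "j \<in> I" "i < j" for i j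
      proof (cases "i \<in> T \<and> j \<notin> T")
        case True
        then have "i + 1 \<noteq> j" using ij by (auto simp: I_def lower_def)
        then show ?thesis using ij by (simp add: \<psi>_def)
      qed (use ij in \<open>auto simp: \<psi>_def\<close>)
      then have "map (\<psi> T) (row_list I) = row_list (K \<union> R)"
        unfolding img[symmetric] by (intro sorted_list_of_set_image[OF fI, symmetric])
      also have "\<dots> = row_list K @ [N + 1..N + int n]"
        unfolding R_def using level_sets_finite[OF K] LS K by (intro sorted_list_of_set_append) auto
      finally have eq: "map (\<psi> T) (row_list I) = row_list K @ [N + 1..N + int n]" .
      show ?thesis unfolding eq us_def N_def
        using level_sets_finite[OF K] level_sets_le[OF K] by (intro minor_append_tail[OF n1]) simp
    qed
    ultimately show ?thesis using fr by (simp add: h_def g_def I_def plucker_minor)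
  qed
  have "(\<Sum>I\<in>level_sets n (Suc s). a (I \<union> {int (Suc s * n)<..}) *
      (\<Sum>J | J \<subseteq> I \<and> card J = l \<and> (\<forall>i\<in>J. in_class n p i).
       minor n (map (\<lambda>i. if i \<in> J then i + 1 else i) (row_list I)) (vs @ tail n s)))
      = (\<Sum>I\<in>level_sets n (Suc s). \<Sum>J | J \<subseteq> I \<and> card J = l \<and> res J. g (I, J))"
    unfolding N' sum_distrib_left g_def res_def \<psi>_def us_def by simp
  also have "\<dots> = sum g A"
    unfolding A_def by (subst sum.Sigma) (auto intro: finite_subset[OF _ finite_Pow_iff[THEN iffD2, OF level_sets_finite]])
  also have "\<dots> = sum g (h ` B)"
  proof (rule sum.mono_neutral_right)
    show "finite A" unfolding A_def
      by (intro finite_SigmaI finite_level_sets) (auto intro: finite_subset[OF _ finite_Pow_iff[THEN iffD2, OF level_sets_finite]])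
  qed (use h_in zero in auto)
  also have "\<dots> = (\<Sum>x\<in>B. g (h x))" by (simp add: sum.reindex[OF inj])
  also have "\<dots> = (\<Sum>K\<in>level_sets n s. \<Sum>T\<in>moves n p l (K \<union> {N<..}). g (h (K, T)))"
    unfolding B_def using fin_moves by (subst sum.Sigma) auto
  also have "\<dots> = ev n s (lower_op n p l a) vs"
    unfolding ev_def lower_op_def N_def[symmetric] sum_distrib_right
    by (intro sum.cong refl g_h)
  finally show ?thesis .
qed

text \<open>The value on the transformed frame is a polynomial in \<open>z\<close> whose
  coefficients are the values of all \<open>lower_op n p l a\<close>. It vanishes for every
  \<open>z\<close>, and the field is infinite.\<close>

lemma Ann_lower_op:
  fixes a :: "int set \<Rightarrow> 'a::alg_closed_field"
  assumes n: "n \<ge> 2" and p: "1 \<le> p" "p \<le> n" and a: "Ann n a"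
  shows "Ann n (lower_op n p k a)"
  unfolding Ann_def
proof (intro allI impI)
  fix s and vs :: "'a lvec list" assume s: "1 \<le> s" and vs: "tframe n s vs"
  have n1: "n \<ge> 1" using n by simp
  \<comment> \<open>At least \<open>Suc s * n\<close>, so that the row expansion is complete, and at
    least \<open>k\<close>, so that the wanted coefficient occurs.\<close>
  define M where "M = max k (Suc s * n)"
  let ?m = "\<lambda>l I. \<Sum>J | J \<subseteq> I \<and> card J = l \<and> (\<forall>i\<in>J. in_class n p i).
       minor n (map (\<lambda>i. if i \<in> J then i + 1 else i) (row_list I)) (vs @ tail n s)"
  have "(\<Sum>l\<le>M. z ^ l * ev n s (lower_op n p l a) vs) = 0" for z
  proof -
    define xs where "xs = map (root_op n p z) (vs @ tail n s)"
    have xs: "tframe n (Suc s) xs" unfolding xs_def by (rule tframe_root_op[OF n p vs])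
    then have "0 = ev n (Suc s) a xs" using a by (simp add: Ann_def)
    also have "\<dots> = (\<Sum>I\<in>level_sets n (Suc s). a (I \<union> {int (Suc s * n)<..}) * minor n (row_list I) xs)"
      using frames_Gr_affD[OF tframe_frames[OF n1 xs]] by (simp add: ev_def plucker_minor)
    also have "\<dots> = (\<Sum>I\<in>level_sets n (Suc s). a (I \<union> {int (Suc s * n)<..}) * (\<Sum>l\<le>M. z ^ l * ?m l I))"
      unfolding xs_def
      by (intro sum.cong refl arg_cong2[where f = "(*)"] minor_root_op[OF p] level_sets_finite)
        (auto simp: level_sets_def M_def)
    also have "\<dots> = (\<Sum>l\<le>M. z ^ l * (\<Sum>I\<in>level_sets n (Suc s). a (I \<union> {int (Suc s * n)<..}) * ?m l I))"
      unfolding sum_distrib_left by (subst sum.swap) (simp add: ac_simps)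
    also have "\<dots> = (\<Sum>l\<le>M. z ^ l * ev n s (lower_op n p l a) vs)"
      unfolding ev_root_op_coeff[OF n p vs] ..
    finally show ?thesis ..
  qed
  then show "ev n s (lower_op n p k a) vs = 0"
    by (rule sum_powers_eq_0_imp_coeff_0) (simp add: M_def)
qed

section \<open>Pluecker coordinates do not vanish on the affine Grassmannian\<close>

text \<open>The least element of \<open>T - T'\<close> exceeds all of \<open>T' - T\<close>, and the
  two differences have equally many elements.\<close>

lemma sum_less_of_exchange:
  fixes T T' :: "int set"
  assumes fin: "finite T" "finite T'" and card: "card T = card T'" and ne: "T \<noteq> T'"
    and less: "\<And>x y. x \<in> T - T' \<Longrightarrow> y \<in> T' - T \<Longrightarrow> y < x"
  shows "\<Sum>T' < \<Sum>T"
proof -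
  have c1: "card (T - T') = card T - card (T \<inter> T')" "card (T' - T) = card T' - card (T \<inter> T')"
    using fin by (simp_all add: card_Diff_subset_Int Int_commute)
  have cD: "card (T' - T) = card (T - T')" using card c1 by simp
  have D: "T - T' \<noteq> {}"
  proof
    assume *: "T - T' = {}"
    have "card (T' - T) = 0" unfolding cD * by simp
    then have "T' - T = {}" using fin by simp
    then show False using * ne by blast
  qed
  define m where "m = Min (T - T')"
  have m: "m \<in> T - T'" unfolding m_def using D fin by (intro Min_in) auto
  have m_le: "m \<le> x" if "x \<in> T - T'" for x unfolding m_def using fin that by (intro Min_le) auto
  have D': "T' - T \<noteq> {}" using cD D fin by (metis card_0_eq finite_Diff)
  have "(\<Sum>y\<in>T' - T. y) < (\<Sum>y\<in>T' - T. m)"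
    using D' fin less[OF m] by (intro sum_strict_mono) auto
  also have "\<dots> = (\<Sum>x\<in>T - T'. m)" by (simp add: cD)
  also have "\<dots> \<le> (\<Sum>x\<in>T - T'. x)" using m_le by (intro sum_mono) auto
  finally have "(\<Sum>y\<in>T' - T. y) < (\<Sum>x\<in>T - T'. x)" .
  moreover have "\<Sum>T = (\<Sum>x\<in>T - T'. x) + \<Sum>(T \<inter> T')" "\<Sum>T' = (\<Sum>x\<in>T' - T. x) + \<Sum>(T \<inter> T')"
    using sum.Int_Diff[OF fin(1), of "\<lambda>x. x" T'] sum.Int_Diff[OF fin(2), of "\<lambda>x. x" T]
    by (simp_all add: Int_commute add.commute)
  ultimately show ?thesis by simp
qed

text \<open>An upward closed diagram is a half line; \<open>card A = N\<close>, which is charge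
  zero, determines where it starts.\<close>

lemma upward_closed_vacuum:
  assumes A: "A \<subseteq> {..int N}" "finite A" "card A = N"
    and up: "\<And>h. h \<in> maya N A \<Longrightarrow> h + 1 \<in> maya N A"
  shows "maya N A = {0<..}"
proof -
  have "A = {1..int N}"
  proof (cases "A = {}")
    case True
    then show ?thesis using A by simp
  next
    case False
    define m where "m = Min A"
    have m: "m \<in> A" "\<And>x. x \<in> A \<Longrightarrow> m \<le> x" using False A(2) by (auto simp: m_def)
    have "j \<in> maya N A" if "m \<le> j" for j
      using that by (induction j rule: int_ge_induct) (use m up in auto)
    then have Am: "A = {m..int N}" using m A(1) by fastforce
    have "card {m..int N} = N" using A(3) Am by simp
    moreover have "m \<le> int N" using m(1) A(1) by auto
    ultimately have "m = 1" by simp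
    then show ?thesis using Am by simp
  qed
  then show ?thesis by auto
qed

lemma residue_index:
  assumes "n \<ge> (1 :: nat)" obtains p where "1 \<le> p" "p \<le> n" "in_class n p h"
proof -
  have "0 \<le> (h - 1) mod int n" "(h - 1) mod int n < int n" using assms by auto
  then show ?thesis by (intro that[of "nat ((h - 1) mod int n) + 1"]) auto
qed

text \<open>
  Raising as many particles of one residue class as possible turns the coefficient function of one
  diagram into that of a smaller one, down to the vacuum.
\<close>

lemma delta_not_Ann:
  assumes n: "n \<ge> 2" and A: "A \<subseteq> {..int N}" "finite A" "card A = N"
  shows "\<not> Ann n (\<lambda>K. if K = maya N A then 1 else (0 :: 'a::alg_closed_field))"
  using A
proof (induction "nat (\<Sum>i\<in>A. int N - i)" arbitrary: A rule: less_induct)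
  case less
  note A = less.prems
  define K0 where "K0 = maya N A"
  show ?case
  proof
    assume ann: "Ann n (\<lambda>K. if K = maya N A then 1 else (0 :: 'a))"
    show False
    proof (cases "\<exists>h\<in>K0. h + 1 \<notin> K0")
      case False
      then have "K0 = {0<..}" unfolding K0_def using A by (intro upward_closed_vacuum) blast+
      then show False using Ann_vacuum[OF _ ann] n unfolding K0_def by simp
    next
      case True
      then obtain h where h: "h \<in> K0" "h + 1 \<notin> K0" by blast
      obtain p where p: "1 \<le> p" "p \<le> n" "in_class n p h"
        using residue_index[of n h] n by auto
      \<comment> \<open>All particles of the class that can be raised are raised at once; this
        leaves only one diagram and one move that lower to \<open>K0\<close>.\<close>
      define S where "S = {i \<in> K0. i + 1 \<notin> K0 \<and> in_class n p i}"
      have S: "S \<subseteq> A" "S \<subseteq> {..int N - 1}" by (auto simp: S_def K0_def)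
      have finS: "finite S" using S A finite_subset by blast
      have disj: "raise S \<inter> K0 = {}" by (auto simp: S_def)
      define A1 where "A1 = (A - S) \<union> raise S"
      define K1 where "K1 = maya N A1"
      have A1: "A1 \<subseteq> {..int N}" "finite A1" using A S finS by (auto simp: A1_def)
      have disjA: "raise S \<inter> A = {}" using disj by (auto simp: K0_def)
      have cA1: "card A1 = N" unfolding A1_def using card_raise[OF A(2) S(1) disjA] A(3) by simp
      have K1: "K1 = (K0 - S) \<union> raise S" using S by (auto simp: K1_def K0_def A1_def)
      have Smoves: "S \<in> moves n p (card S) K1"
        using finS unfolding moves_def K1 by (auto simp: S_def)
      have lowerS: "lower K1 S = K0" using disj S by (auto simp: lower_def K1 S_def)
      \<comment> \<open>A move ending in \<open>K0\<close> can reach only positions of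
        \<open>S\<close>; having as many of them as \<open>S\<close>, it reaches exactly
        these.\<close>
      have uniq: "T = S \<and> K = K1" if T: "T \<in> moves n p (card S) K" "lower K T = K0" for T K
      proof -
        have T': "finite T" "card T = card S" "T \<inter> K = {}" "raise T \<subseteq> K"
          "\<And>i. i \<in> T \<Longrightarrow> in_class n p i" using T(1) by (auto simp: moves_def)
        have "i \<in> S" if i: "i \<in> T" for i
        proof -
          have "i + 1 \<notin> T" using not_both_residue[OF n T'(5)[OF i]] T'(5)[of "i + 1"] by blast
          then have "i + 1 \<notin> K0" using i unfolding T(2)[symmetric] lower_def by auto
          moreover have "i \<in> K0" using i unfolding T(2)[symmetric] lower_def by auto
          ultimately show ?thesis using T'(5)[OF i] by (simp add: S_def)
        qed
        then have TS: "T = S" using T'(1,2) finS by (metis card_subset_eq subsetI)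
        have "K = (lower K T - T) \<union> raise T" using T'(3,4) by (auto simp: lower_def)
        then show ?thesis using TS T(2) K1 by simp
      qed
      obtain lo where lo: "A1 \<subseteq> {lo..}"
      proof (cases "A1 = {}")
        case False
        then show ?thesis using A1(2) by (intro that[of "Min A1"]) auto
      qed auto
      have finm: "finite (moves n p (card S) K1)"
        using lo by (intro finite_moves[of _ "min lo (int N)" "int N"]) (auto simp: K1_def)
      have "lower_op n p (card S) (\<lambda>K. if K = K0 then 1 else (0 :: 'a)) = (\<lambda>K. if K = K1 then 1 else 0)"
      proof
        fix K
        have "lower_op n p (card S) (\<lambda>K. if K = K0 then 1 else (0 :: 'a)) K =
            (\<Sum>T\<in>moves n p (card S) K. if T = S \<and> K = K1 then 1 else 0)"
          unfolding lower_op_def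
        proof (rule sum.cong[OF refl])
          fix T assume T: "T \<in> moves n p (card S) K"
          show "(if lower K T = K0 then 1 else (0 :: 'a)) = (if T = S \<and> K = K1 then 1 else 0)"
            using uniq[OF T] lowerS by (cases "lower K T = K0") auto
        qed
        also have "\<dots> = (if K = K1 then 1 else 0)"
        proof (cases "K = K1")
          case True
          have "(\<Sum>T\<in>moves n p (card S) K1. if T = S then 1 else (0 :: 'a)) = 1"
            using finm Smoves by (simp only: sum.delta if_True)
          then show ?thesis using True by simp
        qed simp
        finally show "lower_op n p (card S) (\<lambda>K. if K = K0 then 1 else (0 :: 'a)) K = (if K = K1 then 1 else 0)" .
      qed
      then have "Ann n (\<lambda>K. if K = K1 then 1 else (0 :: 'a))"
        using Ann_lower_op[OF n p(1,2) ann, of "card S"] by (simp add: K0_def)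
      moreover have "\<not> Ann n (\<lambda>K. if K = maya N A1 then 1 else (0 :: 'a))"
      proof (rule less.hyps[OF _ A1 cA1])
        have "(\<Sum>i\<in>A1. int N - i) = (\<Sum>i\<in>A. int N - i) - int (card S)"
          unfolding A1_def sum_raise[OF A(2) S(1) disjA] by simp
        moreover have "card S > 0" using h p(3) finS by (auto simp: card_gt_0_iff S_def)
        moreover have "0 \<le> (\<Sum>i\<in>A1. int N - i)" using A1 by (intro sum_nonneg) auto
        ultimately show "nat (\<Sum>i\<in>A1. int N - i) < nat (\<Sum>i\<in>A. int N - i)" by simp
      qed
      ultimately show False by (simp add: K1_def)
    qed
  qed
qed

text \<open>Since the delta function of the diagram is not in \<open>Ann\<close>, its Pluecker
  coordinate is nonzero on some lattice, and appending tails keeps it so. This provides the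
  nonvanishing clause of \<open>shuffle_index\<close>.\<close>

lemma shuffle_index_large_level:
  assumes n: "n \<ge> 2" and A: "A \<subseteq> {..int N}" "finite A" "card A = N"
  shows "\<exists>s0\<ge>1. \<forall>s\<ge>s0. fits n s (maya N A) \<and>
    shuffle_index TYPE('a::alg_closed_field) n s ((maya N A) \<inter> {..int (s * n)})"
proof -
  define K0 where "K0 = maya N A"
  define \<delta> where "\<delta> = (\<lambda>K. if K = K0 then 1 else (0 :: 'a))"
  have n1: "n \<ge> 1" using n by simp
  have "\<not> Ann n \<delta>" unfolding \<delta>_def K0_def by (rule delta_not_Ann[OF n A])
  then obtain s1 and vs :: "'a lvec list" where s1: "1 \<le> s1" "tframe n s1 vs" "ev n s1 \<delta> vs \<noteq> 0"
    by (auto simp: Ann_def)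
  have high: "\<exists>us :: 'a lvec list. tframe n s us \<and> ev n s \<delta> us \<noteq> 0" if "s1 \<le> s" for s
    using that
  proof (induction rule: dec_induct)
    case base
    then show ?case using s1 by blast
  next
    case (step m)
    then obtain us :: "'a lvec list" where us: "tframe n m us" "ev n m \<delta> us \<noteq> 0" by blast
    have "us \<in> frames n m (Gr_inf n)" using frames_Gr_affD tframe_frames[OF n1 us(1)] by blast
    then have "ev n (Suc m) \<delta> (us @ tail n m) \<noteq> 0" using ev_append_tail[OF n1] us(2) by metis
    then show ?case using tframe_append_tail[OF n us(1)] by blast
  qed
  have key: "fits n s K0 \<and> (\<exists>us \<in> frames n s (X_schubert n s). plucker n s (row_list (K0 \<inter> {..int (s * n)})) us \<noteq> (0 :: 'a))"
    if s: "s1 \<le> s" for s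
  proof -
    obtain us :: "'a lvec list" where us: "tframe n s us" "ev n s \<delta> us \<noteq> 0" using high[OF s] by blast
    then obtain I where I: "I \<in> level_sets n s" "\<delta> (maya (s * n) I) * plucker n s (row_list I) us \<noteq> 0"
      unfolding ev_def by (metis (no_types, lifting) sum.neutral)
    then have eq: "maya (s * n) I = K0" and nz: "plucker n s (row_list I) us \<noteq> 0"
      by (auto simp: \<delta>_def split: if_splits)
    obtain V where V: "V \<in> Gr_aff n" "in_level n s V" "quot_basis V (tpow (int s) ` L1 n) us"
      using tframe_frames[OF n1 us(1)] by (auto simp: frames_def)
    moreover have "length us = s * n" using us by (simp add: tframe_def)
    ultimately have "us \<in> frames n s (X_schubert n s)"
      by (auto simp: frames_def X_schubert_def quot_dim_def)
    then show ?thesis using fits_level_set[OF I(1)] nz unfolding eq by auto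
  qed
  \<comment> \<open>One level beyond \<open>s1\<close> the lower bound has dropped by
    \<open>n (n - 1)\<close>, which is at least \<open>n\<close>, so the indices lowered by
    \<open>n\<close> stay in range.\<close>
  have "fits n s K0 \<and> shuffle_index TYPE('a) n s (K0 \<inter> {..int (s * n)})" if s: "Suc s1 \<le> s" for s
  proof -
    have K1: "fits n s1 K0" and K: "fits n s K0" using key[of s1] key[of s] s by auto
    have low: "low n s1 \<le> i" if "i \<in> K0" for i
    proof (cases "i \<le> int (s1 * n)")
      case True
      then have "i \<in> K0 \<inter> {..int (s1 * n)}" using that by simp
      then show ?thesis using K1 by (auto simp: fits_def level_sets_def level_idx_def)
    next
      case False
      then have "1 \<le> i" using of_nat_0_le_iff[of "s1 * n"] by linarith
      then show ?thesis using level_bound_le_1[OF n1, of s1] by linarith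
    qed
    have gap: "low n s \<le> low n s1 - int n"
    proof -
      have "int (Suc s1) * (int n * (int n - 1)) \<le> int s * (int n * (int n - 1))"
        using s n by (intro mult_right_mono) auto
      moreover have "int n * 1 \<le> int n * (int n - 1)" using n by (intro mult_left_mono) auto
      ultimately show ?thesis by (simp add: algebra_simps)
    qed
    have "i - int n \<in> level_idx n s" if "i \<in> K0 \<inter> {..int (s * n)}" for i
      using low[of i] gap that by (simp add: level_idx_def)
    then show ?thesis using key[of s] s K unfolding shuffle_index_def fits_def by auto
  qed
  then show ?thesis unfolding K0_def using s1(1) by (intro exI[of _ "Suc s1"]) auto
qed

lemma residue_le:
  fixes i h :: int
  assumes "(i - 1) mod int n = (h - 1) mod int n" "i < h + int n" shows "i \<le> h"
proof -
  have "int n dvd (i - 1) - (h - 1)" using assms(1) by (simp only: mod_eq_dvd_iff)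
  then obtain c where c: "i - h = int n * c" by (auto simp: dvd_def)
  then have "int n * c < int n * 1" using assms(2) by simp
  then have "c < 1" by (simp only: mult_less_cancel_left)
  then have "int n * c \<le> 0" by (simp add: mult_nonneg_nonpos)
  then show ?thesis using c by simp
qed

section \<open>Restricted diagrams\<close>

text \<open>The progression consists of the \<open>k\<close> highest members of the class up to
  \<open>h\<close>, so any other choice trades some of them for lower ones.\<close>

lemma sum_upper_progression:
  fixes T' :: "int set"
  assumes n: "n \<ge> 1" and T': "finite T'" "card T' = k"
    and le: "\<And>i. i \<in> T' \<Longrightarrow> i \<le> h \<and> (i - 1) mod int n = (h - 1) mod int n"
    and ne: "T' \<noteq> (\<lambda>m. h - int m * int n) ` {..<k}"
  shows "\<Sum>T' < (\<Sum>i\<in>(\<lambda>m. h - int m * int n) ` {..<k}. i)"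
proof -
  define T where "T = (\<lambda>m. h - int m * int n) ` {..<k}"
  have inj: "inj_on (\<lambda>m. h - int m * int n) {..<k}" using n by (auto simp: inj_on_def)
  have "\<Sum>T' < \<Sum>T"
  proof (rule sum_less_of_exchange)
    show "finite T" "finite T'" "card T = card T'" "T \<noteq> T'"
      using T' ne inj by (auto simp: T_def card_image)
    fix x y assume x: "x \<in> T - T'" and y: "y \<in> T' - T"
    obtain m where m: "m < k" "x = h - int m * int n" using x by (auto simp: T_def)
    have y': "y \<le> h" "int n dvd (y - 1) - (h - 1)" using le[of y] y by (auto simp only: mod_eq_dvd_iff)
    obtain c where c: "y - h = int n * c" using y'(2) by (auto simp: dvd_def)
    have "int n * c \<le> int n * 0" using c y'(1) by simp
    then have "c \<le> 0" using n by (simp add: mult_le_0_iff)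
    define d where "d = nat (- c)"
    have d: "y = h - int d * int n" using c \<open>c \<le> 0\<close> by (simp add: d_def algebra_simps)
    have "\<not> d < k" using y d by (auto simp: T_def)
    then have "m < d" using m by simp
    then have "int m * int n < int d * int n" using n by (intro mult_strict_right_mono) auto
    then show "y < x" using m d by simp
  qed
  then show ?thesis by (simp add: T_def)
qed

text \<open>
  The induction removes the last ladder: \<open>h\<close> is the largest particle with a hole above it, and the
  chain \<open>h, h - n, \<dots>\<close> of particles with holes above them is raised by one step as far as it goes.
  Lowering \<open>k\<close> particles of the resulting diagram by one step increases the sum of squares most when
  the original chain is restored, so that only the original diagram contributes.
\<close>

lemma restricted_coeff_eq_0:
  fixes a :: "int set \<Rightarrow> 'a::alg_closed_field"
  assumes n: "n \<ge> 2"
    and A: "A \<subseteq> {..int N}" "finite A" "card A = N"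
    and restricted: "\<And>i. i \<in> maya N A \<Longrightarrow> \<exists>j\<in>maya N A. i < j \<and> j \<le> i + int n"
    and a: "Ann n a"
    and larger: "\<And>B. B \<subseteq> {..int N} \<Longrightarrow> finite B \<Longrightarrow> card B = N \<Longrightarrow> \<Sum>B = \<Sum>A \<Longrightarrow>
      (\<Sum>i\<in>A. i\<^sup>2) < (\<Sum>i\<in>B. i\<^sup>2) \<Longrightarrow>
      (\<And>x. x \<notin> maya N B \<Longrightarrow> \<exists>y. y \<notin> maya N A \<and> x \<le> y) \<Longrightarrow> a (maya N B) = 0"
  shows "a (maya N A) = 0"
  using A restricted a larger
proof (induction "nat (\<Sum>i\<in>A. int N - i)" arbitrary: A a rule: less_induct)
  case less
  note A = less.prems(1-3) and restricted = less.prems(4) and ann = less.prems(5) and larger = less.prems(6)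
  define K0 where "K0 = maya N A"
  show ?case
  proof (cases "\<exists>h\<in>K0. h + 1 \<notin> K0")
    case False
    then have "K0 = {0<..}" unfolding K0_def using A by (intro upward_closed_vacuum) blast+
    then show ?thesis using Ann_vacuum[OF _ ann] n unfolding K0_def by simp
  next
    case True
    define H where "H = {h \<in> A. h + 1 \<notin> K0}"
    have H: "finite H" "H \<noteq> {}" using True A by (auto simp: H_def K0_def)
    define h where "h = Max H"
    have hH: "h \<in> H" "\<And>x. x \<in> H \<Longrightarrow> x \<le> h" using H by (auto simp: h_def)
    have h: "h \<in> A" "h \<in> K0" "h + 1 \<notin> K0" "h + 1 \<le> int N" using hH(1) by (auto simp: H_def K0_def)
    have step_up: "x + 1 \<in> K0" if "x \<in> K0" "h < x" for x
      using that hH(2)[of x] by (cases "x \<in> H") (auto simp: H_def K0_def)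
    obtain j0 where j0: "j0 \<in> K0" "h < j0" "j0 \<le> h + int n" using restricted[folded K0_def, OF h(2)] by blast
    \<comment> \<open>Restrictedness puts a particle \<open>j0\<close> within \<open>n\<close> above
      \<open>h\<close>; as no particle above \<open>h\<close> has a hole above it, everything from
      \<open>j0\<close> on is filled.\<close>
    have tail: "x \<in> K0" if "h + int n \<le> x" for x
    proof -
      have "j0 \<le> x" using j0 that by simp
      then show ?thesis
        by (induction x rule: int_ge_induct) (use j0 step_up in auto)
    qed
    define Q where "Q m \<longleftrightarrow> h - int m * int n \<in> K0 \<and> h - int m * int n + 1 \<notin> K0" for m
    define lo where "lo = Min A"
    have lo: "A \<subseteq> {lo..}" using A(2) by (auto simp: lo_def)
    have lo_h: "lo \<le> h" "lo \<le> int N" using lo h by auto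
    \<comment> \<open>The chain descends by at least one per step, so after
      \<open>h - lo + 1\<close> steps it is below every particle.\<close>
    have exQ: "\<not> Q (nat (h - lo + 1))"
    proof
      assume "Q (nat (h - lo + 1))"
      then have in_K0: "h - int (nat (h - lo + 1)) * int n \<in> K0" by (simp add: Q_def)
      have "int (nat (h - lo + 1)) * 1 \<le> int (nat (h - lo + 1)) * int n"
        using n by (intro mult_left_mono) auto
      moreover have "int (nat (h - lo + 1)) = h - lo + 1" using lo_h by simp
      ultimately have "h - int (nat (h - lo + 1)) * int n < lo" by linarith
      then show False using in_K0 lo lo_h by (auto simp: K0_def)
    qed
    define k where "k = (LEAST m. \<not> Q m)"
    have Qk: "\<not> Q k" unfolding k_def by (rule LeastI[of "\<lambda>m. \<not> Q m", OF exQ])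
    have Q_less: "Q m" if "m < k" for m
      using not_less_Least[of m "\<lambda>m. \<not> Q m"] that unfolding k_def by blast
    have "Q 0" using h by (simp add: Q_def)
    then have k0: "k > 0" using Qk by (cases k) auto
    define T where "T = (\<lambda>m. h - int m * int n) ` {..<k}"
    have TQ: "i \<in> K0" "i + 1 \<notin> K0" "i \<le> h" if "i \<in> T" for i
      using that Q_less by (auto simp: T_def Q_def)
    have TA: "T \<subseteq> A" using TQ h(4) by (fastforce simp: K0_def)
    have hT: "h \<in> T" using k0 by (force simp: T_def)
    have finT: "finite T" by (simp add: T_def)
    have cT: "card T = k" unfolding T_def using n by (subst card_image) (auto simp: inj_on_def)
    have Tdisj: "raise T \<inter> K0 = {}" using TQ by auto
    obtain p where p: "1 \<le> p" "p \<le> n" "in_class n p h"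
      using residue_index[of n h] n by auto
    have resT: "in_class n p i" if i: "i \<in> T" for i
    proof -
      obtain m where "i = h - int m * int n" using i by (auto simp: T_def)
      then have "i - 1 = (h - 1) + (- int m) * int n" by simp
      then have "(i - 1) mod int n = (h - 1) mod int n" using mod_mult_self1[of "h - 1" "- int m" "int n"] by (simp only:)
      then show ?thesis using p(3) by simp
    qed
    define A1 where "A1 = (A - T) \<union> raise T"
    define K1 where "K1 = maya N A1"
    have K1: "K1 = (K0 - T) \<union> raise T"
      using TA A(1) by (auto simp: K1_def K0_def A1_def)
    have A1: "A1 \<subseteq> {..int N}" "finite A1" using A TQ(3) h(4) finT by (force simp: A1_def)+
    have TdisjA: "raise T \<inter> A = {}" using Tdisj by (auto simp: K0_def)
    have cA1: "card A1 = N" unfolding A1_def using card_raise[OF A(2) TA TdisjA] A(3) by simp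
    note sumA1 = sum_raise[OF A(2) TA TdisjA, folded A1_def]
    \<comment> \<open>Only a raised particle can spoil the condition. Each raised one is followed by
      the next raised one, the top one by \<open>h + n\<close>; the particle left
      \<open>n + 1\<close> below its old neighbour is the one where the chain stopped.\<close>
    have restricted1: "\<exists>j\<in>K1. i < j \<and> j \<le> i + int n" if i: "i \<in> K1" for i
    proof (cases "i \<in> raise T")
      case True
      then obtain m where m: "m < k" "i = h - int m * int n + 1" by (auto simp: T_def)
      show ?thesis
      proof (cases m)
        case 0
        have "h + int n \<in> K0" using tail by simp
        moreover have "h + int n \<notin> T" using TQ(3)[of "h + int n"] n by auto
        ultimately have "h + int n \<in> K1" by (auto simp: K1)
        then show ?thesis using m 0 n by (intro bexI[of _ "h + int n"]) auto
      next
        case (Suc m')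
        then have "h - int m' * int n \<in> T" using m by (auto simp: T_def)
        then have "h - int m' * int n + 1 \<in> K1" by (auto simp: K1)
        then show ?thesis using m Suc n by (intro bexI[of _ "h - int m' * int n + 1"]) (auto simp: algebra_simps)
      qed
    next
      case False
      then have iK: "i \<in> K0" "i \<notin> T" using i by (auto simp: K1)
      obtain j where j: "j \<in> K0" "i < j" "j \<le> i + int n" using restricted[folded K0_def, OF iK(1)] by blast
      show ?thesis
      proof (cases "j \<in> T")
        case False
        then show ?thesis using j by (intro bexI[of _ j]) (auto simp: K1)
      next
        case True
        then have j1: "j + 1 \<in> K1" by (auto simp: K1)
        show ?thesis
        proof (cases "j + 1 \<le> i + int n")
          case True
          then show ?thesis using j1 j by (intro bexI[of _ "j + 1"]) auto
        next
          case False
          then have ji: "j = i + int n" using j by simp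
          obtain m where m: "m < k" "j = h - int m * int n" using \<open>j \<in> T\<close> by (auto simp: T_def)
          have im: "i = h - int (Suc m) * int n" using m ji by (simp add: algebra_simps)
          \<comment> \<open>Otherwise \<open>i\<close> would satisfy \<open>Q\<close> and continue
            the chain.\<close>
          have "i + 1 \<in> K0"
          proof (rule ccontr)
            assume "i + 1 \<notin> K0"
            then have "Q (Suc m)" using iK(1) unfolding Q_def im by blast
            then have "Suc m \<noteq> k" using Qk by blast
            then have "Suc m \<in> {..<k}" using m(1) by simp
            then have "h - int (Suc m) * int n \<in> T" unfolding T_def by (rule imageI)
            then show False using iK(2) im by blast
          qed
          moreover have "i + 1 \<notin> T"
          proof
            assume "i + 1 \<in> T"
            then have r1: "(i + 1 - 1) mod int n = int p - 1" by (rule resT)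
            have "i - 1 = (j - 1) + (- 1) * int n" using ji by simp
            then have "(i - 1) mod int n = (j - 1) mod int n" using mod_mult_self1[of "j - 1" "- 1" "int n"] by (simp only:)
            then have "in_class n p i" using resT[OF \<open>j \<in> T\<close>] by simp
            then show False using not_both_residue[OF n _ r1] by blast
          qed
          ultimately have "i + 1 \<in> K1" by (auto simp: K1)
          then show ?thesis using n by (intro bexI[of _ "i + 1"]) auto
        qed
      qed
    qed
    \<comment> \<open>Stated for \<open>B = A1\<close> together with all \<open>B\<close> of larger
      square sum: the first gives the value of \<open>lower_op\<close> at \<open>K1\<close>, the
      second the hypothesis on larger diagrams needed for the induction.\<close>
    have key: "lower (maya N B) T' = K0 \<and> T' = T \<or> a (lower (maya N B) T') = 0"
      if B: "B \<subseteq> {..int N}" "finite B" "card B = N" "\<Sum>B = \<Sum>A1"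
        and sq: "(\<Sum>i\<in>A1. i\<^sup>2) < (\<Sum>i\<in>B. i\<^sup>2) \<or> B = A1"
        and holes: "\<And>x. x \<notin> maya N B \<Longrightarrow> \<exists>y. y \<notin> K1 \<and> x \<le> y"
        and T': "T' \<in> moves n p k (maya N B)" for B T'
    proof (cases "B = A1 \<and> T' = T")
      case True
      have "lower K1 T = K0" using Tdisj TQ by (auto simp: lower_def K1)
      then show ?thesis using True by (simp add: K1_def)
    next
      case False
      have mv: "finite T'" "card T' = k" "T' \<inter> (maya N B) = {}" "raise T' \<subseteq> maya N B"
        "\<And>i. i \<in> T' \<Longrightarrow> in_class n p i" using T' by (auto simp: moves_def)
      \<comment> \<open>The condition on holes enters here: a hole of \<open>B\<close> lies at or
        below a hole of \<open>K1\<close>, hence below \<open>h + n\<close>, and being in the class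
        of \<open>h\<close> it is at most \<open>h\<close>.\<close>
      have T'h: "i \<le> h" if i: "i \<in> T'" for i
      proof -
        obtain y where y: "y \<notin> K1" "i \<le> y" using holes[of i] mv(3) i by blast
        have "\<not> h + int n \<le> y"
        proof
          assume "h + int n \<le> y"
          then have "y \<in> K0" "y \<notin> T" using tail TQ(3)[of y] n by auto
          then show False using y(1) by (auto simp: K1)
        qed
        then show ?thesis using residue_le[of i n h] mv(5)[OF i] p(3) y(2) by simp
      qed
      have T'B: "raise T' \<subseteq> B" using mv(4) T'h h(4) by fastforce
      define B0 where "B0 = (B - raise T') \<union> T'"
      have lowB: "lower (maya N B) T' = maya N B0"
        using T'h h(4) unfolding lower_def B0_def by fastforce
      have B0: "B0 \<subseteq> {..int N}" "finite B0" using B mv(1) T'h h(4) by (force simp: B0_def)+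
      have "B = (B0 - T') \<union> raise T'" using mv(3) T'B by (auto simp: B0_def)
      moreover have "T' \<subseteq> B0" "raise T' \<inter> B0 = {}"
        using not_both_residue[OF n mv(5) mv(5)] by (auto simp: B0_def)
      ultimately have sumB: "(\<Sum>i\<in>B. f i) = (\<Sum>i\<in>B0. f i) + (\<Sum>i\<in>T'. f (i + 1) - f i)"
          and cB0: "card B0 = N" for f :: "int \<Rightarrow> int"
        using sum_raise[OF B0(2), of T'] card_raise[OF B0(2), of T'] B(3) by metis+
      have sum1: "\<Sum>B0 = \<Sum>A"
        using sumB[of "\<lambda>i. i"] sumA1[of "\<lambda>i. i"] B(4) mv(2) cT by simp
      \<comment> \<open>As \<open>T\<close> and \<open>T'\<close> have the same size, comparing
        square sums before and after the moves reduces to comparing \<open>\<Sum>T'\<close> with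
        \<open>\<Sum>T\<close>.\<close>
      have sqdiff: "(\<Sum>i\<in>S. (i + 1)\<^sup>2 - i\<^sup>2) = 2 * \<Sum>S + int (card S)" for S :: "int set"
        by (simp add: power2_eq_square algebra_simps sum.distrib sum_distrib_left)
      have le: "\<Sum>T' < \<Sum>T \<or> T' = T"
      proof (cases "T' = T")
        case False
        then show ?thesis
          using sum_upper_progression[of n T' k h] n mv(1,2,5) T'h p(3) unfolding T_def by auto
      qed simp
      have "(\<Sum>i\<in>A. i\<^sup>2) < (\<Sum>i\<in>B0. i\<^sup>2)"
      proof -
        have "(\<Sum>i\<in>A. i\<^sup>2) = (\<Sum>i\<in>A1. i\<^sup>2) - 2 * \<Sum>T - int k" using sumA1[of "\<lambda>i. i\<^sup>2"] sqdiff[of T] cT by simp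
        moreover have "(\<Sum>i\<in>B0. i\<^sup>2) = (\<Sum>i\<in>B. i\<^sup>2) - 2 * \<Sum>T' - int k" using sumB[of "\<lambda>i. i\<^sup>2"] sqdiff[of T'] mv(2) by simp
        ultimately show ?thesis using sq le False by auto
      qed
      \<comment> \<open>Up to \<open>h + 1\<close> the hole \<open>h + 1\<close> of
        \<open>K0\<close> serves as the bound; above it the moves have changed nothing.\<close>
      moreover have "\<exists>y. y \<notin> maya N A \<and> x \<le> y" if x: "x \<notin> maya N B0" for x
      proof (cases "x \<le> h + 1")
        case True
        then show ?thesis using h(3) by (auto simp: K0_def)
      next
        case False
        then have "x \<notin> raise T'" using T'h by auto
        then have "x \<notin> maya N B" using x by (auto simp: B0_def)
        then obtain y where y: "y \<notin> K1" "x \<le> y" using holes by blast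
        then have "y \<notin> K0" using TQ(3)[of y] False by (auto simp: K1)
        then show ?thesis using y(2) by (auto simp: K0_def)
      qed
      ultimately have "a (maya N B0) = 0" using larger[OF B0 cB0 sum1] by blast
      then show ?thesis using lowB by simp
    qed
    have "lower_op n p k a (maya N A1) = 0"
    proof (rule less.hyps[OF _ A1 cA1])
      have "(\<Sum>i\<in>A1. int N - i) = (\<Sum>i\<in>A. int N - i) - int k" using sumA1[of "\<lambda>i. int N - i"] cT by simp
      moreover have "0 \<le> (\<Sum>i\<in>A1. int N - i)" using A1 by (intro sum_nonneg) auto
      ultimately show "nat (\<Sum>i\<in>A1. int N - i) < nat (\<Sum>i\<in>A. int N - i)" using k0 by simp
      show "\<And>i. i \<in> maya N A1 \<Longrightarrow> \<exists>j\<in>maya N A1. i < j \<and> j \<le> i + int n"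
        using restricted1 unfolding K1_def by blast
      show "Ann n (lower_op n p k a)" by (rule Ann_lower_op[OF n p(1,2) ann])
      fix B assume B: "B \<subseteq> {..int N}" "finite B" "card B = N" "\<Sum>B = \<Sum>A1" "(\<Sum>i\<in>A1. i\<^sup>2) < (\<Sum>i\<in>B. i\<^sup>2)"
        and holes: "\<And>x. x \<notin> maya N B \<Longrightarrow> \<exists>y. y \<notin> maya N A1 \<and> x \<le> y"
      have "a (lower (maya N B) T') = 0" if T': "T' \<in> moves n p k (maya N B)" for T'
      proof -
        have "lower (maya N B) T' \<noteq> K0 \<or> T' \<noteq> T"
        proof (rule ccontr)
          assume "\<not> ?thesis"
          then have "lower (maya N B) T = K0" "T' = T" by auto
          then have "maya N B = (K0 - T) \<union> raise T"
            using T' unfolding lower_def moves_def by auto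
          then have "maya N B = maya N A1" using K1 K1_def by simp
          then have "B = A1" using B(1) A1(1) by fastforce
          then show False using B(5) by simp
        qed
        then show ?thesis using key[OF B(1-4) _ _ T'] B(5) holes unfolding K1_def by blast
      qed
      then show "lower_op n p k a (maya N B) = 0" unfolding lower_op_def by (simp add: sum.neutral)
    qed
    moreover have "lower_op n p k a K1 = a K0"
    proof -
      have "finite (moves n p k K1)"
        by (rule finite_moves[of _ "lo" "int N"]) (use lo A1 lo_h TA in \<open>auto simp: K1_def A1_def\<close>)
      moreover have "T \<in> moves n p k K1"
        using finT cT resT TQ Tdisj by (auto simp: moves_def K1)
      moreover have "lower K1 T = K0" using Tdisj TQ by (auto simp: lower_def K1)
      moreover have "a (lower K1 T') = 0" if "T' \<in> moves n p k K1 - {T}" for T'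
        using key[of A1 T', OF A1 cA1] that unfolding K1_def by blast
      ultimately show ?thesis unfolding lower_op_def by (simp add: sum.remove[of _ T] sum.neutral)
    qed
    ultimately show ?thesis by (simp add: K1_def K0_def)
  qed
qed

section \<open>Leading terms of the shuffles\<close>

text \<open>For \<open>n >= 2\<close> the bound \<open>low n S\<close> is at most
  \<open>1 - S\<close> and so passes below any finite set.\<close>

lemma fits_large_level:
  assumes n: "n \<ge> 2" and B: "B \<subseteq> {..int (s * n)}" "finite B" "card B = s * n"
  shows "\<exists>S\<ge>s1. S \<ge> s \<and> fits n S (maya (s * n) B)"
proof -
  define m where "m = Min (insert 0 B)"
  have m: "m \<le> i" if "i \<in> B" for i using B(2) that by (auto simp: m_def)
  define S where "S = max (max s1 s) (nat (1 - m))"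
  have sS: "s \<le> S" by (simp add: S_def)
  have snS: "int (s * n) \<le> int (S * n)" using sS by (simp del: of_nat_mult)
  have eq: "(maya (s * n) B) \<inter> {..int (S * n)} = B \<union> {int (s * n) + 1..int (S * n)}"
    using B(1) snS by auto
  have "int S * 1 \<le> int S * (int n * (int n - 1))"
    using n mult_mono[of 1 "int n" 1 "int n - 1"] by (intro mult_left_mono) simp_all
  moreover have "1 - m \<le> int S" by (simp add: S_def)
  ultimately have lo: "low n S \<le> m" by (simp add: mult.assoc)
  have "B \<inter> {int (s * n) + 1..int (S * n)} = {}" using B(1) by fastforce
  then have "card (B \<union> {int (s * n) + 1..int (S * n)}) = card B + card {int (s * n) + 1..int (S * n)}"
    using B(2) by (intro card_Un_disjoint) auto
  also have "\<dots> = S * n" using B(3) snS by (simp add: nat_diff_distrib del: of_nat_mult)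
  finally have card: "card (B \<union> {int (s * n) + 1..int (S * n)}) = S * n" .
  have "B \<union> {int (s * n) + 1..int (S * n)} \<subseteq> level_idx n S"
  proof
    fix i assume i: "i \<in> B \<union> {int (s * n) + 1..int (S * n)}"
    then have "i \<le> int (S * n)" using B(1) snS by auto
    moreover have "low n S \<le> i"
    proof (cases "i \<in> B")
      case True
      then show ?thesis using lo m by force
    next
      case False
      then have "1 \<le> i" using i of_nat_0_le_iff[of "s * n"] by (auto simp del: of_nat_mult)
      then show ?thesis using level_bound_le_1[of n S] n by linarith
    qed
    ultimately show "i \<in> level_idx n S" by (simp add: level_idx_def)
  qed
  then have "fits n S (maya (s * n) B)"
    using card snS unfolding fits_def eq by (auto simp: level_sets_def)
  then show ?thesis using sS by (intro exI[of _ S]) (auto simp: S_def)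
qed

lemma ev_sum:
  "ev n s (\<lambda>K. b K + (\<Sum>A\<in>X. c A * g A K)) = ev n s b + (\<Sum>A\<in>X. scale_form (c A) (ev n s (g A)))"
proof
  fix vs
  have "ev n s (\<lambda>K. b K + (\<Sum>A\<in>X. c A * g A K)) vs = ev n s b vs +
     (\<Sum>I\<in>level_sets n s. \<Sum>A\<in>X. c A * (g A (maya (s * n) I) * plucker n s (row_list I) vs))"
    unfolding ev_def by (simp add: sum.distrib distrib_right sum_distrib_right mult.assoc)
  also have "\<dots> = ev n s b vs + (\<Sum>A\<in>X. c A * ev n s (g A) vs)"
    unfolding ev_def by (subst sum.swap) (simp add: sum_distrib_left)
  finally show "ev n s (\<lambda>K. b K + (\<Sum>A\<in>X. c A * g A K)) vs =
      (ev n s b + (\<Sum>A\<in>X. scale_form (c A) (ev n s (g A)))) vs"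
    by (simp add: sum_fun_apply scale_form_def)
qed

lemma Ann_sum:
  assumes "Ann n b" "\<And>A. A \<in> X \<Longrightarrow> Ann n (g A)"
  shows "Ann n (\<lambda>K. b K + (\<Sum>A\<in>X. c A * g A K))"
  using assms unfolding Ann_def ev_sum by (auto simp: sum_fun_apply scale_form_def intro!: sum.neutral)

lemma Ann_diff:
  assumes "Ann n a" "Ann n b" shows "Ann n (\<lambda>K. a K - b K)"
  using Ann_sum[of n a "{()}" "\<lambda>_. b" "\<lambda>_. - 1"] assms by simp

text \<open>
  If \<open>i0\<close> and the next \<open>n\<close> positions show that \<open>A\<close> is not restricted, then raise all particles up to
  \<open>i0\<close> by \<open>n\<close> and take the shuffle lowering that many particles. Lowering the lowest ones gives the
  largest sum of squares, so \<open>A\<close> is the leading term.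
\<close>

lemma shuffle_leading_term:
  assumes n: "n \<ge> 2" and s: "1 \<le> s"
    and A: "A \<subseteq> {..int (s * n)}" "finite A" "card A = s * n"
    and i0: "i0 \<in> maya (s * n) A" "\<And>j. j \<in> maya (s * n) A \<Longrightarrow> i0 < j \<Longrightarrow> i0 + int n < j"
  shows "\<exists>g. Ann n g \<and> ev n s g \<in> form.span ((\<lambda>f. f s) ` shuffle_relations n) \<and>
    g (maya (s * n) A) = (1 :: 'a::alg_closed_field) \<and>
    (\<forall>B. B \<subseteq> {..int (s * n)} \<longrightarrow> finite B \<longrightarrow> card B = s * n \<longrightarrow> (\<Sum>i\<in>A. i\<^sup>2) \<le> (\<Sum>i\<in>B. i\<^sup>2) \<longrightarrow> B \<noteq> A \<longrightarrow>
       g (maya (s * n) B) = 0)"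
proof -
  define N where "N = s * n"
  have n1: "n \<ge> 1" using n by simp
  note A = A[folded N_def] and i0 = i0[folded N_def]
  \<comment> \<open>All indices beyond \<open>N\<close> are particles, so otherwise
    \<open>i0 + n\<close> itself would be a particle inside the gap.\<close>
  have i0N: "i0 + int n \<le> int N"
  proof (rule ccontr)
    assume "\<not> i0 + int n \<le> int N"
    then have "i0 + int n \<in> maya N A" by simp
    then show False using i0(2)[of "i0 + int n"] n by simp
  qed
  have i0A: "i0 \<in> A" using i0(1) i0N n by auto
  define L where "L = {i \<in> A. i \<le> i0}"
  define l where "l = card L"
  define Ln where "Ln = (\<lambda>i. i + int n) ` L"
  have L: "L \<subseteq> A" "finite L" "i0 \<in> L" using A(2) i0A by (auto simp: L_def)
  have l1: "1 \<le> l" using L(2,3) by (auto simp: l_def Suc_le_eq card_gt_0_iff)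
  have lN: "l \<le> N" using card_mono[OF A(2) L(1)] A(3) by (simp add: l_def)
  have cLn: "card Ln = l" unfolding Ln_def l_def by (intro card_image) auto
  have Ln: "i \<le> i0 + int n" if "i \<in> Ln" for i using that by (auto simp: Ln_def L_def)
  have AL: "i0 + int n < i" if "i \<in> A - L" for i using that i0(2)[of i] by (auto simp: L_def)
  define A1 where "A1 = (A - L) \<union> Ln"
  define K1 where "K1 = maya N A1"
  have disj: "(A - L) \<inter> Ln = {}" using Ln AL by force
  have A1: "A1 \<subseteq> {..int N}" "finite A1" using A Ln i0N L by (force simp: A1_def Ln_def)+
  have cA1: "card A1 = N"
    unfolding A1_def using disj A L cLn card_mono[OF A(2) L(1)]
    by (subst card_Un_disjoint) (auto simp: card_Diff_subset Ln_def l_def)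
  obtain s0 where s0: "1 \<le> s0" "\<And>s. s0 \<le> s \<Longrightarrow> fits n s K1"
    "\<And>s. s0 \<le> s \<Longrightarrow> shuffle_index TYPE('a) n s (K1 \<inter> {..int (s * n)})"
    using shuffle_index_large_level[OF n A1 cA1, where 'a = 'a] unfolding K1_def by blast
  define s1 where "s1 = max s s0"
  have s1: "1 \<le> s1" "s \<le> s1" "s0 \<le> s1" using s by (auto simp: s1_def)
  define h where "h s = (shuffle n s (K1 \<inter> {..int (s * n)}) l :: 'a lvec list \<Rightarrow> 'a)" for s
  have fitsK1: "fits n s K1" if "s1 \<le> s" for s using s0(2)[of s] that s1 by simp
  have LSK1: "K1 \<inter> {..int (s * n)} \<in> level_sets n s" if "s1 \<le> s" for s
    using fitsK1[OF that] by (simp add: fits_def)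
  have compat: "h s vs = h (Suc s) (vs @ tail n s)" if "s1 \<le> s" "vs \<in> frames n s (Gr_inf n)" for s vs
    unfolding h_def fits_Suc(2)[OF n1 fitsK1[OF that(1)]]
    using level_sets_finite[OF LSK1[OF that(1)]] by (intro shuffle_append_tail[OF n1 that(2), symmetric]) auto
  have hLF: "h s \<in> level_forms n s" if "s1 \<le> s" for s
    unfolding h_def using LSK1[OF that] level_sets_finite[OF LSK1[OF that]]
    by (intro shuffle_level_forms[OF n1]) (auto simp: level_sets_def)
  \<comment> \<open>The shuffle \<open>h\<close> is prescribed only from \<open>s1\<close> on; its
    coefficient function supplies the components at the lower levels, in particular at
    \<open>s\<close> itself.\<close>
  define g where "g = coefs n s1 h"
  have evg: "ev n s' g = h s'" if "s1 \<le> s'" for s'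
    unfolding g_def by (rule ev_coefs[OF n1 compat that hLF[OF that]])
  define f where "f = (\<lambda>s. if s = 0 then 0 else ev n s g)"
  have f_in: "f \<in> shuffle_relations n"
  proof -
    have "f \<in> coord_ring1 n" using ev_coord_ring1[OF n1, of g] by (simp add: f_def)
    moreover have "f s' = shuffle n s' ((K1 \<inter> {..int (s1 * n)}) \<union> {int (s1 * n) + 1..int (s' * n)}) l"
      if "s1 \<le> s'" for s'
    proof -
      have "{int (s1 * n)<..} \<subseteq> K1" using fitsK1[of s1] by (simp add: fits_def)
      moreover have le: "int (s1 * n) \<le> int (s' * n)" using that by (simp del: of_nat_mult)
      ultimately have "K1 \<inter> {..int (s' * n)} = (K1 \<inter> {..int (s1 * n)}) \<union> {int (s1 * n) + 1..int (s' * n)}"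
        by (auto simp: subset_iff simp del: of_nat_mult of_nat_le_iff intro: order_trans[OF _ le])
      then show ?thesis using evg[OF that] that s1(1) by (simp add: f_def h_def del: of_nat_mult)
    qed
    moreover have "l \<le> s1 * n" using lN s1(2) unfolding N_def by (meson le_trans mult_le_mono1)
    ultimately show ?thesis
      unfolding shuffle_relations_def using s1(1) s0(3)[OF s1(3)] l1 by blast
  qed
  have "Ann n g"
    unfolding Ann_def
  proof (intro allI impI)
    fix s' and vs :: "'a lvec list" assume "1 \<le> s'" "tframe n s' vs"
    then have "f s' vs = 0" using shuffle_relation_eq_0[OF n1 f_in] tframe_frames[OF n1] by blast
    then show "ev n s' g vs = 0" using \<open>1 \<le> s'\<close> by (simp add: f_def)
  qed
  moreover have "ev n s g \<in> form.span ((\<lambda>f. f s) ` shuffle_relations n)"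
  proof -
    have "ev n s g = f s" using s by (simp add: f_def)
    then show ?thesis using f_in by (auto intro: form.span_base)
  qed
  \<comment> \<open>\<open>B\<close> need not have level \<open>s\<close>, so its coefficient is
    computed at a level \<open>S\<close> that accommodates \<open>B\<close> and the shuffle.\<close>
  moreover have g_val: "g (maya N B) = (if B = A then 1 else 0)"
    if B: "B \<subseteq> {..int N}" "finite B" "card B = N" "(\<Sum>i\<in>A. i\<^sup>2) \<le> (\<Sum>i\<in>B. i\<^sup>2)" for B
  proof -
    obtain S where S: "s1 \<le> S" "s \<le> S" "fits n S (maya N B)"
      using fits_large_level[OF n B(1-3)[unfolded N_def]] unfolding N_def by blast
    have snS: "int N \<le> int (S * n)" using S(2) by (simp add: N_def del: of_nat_mult)
    define R where "R = {int N + 1..int (S * n)}"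
    have cut: "(maya N X) \<inter> {..int (S * n)} = X \<union> R" if "X \<subseteq> {..int N}" for X
      using that snS by (auto simp: R_def)
    have cutB: "(maya N B) \<inter> {..int (S * n)} = B \<union> R" and cutK1: "K1 \<inter> {..int (S * n)} = A1 \<union> R"
      using cut[OF B(1)] cut[OF A1(1)] by (auto simp: K1_def)
    have disjR: "X \<inter> R = {}" if "X \<subseteq> {..int N}" for X using that by (force simp: R_def)
    have LSB: "B \<union> R \<in> level_sets n S" using S(3) cutB by (simp add: fits_def)
    define \<phi> where "\<phi> J i = (if i \<in> J then i - int n else i)" for J i
    define js where "js = row_list (A1 \<union> R)"
    have fA1R: "finite (A1 \<union> R)" using A1 by (simp add: R_def)
    have js: "set js = A1 \<union> R" "distinct js" using fA1R by (auto simp: js_def)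
    have gB: "g (maya N B) = (\<Sum>J | J \<subseteq> A1 \<union> R \<and> card J = l. minor n (map (\<phi> J) js) (coord_frame n (B \<union> R)))"
    proof -
      have "g (maya N B) = h S (coord_frame n (B \<union> R))"
        unfolding g_def using coefs_eq[of n s1 h S "maya N B", OF n1 compat S(1,3)] by (simp only: cutB)
      then show ?thesis
        using coord_frame_frames[OF n1 LSB, where 'a = 'a] unfolding h_def shuffle_minor cutK1 \<phi>_def js_def
        by (simp only: if_True)
    qed
    have LnA1: "Ln \<subseteq> A1 \<union> R" by (auto simp: A1_def)
    \<comment> \<open>For fixed \<open>l\<close> the square sum after lowering depends on
      \<open>J\<close> only through \<open>\<Sum>J\<close>. It is largest for the \<open>l\<close>
      lowest elements, which form \<open>Ln\<close>.\<close>
    have sq: "(\<Sum>i\<in>A1 \<union> R. (\<phi> J i)\<^sup>2) = (\<Sum>i\<in>A1 \<union> R. i\<^sup>2) + int l * (int n)\<^sup>2 - 2 * int n * \<Sum>J"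
      if J: "J \<subseteq> A1 \<union> R" "card J = l" for J
    proof -
      have "(\<Sum>i\<in>A1 \<union> R. (\<phi> J i)\<^sup>2) = (\<Sum>i\<in>A1 \<union> R. i\<^sup>2 + (if i \<in> J then (int n)\<^sup>2 - 2 * int n * i else 0))"
        by (intro sum.cong) (auto simp: \<phi>_def power2_eq_square algebra_simps)
      also have "\<dots> = (\<Sum>i\<in>A1 \<union> R. i\<^sup>2) + (\<Sum>i\<in>J. (int n)\<^sup>2 - 2 * int n * i)"
        using J(1) fA1R by (simp add: sum.distrib sum.inter_restrict[symmetric] Int_absorb1)
      also have "(\<Sum>i\<in>J. (int n)\<^sup>2 - 2 * int n * i) = int l * (int n)\<^sup>2 - 2 * int n * \<Sum>J"
        using J(2) by (simp add: sum_subtractf sum_distrib_left)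
      finally show ?thesis by simp
    qed
    have imgLn: "\<phi> Ln ` (A1 \<union> R) = A \<union> R"
    proof -
      have "R \<inter> Ln = {}" using Ln i0N by (force simp: R_def)
      then have "\<phi> Ln ` (A1 \<union> R) = (A - L) \<union> R \<union> (\<lambda>i. i - int n) ` Ln"
        using disj unfolding A1_def \<phi>_def by (auto simp: image_iff)
      also have "(\<lambda>i. i - int n) ` Ln = L" by (force simp: Ln_def)
      finally show ?thesis using L(1) by auto
    qed
    \<comment> \<open>Elements outside \<open>Ln\<close> lie above those of \<open>Ln\<close>, so
      lowering \<open>Ln\<close> preserves the order and the leading coefficient is 1 without a
      sign.\<close>
    have monoLn: "\<phi> Ln i < \<phi> Ln j" if "i \<in> A1 \<union> R" "j \<in> A1 \<union> R" "i < j" for i j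
    proof (cases "i \<notin> Ln \<and> j \<in> Ln")
      case True
      then have "i0 + int n < i" using that(1) AL i0N by (auto simp: A1_def R_def)
      then show ?thesis using Ln[of j] True that(3) by simp
    qed (use that n in \<open>auto simp: \<phi>_def\<close>)
    have injLn: "inj_on (\<phi> Ln) (A1 \<union> R)"
      using monoLn by (metis inj_onI less_irrefl linorder_neqE)
    have sumA: "(\<Sum>i\<in>A \<union> R. i\<^sup>2) = (\<Sum>i\<in>A1 \<union> R. i\<^sup>2) + int l * (int n)\<^sup>2 - 2 * int n * \<Sum>Ln"
      using sum.reindex[OF injLn, of "\<lambda>i. i\<^sup>2"] sq[OF LnA1 cLn] unfolding imgLn by (simp add: o_def)
    have zero: "minor n (map (\<phi> J) js) (coord_frame n (B \<union> R)) = 0"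
      if J: "J \<subseteq> A1 \<union> R" "card J = l" "J \<noteq> Ln" for J
    proof (rule ccontr)
      assume nz: "minor n (map (\<phi> J) js) (coord_frame n (B \<union> R)) \<noteq> 0"
      have img: "\<phi> J ` (A1 \<union> R) = B \<union> R"
        using nz minor_coord_frame_eq_0[OF n1, of "B \<union> R" "map (\<phi> J) js"] level_sets_finite[OF LSB] js by auto
      have inj: "inj_on (\<phi> J) (A1 \<union> R)"
        using nz minor_not_distinct[of "map (\<phi> J) js"] js by (auto simp: distinct_map)
      have fJ: "finite J" using J(1) fA1R finite_subset by blast
      have "\<Sum>Ln < \<Sum>J"
      proof (rule sum_less_of_exchange)
        show "finite J" "finite Ln" "card J = card Ln" "J \<noteq> Ln" using fJ L J cLn by (auto simp: Ln_def)
        fix x y assume "x \<in> J - Ln" "y \<in> Ln - J"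
        then have "x \<in> (A - L) \<union> R" "y \<le> i0 + int n" using J(1) Ln by (auto simp: A1_def)
        then show "y < x" using AL[of x] i0N by (auto simp: R_def)
      qed
      then have "int n * \<Sum>Ln < int n * \<Sum>J" using n by simp
      moreover have "(\<Sum>i\<in>B \<union> R. i\<^sup>2) = (\<Sum>i\<in>A1 \<union> R. i\<^sup>2) + int l * (int n)\<^sup>2 - 2 * int n * \<Sum>J"
        using sum.reindex[OF inj, of "\<lambda>i. i\<^sup>2"] sq[OF J(1,2)] unfolding img by (simp add: o_def)
      ultimately have "(\<Sum>i\<in>B \<union> R. i\<^sup>2) < (\<Sum>i\<in>A \<union> R. i\<^sup>2)" using sumA by simp
      moreover have "(\<Sum>i\<in>X \<union> R. i\<^sup>2) = (\<Sum>i\<in>X. i\<^sup>2) + (\<Sum>i\<in>R. i\<^sup>2)" if "X \<subseteq> {..int N}" "finite X" for X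
        using that disjR by (intro sum.union_disjoint) (auto simp: R_def)
      ultimately show False using B A by simp
    qed
    have "g (maya N B) = minor n (map (\<phi> Ln) js) (coord_frame n (B \<union> R))"
    proof -
      have "finite {J. J \<subseteq> A1 \<union> R \<and> card J = l}" using fA1R by simp
      moreover have "Ln \<in> {J. J \<subseteq> A1 \<union> R \<and> card J = l}" using LnA1 cLn by simp
      ultimately show ?thesis unfolding gB using zero by (subst sum.remove[of _ Ln]) (auto intro!: sum.neutral)
    qed
    also have "map (\<phi> Ln) js = row_list (A \<union> R)"
      unfolding js_def imgLn[symmetric] by (rule sorted_list_of_set_image[OF fA1R monoLn, symmetric])
    also have "minor n (row_list (A \<union> R)) (coord_frame n (B \<union> R)) = (if B = A then 1 else 0)"
    proof (cases "B = A")
      case True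
      then show ?thesis using minor_coord_frame_self[OF n1, of "A \<union> R"] A(2) by (simp add: R_def)
    next
      case False
      then have "A \<union> R \<noteq> B \<union> R" using disjR[OF A(1)] disjR[OF B(1)] by blast
      then show ?thesis
        using False minor_coord_frame_eq_0[OF n1, of "B \<union> R" "row_list (A \<union> R)"] A(2) B(2) by (simp add: R_def)
    qed
    finally show ?thesis .
  qed
  ultimately show ?thesis using A unfolding N_def[symmetric] by (intro exI[of _ g]) auto
qed

text \<open>
  Diagrams are treated by decreasing sum of squares: on restricted ones the coefficients agree already,
  on the others a shuffle corrects them. Shuffles may leave the given level from below, hence the larger
  finite set \<open>\<Lambda>\<close>, which depends only on the sum of the elements.
\<close>

lemma Ann_imp_span_shuffles:
  fixes a :: "int set \<Rightarrow> 'a::alg_closed_field"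
  assumes n: "n \<ge> 2" and s: "1 \<le> s" and a: "Ann n a"
  shows "ev n s a \<in> form.span ((\<lambda>f. f s) ` shuffle_relations n)"
proof -
  define N where "N = s * n"
  \<comment> \<open>A lower bound for the sum of a level set, whose \<open>N\<close> elements are
    all at least \<open>low n s\<close>.\<close>
  define c where "c = int N * (low n s)"
  define \<Lambda> where "\<Lambda> = {A. A \<subseteq> {..int N} \<and> finite A \<and> card A = N \<and> c \<le> \<Sum>A}"
  define q where "q A = (\<Sum>i\<in>A. i\<^sup>2)" for A :: "int set"
  have q0: "0 \<le> q A" for A by (simp add: q_def sum_nonneg)
  have "finite \<Lambda>"
  proof (rule finite_subset)
    \<comment> \<open>With the other elements at most \<open>int N\<close> and the sum at least
      \<open>c\<close>, no element can be very low.\<close>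
    show "\<Lambda> \<subseteq> Pow {c - int N * int N..int N}"
    proof (intro subsetI PowI)
      fix A i assume A: "A \<in> \<Lambda>" and i: "i \<in> A"
      have "\<Sum>A = i + \<Sum>(A - {i})" using A i by (auto simp: \<Lambda>_def intro: sum.remove)
      moreover have "\<Sum>(A - {i}) \<le> of_nat (card (A - {i})) * int N"
        using A by (intro sum_bounded_above) (auto simp: \<Lambda>_def)
      moreover have "card (A - {i}) \<le> N" using A card_Diff1_le[of A i] by (simp add: \<Lambda>_def)
      then have "of_nat (card (A - {i})) * int N \<le> int N * int N" by (intro mult_right_mono) auto
      ultimately have "c - int N * int N \<le> i" using A by (simp add: \<Lambda>_def)
      then show "i \<in> {c - int N * int N..int N}" using A i by (auto simp: \<Lambda>_def)
    qed
  qed simp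
  \<comment> \<open>Exceeds every square sum on \<open>\<Lambda>\<close>, so the induction starts
    with nothing to correct.\<close>
  define M where "M = Max (insert 0 (q ` \<Lambda>)) + 1"
  have M: "q A < M" if "A \<in> \<Lambda>" for A
    using Max_ge[of "insert 0 (q ` \<Lambda>)" "q A"] \<open>finite \<Lambda>\<close> that by (simp add: M_def)
  have M0: "0 \<le> M" using Max_ge[of "insert 0 (q ` \<Lambda>)" 0] \<open>finite \<Lambda>\<close> by (simp add: M_def)
  define restr where "restr A \<longleftrightarrow> (\<forall>i\<in>maya N A. \<exists>j\<in>maya N A. i < j \<and> j \<le> i + int n)" for A
  define Sp where "Sp = form.span ((\<lambda>f. f s) ` (shuffle_relations n :: (nat \<Rightarrow> 'a lvec list \<Rightarrow> 'a) set))"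
  have "\<exists>g. \<forall>A. A \<in> \<Lambda> \<and> \<not> restr A \<longrightarrow> Ann n (g A) \<and> ev n s (g A) \<in> Sp \<and>
    g A (maya N A) = (1 :: 'a) \<and> (\<forall>B\<in>\<Lambda>. q A \<le> q B \<longrightarrow> B \<noteq> A \<longrightarrow> g A (maya N B) = 0)"
  proof (rule choice, rule allI)
    fix A
    show "\<exists>g. A \<in> \<Lambda> \<and> \<not> restr A \<longrightarrow> Ann n g \<and> ev n s g \<in> Sp \<and>
      g (maya N A) = (1 :: 'a) \<and> (\<forall>B\<in>\<Lambda>. q A \<le> q B \<longrightarrow> B \<noteq> A \<longrightarrow> g (maya N B) = 0)"
    proof (cases "A \<in> \<Lambda> \<and> \<not> restr A")
      case True
      then obtain i0 where i0: "i0 \<in> maya N A" "\<And>j. j \<in> maya N A \<Longrightarrow> i0 < j \<Longrightarrow> i0 + int n < j"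
        unfolding restr_def by force
      have A: "A \<subseteq> {..int (s * n)}" "finite A" "card A = s * n" using True by (auto simp: \<Lambda>_def N_def)
      from shuffle_leading_term[OF n s A i0[unfolded N_def], where 'a = 'a]
      show ?thesis unfolding Sp_def q_def \<Lambda>_def N_def[symmetric] by blast
    qed blast
  qed
  then obtain g where g: "\<And>A. A \<in> \<Lambda> \<Longrightarrow> \<not> restr A \<Longrightarrow> Ann n (g A)"
      "\<And>A. A \<in> \<Lambda> \<Longrightarrow> \<not> restr A \<Longrightarrow> ev n s (g A) \<in> Sp"
      "\<And>A. A \<in> \<Lambda> \<Longrightarrow> \<not> restr A \<Longrightarrow> g A (maya N A) = (1 :: 'a)"
      "\<And>A B. A \<in> \<Lambda> \<Longrightarrow> \<not> restr A \<Longrightarrow> B \<in> \<Lambda> \<Longrightarrow> q A \<le> q B \<Longrightarrow> B \<noteq> A \<Longrightarrow> g A (maya N B) = 0"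
    by blast
  \<comment> \<open>Each step lowers the threshold by one. The corrections vanish at all other
    diagrams of \<open>\<Lambda>\<close> of the same or larger square sum, so they neither interfere
    with each other nor with what was achieved before.\<close>
  have "\<exists>b. Ann n b \<and> ev n s b \<in> Sp \<and>
      (\<forall>A\<in>\<Lambda>. M - int d \<le> q A \<longrightarrow> a (maya N A) = b (maya N A))" for d
  proof (induction d)
    case 0
    have "ev n s (\<lambda>_. 0 :: 'a) = 0" by (rule ext) (simp add: ev_def)
    then have "Ann n (\<lambda>_. 0 :: 'a)" "ev n s (\<lambda>_. 0 :: 'a) \<in> Sp"
      by (auto simp: Ann_def ev_def Sp_def form.span_zero)
    then show ?case using M by (intro exI[of _ "\<lambda>_. 0"]) force
  next
    case (Suc d)
    then obtain b where b: "Ann n b" "ev n s b \<in> Sp"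
      and ab: "\<And>A. A \<in> \<Lambda> \<Longrightarrow> M - int d \<le> q A \<Longrightarrow> a (maya N A) = b (maya N A)" by blast
    define X where "X = {A \<in> \<Lambda>. q A = M - int (Suc d) \<and> \<not> restr A}"
    define e where "e A = a (maya N A) - b (maya N A)" for A
    define b' where "b' = (\<lambda>K. b K + (\<Sum>A\<in>X. e A * g A K))"
    have finX: "finite X" using \<open>finite \<Lambda>\<close> by (simp add: X_def)
    have "Ann n b'" unfolding b'_def using b g by (intro Ann_sum) (auto simp: X_def)
    moreover have "ev n s b' \<in> Sp"
      unfolding b'_def ev_sum Sp_def
      using b g by (intro form.span_add form.span_sum form.span_scale) (auto simp: X_def Sp_def)
    moreover have "a (maya N A) = b' (maya N A)" if A: "A \<in> \<Lambda>" "M - int (Suc d) \<le> q A" for A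
    proof -
      have zero: "(\<Sum>C\<in>X - {A}. e C * g C (maya N A)) = 0"
      proof (rule sum.neutral, rule ballI)
        fix C assume "C \<in> X - {A}"
        then have "g C (maya N A) = 0" using A by (intro g(4)) (auto simp: X_def)
        then show "e C * g C (maya N A) = 0" by simp
      qed
      show ?thesis
      proof (cases "A \<in> X")
        case True
        have "(\<Sum>C\<in>X. e C * g C (maya N A)) = e A * g A (maya N A) + (\<Sum>C\<in>X - {A}. e C * g C (maya N A))"
          using finX True by (rule sum.remove)
        also note zero
        finally show ?thesis using True g(3) by (simp add: b'_def e_def X_def)
      next
        case False
        then have "(\<Sum>C\<in>X. e C * g C (maya N A)) = 0" using zero by simp
        then have b'A: "b' (maya N A) = b (maya N A)" by (simp add: b'_def)
        show ?thesis
        proof (cases "M - int d \<le> q A")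
          case True
          then show ?thesis using ab[OF A(1)] b'A by simp
        next
          case False
          then have qA: "q A = M - int (Suc d)" using A by simp
          \<comment> \<open>The difference \<open>a - b\<close> vanishes on all diagrams of larger
            square sum with the sum of \<open>A\<close>, since these lie in \<open>\<Lambda>\<close>
            too; hence it vanishes at the restricted diagram \<open>A\<close> without a
            correction.\<close>
          then have "restr A" using A \<open>A \<notin> X\<close> by (simp add: X_def)
          have "a (maya N A) - b (maya N A) = 0"
          proof (rule restricted_coeff_eq_0[OF n _ _ _ _ Ann_diff[OF a b(1)]])
            show "A \<subseteq> {..int N}" "finite A" "card A = N" using A by (auto simp: \<Lambda>_def)
            show "\<And>i. i \<in> maya N A \<Longrightarrow> \<exists>j\<in>maya N A. i < j \<and> j \<le> i + int n"
              using \<open>restr A\<close> unfolding restr_def by blast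
            fix B assume B: "B \<subseteq> {..int N}" "finite B" "card B = N" "\<Sum>B = \<Sum>A" "(\<Sum>i\<in>A. i\<^sup>2) < (\<Sum>i\<in>B. i\<^sup>2)"
            have "B \<in> \<Lambda>" using B A by (auto simp: \<Lambda>_def)
            moreover have "M - int d \<le> q B" using B(5) qA by (simp add: q_def)
            ultimately show "a (maya N B) - b (maya N B) = 0" using ab by simp
          qed
          then show ?thesis using b'A by simp
        qed
      qed
    qed
    ultimately show ?case by blast
  qed
  from this[of "nat M"] obtain b where b: "Ann n b" "ev n s b \<in> Sp"
    "\<And>A. A \<in> \<Lambda> \<Longrightarrow> a (maya N A) = b (maya N A)" using M0 q0 by auto
  have "I \<in> \<Lambda>" if I: "I \<in> level_sets n s" for I
  proof -
    have "of_nat (card I) * (low n s) \<le> \<Sum>I"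
      using I by (intro sum_bounded_below) (auto simp: level_sets_def level_idx_def)
    then show ?thesis using I level_sets_finite[OF I] level_sets_le[OF I]
      by (auto simp: \<Lambda>_def N_def c_def level_sets_def)
  qed
  then have "ev n s a = ev n s b" using b(3) unfolding ev_def N_def by (intro ext sum.cong) auto
  then show ?thesis using b(2) by (simp add: Sp_def)
qed

lemma ideal1_subset_closed_span:
  assumes n: "n \<ge> 1"
  shows "(ideal1 n :: (nat \<Rightarrow> 'a::alg_closed_field lvec list \<Rightarrow> 'a) set) \<subseteq> closed_span n (shuffle_relations n)"
proof
  fix f :: "nat \<Rightarrow> 'a lvec list \<Rightarrow> 'a" assume f: "f \<in> ideal1 n"
  then have f1: "f \<in> coord_ring1 n" and van: "\<And>s vs. 1 \<le> s \<Longrightarrow> vs \<in> frames n s (Gr_aff n) \<Longrightarrow> f s vs = 0"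
    by (auto simp: ideal1_def)
  define a where "a = coefs n 1 f"
  have ev_a: "ev n s a = f s" if s: "1 \<le> s" for s
    unfolding a_def
    by (rule ev_coefs[of n 1 f s, OF n coord_ring1_tail[OF n f1] s]) (use f1 s in \<open>auto simp: coord_ring1_def\<close>)
  have ann: "Ann n a"
    unfolding Ann_def using ev_a van tframe_frames[OF n] by metis
  have "f s \<in> form.span ((\<lambda>f. f s) ` shuffle_relations n)" if s: "1 \<le> s" for s
  proof (cases "n \<ge> 2")
    case True
    then show ?thesis using Ann_imp_span_shuffles[OF True s ann] ev_a[OF s] by simp
  next
    case False
    \<comment> \<open>Here \<open>low n s\<close> is 1, so every level has a single index set, the
      vacuum, and all forms in the ideal are zero.\<close>
    then have n: "n = 1" using n by simp
    have LS: "I = {1..int s}" if "I \<in> level_sets n s" for I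
    proof (rule card_subset_eq)
      show "I \<subseteq> {1..int s}" "card I = card {1..int s}"
        using that by (auto simp: level_sets_def level_idx_def n)
    qed simp
    have "{1..int s} \<union> {int s<..} = {0<..}" by auto
    then have "a (maya (s * n) I) = 0" if "I \<in> level_sets n s" for I
      using Ann_vacuum[OF _ ann] LS[OF that] n by simp
    then have "ev n s a = 0" by (intro ext) (simp add: ev_def)
    then show ?thesis using ev_a[OF s] form.span_zero by simp
  qed
  then show "f \<in> closed_span n (shuffle_relations n)" using f1 by (simp add: closed_span_def)
qed

theorem theorem4p6p5:
  fixes n :: nat
  assumes "n \<ge> 1"
  shows "(ideal1 n :: (nat \<Rightarrow> 'a::alg_closed_field lvec list \<Rightarrow> 'a) set) =
           closed_span n (shuffle_relations n)"
  using ideal1_subset_closed_span[OF assms] closed_span_subset_ideal1[OF assms] by (rule equalityI)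

end
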